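(* Let $\mathcal{A}$ and $\mathcal{B}$ be (nonzero) analytic operator algebras with $c_0$-isomorphic, separable diagonals, and let $\mathfrak{K}_{\mathcal{A}}$ and $\mathfrak{K}_{\mathcal{B}}$ be operator algebras containing the compact operators. If $\mathcal{A}\otimes\mathfrak{K}_{\mathcal{A}}$ and $\mathcal{B}\otimes\mathfrak{K}_{\mathcal{B}}$ are isometrically isomorphic, then $\operatorname{diag}\mathfrak{K}_{\mathcal{A}}$ and $\operatorname{diag}\mathfrak{K}_{\mathcal{B}}$ are $*$-isomorphic and the algebras $\mathcal{A}$ and $\mathcal{B}$ are bicontinuously isomorphic.
   Context: An operator algebra is a norm-closed (not necessarily selfadjoint) subalgebra of $B(\mathcal{H}_0)$ for some Hilbert space $\mathcal{H}_0$, acting non-degenerately. The diagonal of an operator algebra $\mathcal{A}$ is the $\mathrm{C}^*$-algebra $\operatorname{diag}\mathcal{A}:=\mathcal{A}\cap\mathcal{A}^*$. Standing assumption: every operator algebra has a contractive approximate unit contained in its diagonal. An operator algebra $\mathcal{A}$ has a $c_0$-isomorphic diagonal if there is a (possibly finite) set $\Gamma$ such that $\operatorname{diag}\mathcal{A}$ is $*$-isomorphic to $c_0(\Gamma)$. Fix an infinite-dimensional separable Hilbert space $\mathcal{H}$ with compact operators $\mathcal{K}$; an operator algebra $\mathfrak{K}$ "contains the compact operators" if $\mathfrak{K}$ acts on $\mathcal{H}$ and $\mathcal{K}\subseteq\mathfrak{K}\subseteq B(\mathcal{H})$. For operator algebras $\mathcal{A}_i\subseteq B(\mathcal{H}_i)$,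 $\mathcal{A}_1\otimes\mathcal{A}_2$ is the spatial tensor product: the norm-closed subalgebra of $B(\mathcal{H}_1\otimes\mathcal{H}_2)$ generated by elementary tensors $a_1\otimes a_2$. Analyticity: a discrete ordered abelian group $(G,P)$ is a discrete abelian group $G$ with a subset $P\subseteq G$ such that $P+P\subseteq P$ and $P\cap(-P)=\{e\}$, $e$ the unit of $G$. Given a strongly continuous action $\alpha\colon\hat G\to\operatorname{Aut}(\mathcal{C})$ of the Pontryagin dual $\hat G$ on a $\mathrm{C}^*$-algebra $\mathcal{C}$ by $*$-automorphisms, the Fourier coefficients of $c\in\mathcal{C}$ are $\hat c(s):=\int_{\hat G}\alpha_\gamma(c)\overline{\gamma(s)}\,d\gamma$, $s\in G$ ($d\gamma$ normalized Haar measure), and $E_\alpha(c):=\hat c(e)$. An operator algebra $\mathcal{A}$, generating the $\mathrm{C}^*$-algebra $\mathrm{C}^*(\mathcal{A})$, is analytic if there exist a discrete ordered abelian group $(G,P)$ and a strongly continuous action $\alpha\colon\hat G\to\operatorname{Aut}(\mathrm{C}^*(\mathcal{A}))$ leaving $\mathcal{A}$ invariant such that (i) $\mathcal{A}\subseteq\{a\in\mathrm{C}^*(\mathcal{A}):\hat a(s)=0\text{ for all }s\notin P\}$ and (ii) $\operatorname{diag}\mathcal{A}=E_\alpha(\mathcal{A})$. Isometrically isomorphic means that there is a surjective algebra isomorphism that is isometric; bicontinuously isomorphic means that there is a surjective algebra isomorphism that is bounded with bounded inverse. *)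

theory Defs
  imports "HOL-Analysis.Analysis"
begin

section \<open>Complex normed spaces and Hilbert spaces\<close>

class complex_normed_vector = real_normed_vector +
  fixes scaleC :: "complex \<Rightarrow> 'a \<Rightarrow> 'a"  (infixr \<open>*\<^sub>C\<close> 75)
  assumes scaleC_add_right: "c *\<^sub>C (x + y) = c *\<^sub>C x + c *\<^sub>C y"
    and scaleC_add_left: "(c + d) *\<^sub>C x = c *\<^sub>C x + d *\<^sub>C x"
    and scaleC_scaleC: "c *\<^sub>C d *\<^sub>C x = (c * d) *\<^sub>C x"
    and scaleC_of_real: "complex_of_real r *\<^sub>C x = r *\<^sub>R x"
    and norm_scaleC: "norm (c *\<^sub>C x) = cmod c * norm x"

text \<open>The complex inner product is linear in its first argument. The norm is the one of
  \<^class>\<open>real_inner\<close>, i.e. the square root of \<open>inner x x = Re (cinner x x) = cinner x x\<close>.\<close>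

class chilbert_space = real_inner + banach + complex_normed_vector +
  fixes cinner :: "'a \<Rightarrow> 'a \<Rightarrow> complex"
  assumes cinner_add_left: "cinner (x + y) z = cinner x z + cinner y z"
    and cinner_scaleC_left: "cinner (c *\<^sub>C x) y = c * cinner x y"
    and cinner_commute: "cinner x y = cnj (cinner y x)"
    and inner_eq_Re_cinner: "inner x y = Re (cinner x y)"

instantiation complex :: chilbert_space
begin

definition scaleC_complex :: "complex \<Rightarrow> complex \<Rightarrow> complex"
  where "scaleC_complex c x = c * x"

definition cinner_complex :: "complex \<Rightarrow> complex \<Rightarrow> complex"
  where "cinner_complex x y = x * cnj y"

instance
  by standard
    (auto simp: scaleC_complex_def cinner_complex_def algebra_simps scaleR_conv_of_real
      norm_mult inner_complex_def)

end

definition csubspace :: "'a::complex_normed_vector set \<Rightarrow> bool"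
  where "csubspace S \<longleftrightarrow>
    0 \<in> S \<and> (\<forall>x\<in>S. \<forall>y\<in>S. x + y \<in> S) \<and> (\<forall>c. \<forall>x\<in>S. c *\<^sub>C x \<in> S)"

definition cspan :: "'a::complex_normed_vector set \<Rightarrow> 'a set"
  where "cspan S = csubspace hull S"

definition infinite_dimensional :: "'a::complex_normed_vector itself \<Rightarrow> bool"
  where "infinite_dimensional T \<longleftrightarrow> (\<forall>S::'a set. finite S \<longrightarrow> cspan S \<noteq> UNIV)"


section \<open>Bounded operators\<close>

lemma scaleC_diff_right:
  "c *\<^sub>C (x - y) = c *\<^sub>C x - c *\<^sub>C (y::'a::complex_normed_vector)"
  by (metis add_diff_cancel diff_add_cancel scaleC_add_right)

lemma scaleC_scaleR_commute:
  "c *\<^sub>C r *\<^sub>R x = r *\<^sub>R c *\<^sub>C (x::'a::complex_normed_vector)"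
  by (metis mult.commute scaleC_of_real scaleC_scaleC)

lemma bounded_linear_scaleC: "bounded_linear (\<lambda>x::'a::complex_normed_vector. c *\<^sub>C x)"
  by (rule bounded_linear_intro[where K = "cmod c"])
    (simp_all add: scaleC_add_right scaleC_scaleR_commute norm_scaleC mult.commute)

instantiation blinfun :: (real_normed_vector, complex_normed_vector) complex_normed_vector
begin

lift_definition scaleC_blinfun :: "complex \<Rightarrow> ('a \<Rightarrow>\<^sub>L 'b) \<Rightarrow> ('a \<Rightarrow>\<^sub>L 'b)"
  is "\<lambda>c T x. c *\<^sub>C T x"
  by (rule bounded_linear_compose[OF bounded_linear_scaleC])

instance
proof
  fix c d :: complex and r :: real and S T :: "'a \<Rightarrow>\<^sub>L 'b"
  show "c *\<^sub>C (S + T) = c *\<^sub>C S + c *\<^sub>C T"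
    by transfer (simp add: scaleC_add_right)
  show "(c + d) *\<^sub>C T = c *\<^sub>C T + d *\<^sub>C T"
    by transfer (simp add: scaleC_add_left)
  show "c *\<^sub>C d *\<^sub>C T = (c * d) *\<^sub>C T"
    by transfer (simp add: scaleC_scaleC)
  show "complex_of_real r *\<^sub>C T = r *\<^sub>R T"
    by transfer (simp add: scaleC_of_real)
  have le: "norm (e *\<^sub>C U) \<le> cmod e * norm U" for e and U :: "'a \<Rightarrow>\<^sub>L 'b"
    by (rule norm_blinfun_bound)
      (simp_all add: scaleC_blinfun.rep_eq norm_scaleC mult.assoc mult_left_mono norm_blinfun)
  show "norm (c *\<^sub>C T) = cmod c * norm T"
  proof (cases "c = 0")
    case True
    then show ?thesis
      using le[of 0 T] by simp
  next
    case False
    have "T = inverse c *\<^sub>C c *\<^sub>C T"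
      using False \<open>complex_of_real r *\<^sub>C T = r *\<^sub>R T\<close>
      by (intro blinfun_eqI)
        (simp add: scaleC_blinfun.rep_eq scaleC_scaleC scaleC_of_real[of 1, simplified])
    then have "norm T \<le> norm (c *\<^sub>C T) / cmod c"
      using le[of "inverse c" "c *\<^sub>C T"] by (simp add: norm_inverse divide_inverse mult.commute)
    then show ?thesis
      using le[of c T] False by (simp add: field_simps)
  qed
qed

end

text \<open>The library type \<^typ>\<open>'a \<Rightarrow>\<^sub>L 'a\<close> consists of the bounded real-linear maps; \<open>B(H)\<close> is its
  closed subset of complex-linear maps, with the same (operator) norm.\<close>

definition bounded_ops :: "('a::chilbert_space \<Rightarrow>\<^sub>L 'a) set"  (\<open>\<B>\<close>)
  where "\<B> = {T. \<forall>c x. blinfun_apply T (c *\<^sub>C x) = c *\<^sub>C blinfun_apply T x}"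

definition adj :: "('a::chilbert_space \<Rightarrow>\<^sub>L 'a) \<Rightarrow> ('a \<Rightarrow>\<^sub>L 'a)"
  where "adj T = (THE S. \<forall>x y. cinner (T x) y = cinner x (blinfun_apply S y))"

definition compact_ops :: "('a::chilbert_space \<Rightarrow>\<^sub>L 'a) set"  (\<open>\<K>\<close>)
  where "\<K> = {T \<in> \<B>. compact (closure (blinfun_apply T ` cball 0 1))}"


section \<open>Operator algebras\<close>

definition subalgebra :: "('a::chilbert_space \<Rightarrow>\<^sub>L 'a) set \<Rightarrow> bool"
  where "subalgebra A \<longleftrightarrow> A \<subseteq> \<B> \<and> csubspace A \<and> (\<forall>a\<in>A. \<forall>b\<in>A. a o\<^sub>L b \<in> A)"

definition diag :: "('a::chilbert_space \<Rightarrow>\<^sub>L 'a) set \<Rightarrow> ('a \<Rightarrow>\<^sub>L 'a) set"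
  where "diag A = A \<inter> adj ` A"

definition nondegenerate :: "('a::chilbert_space \<Rightarrow>\<^sub>L 'a) set \<Rightarrow> bool"
  where "nondegenerate A \<longleftrightarrow> closure (cspan {blinfun_apply a x |a x. a \<in> A}) = UNIV"

text \<open>A contractive approximate unit of \<open>A\<close> in \<open>D\<close>; the (tail filter of the) net is
  represented by a proper filter.\<close>

definition has_contractive_approx_unit_in ::
    "('a::chilbert_space \<Rightarrow>\<^sub>L 'a) set \<Rightarrow> ('a \<Rightarrow>\<^sub>L 'a) set \<Rightarrow> bool"
  where "has_contractive_approx_unit_in A D \<longleftrightarrow>
    (\<exists>F. F \<noteq> bot \<and> (\<forall>\<^sub>F e in F. e \<in> D \<and> norm e \<le> 1) \<and>
      (\<forall>a\<in>A. ((\<lambda>e. e o\<^sub>L a) \<longlongrightarrow> a) F \<and> ((\<lambda>e. a o\<^sub>L e) \<longlongrightarrow> a) F))"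

definition operator_algebra :: "('a::chilbert_space \<Rightarrow>\<^sub>L 'a) set \<Rightarrow> bool"
  where "operator_algebra A \<longleftrightarrow>
    subalgebra A \<and> closed A \<and> nondegenerate A \<and> has_contractive_approx_unit_in A (diag A)"

definition contains_compacts :: "('a::chilbert_space \<Rightarrow>\<^sub>L 'a) set \<Rightarrow> bool"
  where "contains_compacts A \<longleftrightarrow> \<K> \<subseteq> A \<and> A \<subseteq> \<B>"

text \<open>The C*-algebra generated by \<open>A\<close>.\<close>

definition cstar :: "('a::chilbert_space \<Rightarrow>\<^sub>L 'a) set \<Rightarrow> ('a \<Rightarrow>\<^sub>L 'a) set"
  where "cstar A = (\<lambda>C. subalgebra C \<and> closed C \<and> adj ` C \<subseteq> C) hull A"


section \<open>Isomorphisms\<close>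

definition algebra_isomorphism ::
    "(('a::chilbert_space \<Rightarrow>\<^sub>L 'a) \<Rightarrow> ('b::chilbert_space \<Rightarrow>\<^sub>L 'b)) \<Rightarrow>
      ('a \<Rightarrow>\<^sub>L 'a) set \<Rightarrow> ('b \<Rightarrow>\<^sub>L 'b) set \<Rightarrow> bool"
  where "algebra_isomorphism \<phi> A B \<longleftrightarrow>
    bij_betw \<phi> A B \<and>
    (\<forall>a\<in>A. \<forall>b\<in>A. \<phi> (a + b) = \<phi> a + \<phi> b) \<and>
    (\<forall>c. \<forall>a\<in>A. \<phi> (c *\<^sub>C a) = c *\<^sub>C \<phi> a) \<and>
    (\<forall>a\<in>A. \<forall>b\<in>A. \<phi> (a o\<^sub>L b) = \<phi> a o\<^sub>L \<phi> b)"

definition star_isomorphism ::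
    "(('a::chilbert_space \<Rightarrow>\<^sub>L 'a) \<Rightarrow> ('b::chilbert_space \<Rightarrow>\<^sub>L 'b)) \<Rightarrow>
      ('a \<Rightarrow>\<^sub>L 'a) set \<Rightarrow> ('b \<Rightarrow>\<^sub>L 'b) set \<Rightarrow> bool"
  where "star_isomorphism \<phi> A B \<longleftrightarrow>
    algebra_isomorphism \<phi> A B \<and> (\<forall>a\<in>A. \<phi> (adj a) = adj (\<phi> a))"

definition star_isomorphic ::
    "('a::chilbert_space \<Rightarrow>\<^sub>L 'a) set \<Rightarrow> ('b::chilbert_space \<Rightarrow>\<^sub>L 'b) set \<Rightarrow> bool"
  where "star_isomorphic A B \<longleftrightarrow> (\<exists>\<phi>. star_isomorphism \<phi> A B)"

definition isometrically_isomorphic ::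
    "('a::chilbert_space \<Rightarrow>\<^sub>L 'a) set \<Rightarrow> ('b::chilbert_space \<Rightarrow>\<^sub>L 'b) set \<Rightarrow> bool"
  where "isometrically_isomorphic A B \<longleftrightarrow>
    (\<exists>\<phi>. algebra_isomorphism \<phi> A B \<and> (\<forall>a\<in>A. norm (\<phi> a) = norm a))"

definition bicontinuously_isomorphic ::
    "('a::chilbert_space \<Rightarrow>\<^sub>L 'a) set \<Rightarrow> ('b::chilbert_space \<Rightarrow>\<^sub>L 'b) set \<Rightarrow> bool"
  where "bicontinuously_isomorphic A B \<longleftrightarrow>
    (\<exists>\<phi>. algebra_isomorphism \<phi> A B \<and>
      (\<exists>M. \<forall>a\<in>A. norm (\<phi> a) \<le> M * norm a) \<and>
      (\<exists>M. \<forall>b\<in>B. norm (inv_into A \<phi> b) \<le> M * norm b))"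

text \<open>\<open>c\<^sub>0(\<Gamma>)\<close>, its elements being extended by \<open>0\<close> outside \<open>\<Gamma>\<close>.\<close>

definition c0 :: "'i set \<Rightarrow> ('i \<Rightarrow> complex) set"
  where "c0 \<Gamma> = {f. (\<forall>i. i \<notin> \<Gamma> \<longrightarrow> f i = 0) \<and> (\<forall>\<epsilon>>0. finite {i \<in> \<Gamma>. \<epsilon> \<le> cmod (f i)})}"

text \<open>The type argument \<^typ>\<open>'i\<close> is the universe from which the index set \<open>\<Gamma>\<close> is taken.\<close>

definition c0_isomorphic_diagonal ::
    "'i itself \<Rightarrow> ('a::chilbert_space \<Rightarrow>\<^sub>L 'a) set \<Rightarrow> bool"
  where "c0_isomorphic_diagonal I A \<longleftrightarrow>
    (\<exists>(\<Gamma>::'i set) \<phi>. bij_betw \<phi> (diag A) (c0 \<Gamma>) \<and>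
      (\<forall>a\<in>diag A. \<forall>b\<in>diag A. \<phi> (a + b) = (\<lambda>i. \<phi> a i + \<phi> b i)) \<and>
      (\<forall>c. \<forall>a\<in>diag A. \<phi> (c *\<^sub>C a) = (\<lambda>i. c * \<phi> a i)) \<and>
      (\<forall>a\<in>diag A. \<forall>b\<in>diag A. \<phi> (a o\<^sub>L b) = (\<lambda>i. \<phi> a i * \<phi> b i)) \<and>
      (\<forall>a\<in>diag A. \<phi> (adj a) = (\<lambda>i. cnj (\<phi> a i))))"


section \<open>Spatial tensor products\<close>

text \<open>\<open>hilbert_tensor t\<close> says that \<^typ>\<open>'c\<close> together with \<open>t x y = x \<otimes> y\<close> is the Hilbert space
  tensor product of \<^typ>\<open>'a\<close> and \<^typ>\<open>'b\<close>. This determines \<^typ>\<open>'c\<close> and \<open>t\<close> up to a unique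
  unitary.\<close>

definition hilbert_tensor ::
    "('a::chilbert_space \<Rightarrow> 'b::chilbert_space \<Rightarrow> 'c::chilbert_space) \<Rightarrow> bool"
  where "hilbert_tensor t \<longleftrightarrow>
    (\<forall>x x' y. t (x + x') y = t x y + t x' y) \<and>
    (\<forall>x y y'. t x (y + y') = t x y + t x y') \<and>
    (\<forall>c x y. t (c *\<^sub>C x) y = c *\<^sub>C t x y) \<and>
    (\<forall>c x y. t x (c *\<^sub>C y) = c *\<^sub>C t x y) \<and>
    (\<forall>x x' y y'. cinner (t x y) (t x' y') = cinner x x' * cinner y y') \<and>
    closure (cspan {t x y |x y. True}) = UNIV"

definition op_tensor ::
    "('a::chilbert_space \<Rightarrow> 'b::chilbert_space \<Rightarrow> 'c::chilbert_space) \<Rightarrow>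
      ('a \<Rightarrow>\<^sub>L 'a) \<Rightarrow> ('b \<Rightarrow>\<^sub>L 'b) \<Rightarrow> ('c \<Rightarrow>\<^sub>L 'c)"
  where "op_tensor t a b = (THE c. c \<in> \<B> \<and> (\<forall>x y. blinfun_apply c (t x y) = t (a x) (b y)))"

definition spatial_tensor ::
    "('a::chilbert_space \<Rightarrow> 'b::chilbert_space \<Rightarrow> 'c::chilbert_space) \<Rightarrow>
      ('a \<Rightarrow>\<^sub>L 'a) set \<Rightarrow> ('b \<Rightarrow>\<^sub>L 'b) set \<Rightarrow> ('c \<Rightarrow>\<^sub>L 'c) set"
  where "spatial_tensor t A B =
    (\<lambda>C. subalgebra C \<and> closed C) hull {op_tensor t a b |a b. a \<in> A \<and> b \<in> B}"


section \<open>Analyticity\<close>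

definition ordered_group_cone :: "'g::ab_group_add set \<Rightarrow> bool"
  where "ordered_group_cone P \<longleftrightarrow> (\<forall>s\<in>P. \<forall>t\<in>P. s + t \<in> P) \<and> P \<inter> uminus ` P = {0}"

text \<open>The Pontryagin dual of the discrete group \<^typ>\<open>'g\<close>. Its topology is that of pointwise
  convergence, i.e. the one inherited from the product topology on \<^typ>\<open>'g \<Rightarrow> complex\<close>.\<close>

definition dual_group :: "('g::ab_group_add \<Rightarrow> complex) set"
  where "dual_group = {\<gamma>. (\<forall>s. cmod (\<gamma> s) = 1) \<and> (\<forall>s t. \<gamma> (s + t) = \<gamma> s * \<gamma> t)}"

text \<open>Regularity is needed for uniqueness, since Borel measures on the dual of an uncountable
  group need not be regular.\<close>

definition normalized_haar :: "('g::ab_group_add \<Rightarrow> complex) measure \<Rightarrow> bool"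
  where "normalized_haar \<mu> \<longleftrightarrow>
    space \<mu> = dual_group \<and>
    sets \<mu> = sets (restrict_space borel dual_group) \<and>
    emeasure \<mu> dual_group = 1 \<and>
    (\<forall>\<gamma>\<in>dual_group. \<forall>X\<in>sets \<mu>. emeasure \<mu> ((\<lambda>\<eta> s. \<gamma> s * \<eta> s) ` X) = emeasure \<mu> X) \<and>
    (\<forall>X\<in>sets \<mu>. emeasure \<mu> X = (SUP K\<in>{K. compact K \<and> K \<subseteq> X}. emeasure \<mu> K))"

text \<open>The vector-valued integral in the weak (Pettis) sense. The Bochner integral of the library is
  only available for second countable target types. For norm-continuous functions on a compact
  space the integral exists and is the usual one.\<close>

definition vector_integral :: "'x measure \<Rightarrow> ('x \<Rightarrow> 'v::real_normed_vector) \<Rightarrow> 'v"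
  where "vector_integral \<mu> f =
    (THE v. \<forall>\<phi>::'v \<Rightarrow>\<^sub>L real. has_bochner_integral \<mu> (\<lambda>x. \<phi> (f x)) (\<phi> v))"

definition dual_action ::
    "(('g::ab_group_add \<Rightarrow> complex) \<Rightarrow> ('a::chilbert_space \<Rightarrow>\<^sub>L 'a) \<Rightarrow> ('a \<Rightarrow>\<^sub>L 'a)) \<Rightarrow>
      ('a \<Rightarrow>\<^sub>L 'a) set \<Rightarrow> bool"
  where "dual_action \<alpha> C \<longleftrightarrow>
    (\<forall>\<gamma>\<in>dual_group. star_isomorphism (\<alpha> \<gamma>) C C) \<and>
    (\<forall>c\<in>C. \<alpha> (\<lambda>_. 1) c = c) \<and>
    (\<forall>\<gamma>\<in>dual_group. \<forall>\<eta>\<in>dual_group. \<forall>c\<in>C. \<alpha> (\<lambda>s. \<gamma> s * \<eta> s) c = \<alpha> \<gamma> (\<alpha> \<eta> c)) \<and>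
    (\<forall>c\<in>C. continuous_on dual_group (\<lambda>\<gamma>. \<alpha> \<gamma> c))"

definition fourier_coeff ::
    "('g::ab_group_add \<Rightarrow> complex) measure \<Rightarrow>
      (('g \<Rightarrow> complex) \<Rightarrow> ('a::chilbert_space \<Rightarrow>\<^sub>L 'a) \<Rightarrow> ('a \<Rightarrow>\<^sub>L 'a)) \<Rightarrow>
      ('a \<Rightarrow>\<^sub>L 'a) \<Rightarrow> 'g \<Rightarrow> ('a \<Rightarrow>\<^sub>L 'a)"
  where "fourier_coeff \<mu> \<alpha> c s = vector_integral \<mu> (\<lambda>\<gamma>. cnj (\<gamma> s) *\<^sub>C \<alpha> \<gamma> c)"

text \<open>The type argument \<^typ>\<open>'g\<close> is the group. The measure \<open>\<mu>\<close> is the Haar measure of its dual,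
  which exists and is unique.\<close>

definition analytic :: "'g::ab_group_add itself \<Rightarrow> ('a::chilbert_space \<Rightarrow>\<^sub>L 'a) set \<Rightarrow> bool"
  where "analytic G A \<longleftrightarrow>
    (\<exists>(P::'g set) \<mu> \<alpha>. ordered_group_cone P \<and> normalized_haar \<mu> \<and>
      dual_action \<alpha> (cstar A) \<and> (\<forall>\<gamma>\<in>dual_group. \<alpha> \<gamma> ` A \<subseteq> A) \<and>
      A \<subseteq> {a \<in> cstar A. \<forall>s. s \<notin> P \<longrightarrow> fourier_coeff \<mu> \<alpha> a s = 0} \<and>
      diag A = (\<lambda>a. fourier_coeff \<mu> \<alpha> a 0) ` A)"

end

theory Submission
  imports Defs
begin

text \<open>The minimal projections \<open>p\<^sub>i\<close> of \<open>diag A = c\<^sub>0(\<Gamma>)\<close> have finite sums that form an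
  approximate unit of \<open>A\<close>; let \<open>q\<^sub>j\<close> be those of \<open>B\<close>. An isometric isomorphism
  \<open>\<phi>\<close> maps contractive idempotents to contractive idempotents, that is, orthogonal
  projections to orthogonal projections. Slicing shows that a projection in the tensor product
  commutes with every \<open>q\<^sub>j \<otimes> 1\<close> and has corners of the form \<open>q\<^sub>j \<otimes> x\<close>. By minimality,
  \<open>\<phi> (p\<^sub>i \<otimes> \<theta>) = q\<^sub>\<sigma>\<^sub>i \<otimes> \<theta>'\<close> for rank-one projections \<open>\<theta>\<close>, where \<open>\<theta>'\<close> is
  again a rank-one projection and \<open>\<sigma>\<close> is a bijection independent of \<open>\<theta>\<close>.

  By polarization, \<open>\<phi> (p\<^sub>i \<otimes> d) = q\<^sub>\<sigma>\<^sub>i \<otimes> \<kappa> d\<close> for all \<open>d\<close>, and \<open>\<kappa>\<close> preserves adjoints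
  because the quadratic forms of \<open>d\<close> and \<open>\<kappa> d\<close> correspond to each other.

  For fixed \<open>\<theta>\<close>, write \<open>\<phi> (p\<^sub>i \<otimes> \<theta>) = q\<^sub>\<sigma>\<^sub>i \<otimes> \<theta>\<^sub>i\<close> and choose unit vectors \<open>f\<^sub>i\<close> in the
  range of \<open>\<theta>\<^sub>i\<close>. With the isometry \<open>T x = (\<Sum>i. q\<^sub>\<sigma>\<^sub>i x \<otimes> f\<^sub>i)\<close>, the map
  \<open>a \<mapsto> T\<^sup>* \<phi> (a \<otimes> \<theta>) T\<close> is an isometric isomorphism of \<open>A\<close> onto \<open>B\<close>.\<close>

text \<open>The map \<phi> is not known to respect adjoints and the algebras are not selfadjoint, so
  only norms, sums and products may be carried across. This is why contractive idempotents are used: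
  their selfadjointness is a metric fact. Elements of a spatial tensor product are mere limits of
  sums of elementary tensors. Slices bring them back into the factors, and slices of a selfadjoint
  element fall into the diagonal, where minimality reduces them to scalars.

  The vectors \<open>f\<^sub>i\<close> vary with the index, so no single \<theta>' need serve all of
  A \<otimes> \<theta>; T absorbs this twist. Its series converges because the first legs are
  orthogonal, whatever the \<open>f\<^sub>i\<close> are. Since T need not belong to any of the
  algebras, membership in B is tested on corners, where T acts like x \<mapsto> x \<otimes>
  \<open>f\<^sub>i\<close>. Compression by T loses nothing: the range projection of T is the strong
  limit of the images of (finite sums of the \<open>p\<^sub>i\<close>) \<otimes> \<theta>, and these
  fix the image of a \<otimes> \<theta> in the limit.\<close>

section \<open>Calculus of complex scalars and the complex inner product\<close>

lemma scaleC_one [simp]: "1 *\<^sub>C x = (x::'a::complex_normed_vector)"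
  using scaleC_of_real[of 1 x] by simp

lemma scaleC_zero_left [simp]: "0 *\<^sub>C x = (0::'a::complex_normed_vector)"
  using scaleC_of_real[of 0 x] by simp

lemma scaleC_zero_right [simp]: "c *\<^sub>C 0 = (0::'a::complex_normed_vector)"
  using norm_scaleC[of c 0] by simp

lemma scaleC_minus_one: "(- 1) *\<^sub>C x = - (x::'a::complex_normed_vector)"
  using scaleC_of_real[of "-1" x] by simp

lemma scaleC_sum_right: "c *\<^sub>C sum f I = (\<Sum>i\<in>I. c *\<^sub>C (f i::'a::complex_normed_vector))"
  by (induction I rule: infinite_finite_induct) (simp_all add: scaleC_add_right)

lemma cinner_add_right: "cinner x (y + z) = cinner x y + cinner x (z::'a::chilbert_space)"
  by (metis cinner_add_left cinner_commute complex_cnj_add)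

lemma cinner_scaleC_right: "cinner x (c *\<^sub>C y) = cnj c * cinner x (y::'a::chilbert_space)"
  by (metis cinner_commute cinner_scaleC_left complex_cnj_mult)

lemma cinner_zero_left [simp]: "cinner 0 (x::'a::chilbert_space) = 0"
  using cinner_scaleC_left[of 0 0 x] by simp

lemma cinner_zero_right [simp]: "cinner (x::'a::chilbert_space) 0 = 0"
  using cinner_scaleC_right[of x 0 0] by simp

lemma cinner_minus_left: "cinner (- x) y = - cinner x (y::'a::chilbert_space)"
  using cinner_scaleC_left[of "-1" x y] by (simp add: scaleC_minus_one)

lemma cinner_minus_right: "cinner x (- y) = - cinner x (y::'a::chilbert_space)"
  using cinner_scaleC_right[of x "-1" y] by (simp add: scaleC_minus_one)

lemma cinner_diff_left: "cinner (x - y) z = cinner x z - cinner y (z::'a::chilbert_space)"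
  using cinner_add_left[of x "-y" z] by (simp add: cinner_minus_left)

lemma cinner_diff_right: "cinner x (y - z) = cinner x y - cinner x (z::'a::chilbert_space)"
  using cinner_add_right[of x y "-z"] by (simp add: cinner_minus_right)

lemma cinner_scaleR_left: "cinner (r *\<^sub>R x) y = of_real r * cinner x (y::'a::chilbert_space)"
  by (metis cinner_scaleC_left scaleC_of_real)

lemma cinner_sum_left: "cinner (sum f I) y = (\<Sum>i\<in>I. cinner (f i) (y::'a::chilbert_space))"
  by (induction I rule: infinite_finite_induct) (simp_all add: cinner_add_left)

lemma cinner_sum_right: "cinner y (sum f I) = (\<Sum>i\<in>I. cinner y (f i::'a::chilbert_space))"
  by (induction I rule: infinite_finite_induct) (simp_all add: cinner_add_right)

lemmas cinner_simps = cinner_add_left cinner_add_right cinner_scaleC_left cinner_scaleC_right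
  cinner_diff_left cinner_diff_right cinner_minus_left cinner_minus_right

lemma cinner_self: "cinner x x = of_real ((norm (x::'a::chilbert_space))\<^sup>2)"
proof (rule complex_eqI)
  show "Re (cinner x x) = Re (of_real ((norm x)\<^sup>2))"
    using inner_eq_Re_cinner[of x x] by (simp add: power2_norm_eq_inner)
  have "Im (cinner x x) = - Im (cinner x x)"
    using arg_cong[OF cinner_commute[of x x], of Im] by simp
  then show "Im (cinner x x) = Im (of_real ((norm x)\<^sup>2))" by simp
qed

lemma cinner_self_eq_0 [simp]: "cinner x x = 0 \<longleftrightarrow> x = (0::'a::chilbert_space)"
  by (simp add: cinner_self)

lemma cinner_self_unit: "norm (x::'a::chilbert_space) = 1 \<Longrightarrow> cinner x x = 1"
  by (simp add: cinner_self)

text \<open>The imaginary part is itself a real inner product, so results on real Hilbert spaces,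
  adjoints in particular, transfer to \<open>cinner\<close>.\<close>

lemma cinner_eq_inner: "cinner x y = Complex (inner x y) (inner x (\<i> *\<^sub>C (y::'a::chilbert_space)))"
  by (rule complex_eqI) (simp_all add: inner_eq_Re_cinner cinner_scaleC_right)

lemma cinner_eqI: "(\<And>y. cinner x y = cinner x' y) \<Longrightarrow> x = (x'::'a::chilbert_space)"
  by (metis cinner_diff_left cinner_self_eq_0 eq_iff_diff_eq_0)

text \<open>Rotating \<open>x\<close> by the phase \<open>c\<close> makes the inner product real and
  nonnegative without changing the norm; the real Cauchy-Schwarz inequality then applies.\<close>

lemma norm_cinner_le: "cmod (cinner x y) \<le> norm x * norm (y::'a::chilbert_space)"
proof (cases "cinner x y = 0")
  case False
  define c where "c = cnj (sgn (cinner x y))"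
  have c: "cmod c = 1" using False by (simp add: c_def norm_sgn)
  have "c * cinner x y = of_real (cmod (cinner x y))"
    using complex_norm_square[of "cinner x y"] False
    by (simp add: c_def mult.commute sgn_div_norm scaleR_conv_of_real field_simps power2_eq_square)
  then have "cmod (cinner x y) = inner (c *\<^sub>C x) y"
    by (simp add: inner_eq_Re_cinner cinner_scaleC_left)
  also have "\<dots> \<le> norm (c *\<^sub>C x) * norm y" by (rule norm_cauchy_schwarz)
  finally show ?thesis by (simp add: norm_scaleC c)
qed auto

lemma norm_unit_scale_exists:
  fixes x :: "'a::chilbert_space"
  assumes "x \<noteq> 0"
  obtains f where "norm f = 1" "x = of_real (norm x) *\<^sub>C f"
  by (rule that[of "x /\<^sub>R norm x"]) (use assms in \<open>simp_all add: scaleC_of_real\<close>)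

section \<open>Complex-linear bounded operators\<close>

text \<open>\<open>\<B>\<close> covers only endomorphisms, whereas slices and the twisting isometry
  involve maps between different spaces.\<close>

definition clin :: "('a::complex_normed_vector \<Rightarrow>\<^sub>L 'b::complex_normed_vector) \<Rightarrow> bool"
  where "clin T \<longleftrightarrow> (\<forall>c x. blinfun_apply T (c *\<^sub>C x) = c *\<^sub>C blinfun_apply T x)"

lemma bounded_ops_iff_clin: "T \<in> \<B> \<longleftrightarrow> clin T"
  by (simp add: bounded_ops_def clin_def)

lemma clinD: "clin T \<Longrightarrow> blinfun_apply T (c *\<^sub>C x) = c *\<^sub>C blinfun_apply T x"
  by (simp add: clin_def)

lemma clin_compose: "clin S \<Longrightarrow> clin T \<Longrightarrow> clin (S o\<^sub>L T)"
  by (simp add: clin_def)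

lemma clin_add: "clin S \<Longrightarrow> clin T \<Longrightarrow> clin (S + T)"
  by (simp add: clin_def blinfun.add_left scaleC_add_right)

lemma clin_zero: "clin 0"
  by (simp add: clin_def)

lemma clin_diff: "clin S \<Longrightarrow> clin T \<Longrightarrow> clin (S - T)"
  by (simp add: clin_def blinfun.diff_left scaleC_diff_right)

lemma clin_scaleC: "clin T \<Longrightarrow> clin (c *\<^sub>C T)"
  by (simp add: clin_def scaleC_blinfun.rep_eq scaleC_scaleC mult.commute)

lemma clin_sum: "(\<And>i. i \<in> I \<Longrightarrow> clin (T i)) \<Longrightarrow> clin (sum T I)"
  by (induction I rule: infinite_finite_induct) (simp_all add: clin_add clin_zero)

lemma clin_id: "clin id_blinfun"
  by (simp add: clin_def)

lemma closed_clin: "closed {T::'a::complex_normed_vector \<Rightarrow>\<^sub>L 'b::complex_normed_vector. clin T}"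
proof -
  have "{T::'a \<Rightarrow>\<^sub>L 'b. clin T} = (\<Inter>c. \<Inter>x. {T. blinfun_apply T (c *\<^sub>C x) = c *\<^sub>C blinfun_apply T x})"
    by (auto simp: clin_def)
  also have "closed \<dots>"
    by (intro closed_INT ballI closed_Collect_eq blinfun.continuous_on continuous_on_id continuous_on_const
      continuous_intros bounded_linear.continuous_on[OF bounded_linear_scaleC])
  finally show ?thesis .
qed

lemma scaleC_compose_left: "(c *\<^sub>C S) o\<^sub>L T = c *\<^sub>C (S o\<^sub>L T)"
  by (rule blinfun_eqI) (simp add: scaleC_blinfun.rep_eq)

lemma scaleC_compose_right: "clin S \<Longrightarrow> S o\<^sub>L (c *\<^sub>C T) = c *\<^sub>C (S o\<^sub>L T)"
  by (rule blinfun_eqI) (simp add: scaleC_blinfun.rep_eq clinD)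

lemma add_compose: "(S + T) o\<^sub>L R = (S o\<^sub>L R) + (T o\<^sub>L R)"
  by (rule blinfun_eqI) (simp add: blinfun.add_left)

lemma compose_add: "R o\<^sub>L (S + T) = (R o\<^sub>L S) + (R o\<^sub>L T)"
  by (rule blinfun_eqI) (simp add: blinfun.add_left blinfun.add_right)

lemma diff_compose: "(S - T) o\<^sub>L R = (S o\<^sub>L R) - (T o\<^sub>L R)"
  by (rule blinfun_eqI) (simp add: blinfun.diff_left)

lemma sum_compose: "sum f I o\<^sub>L R = (\<Sum>i\<in>I. f i o\<^sub>L R)"
  by (induction I rule: infinite_finite_induct) (simp_all add: add_compose)

lemma compose_sum: "R o\<^sub>L sum f I = (\<Sum>i\<in>I. R o\<^sub>L f i)"
  by (induction I rule: infinite_finite_induct) (simp_all add: compose_add)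

lemma compose_id [simp]: "T o\<^sub>L id_blinfun = T" "id_blinfun o\<^sub>L T = T"
  by (rule blinfun_eqI; simp)+

lemma compose_assoc: "(R o\<^sub>L S) o\<^sub>L T = R o\<^sub>L (S o\<^sub>L T)"
  by (rule blinfun_eqI) simp

section \<open>Complex subspaces, their closures and spans\<close>

lemma csubspace_sum: "csubspace S \<Longrightarrow> (\<And>i. i \<in> I \<Longrightarrow> f i \<in> S) \<Longrightarrow> sum f I \<in> S"
  by (induction I rule: infinite_finite_induct) (simp_all add: csubspace_def)

lemma csubspace_diff: "csubspace S \<Longrightarrow> x \<in> S \<Longrightarrow> y \<in> S \<Longrightarrow> x - y \<in> S"
  unfolding csubspace_def by (metis add_uminus_conv_diff scaleC_minus_one)

lemma csubspace_imp_subspace: "csubspace S \<Longrightarrow> subspace S"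
  unfolding csubspace_def subspace_def by (metis scaleC_of_real)

lemma subspace_closure:
  fixes S :: "'a::real_normed_vector set"
  assumes "subspace S" shows "subspace (closure S)"
proof -
  have "x + y \<in> closure S" if xy: "x \<in> closure S" "y \<in> closure S" for x y
  proof -
    obtain f g where f: "\<And>n. f n \<in> S" "f \<longlonglongrightarrow> x" and g: "\<And>n. g n \<in> S" "g \<longlonglongrightarrow> y"
      using xy unfolding closure_sequential by blast
    have "(\<lambda>n. f n + g n) \<longlonglongrightarrow> x + y" by (intro tendsto_add f g)
    moreover have "f n + g n \<in> S" for n using assms f g by (simp add: subspace_add)
    ultimately show ?thesis
      unfolding closure_sequential by (intro exI[of _ "\<lambda>n. f n + g n"]) simp
  qed
  moreover have "r *\<^sub>R x \<in> closure S" if "x \<in> closure S" for r x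
  proof -
    have "(\<lambda>x. r *\<^sub>R x) ` closure S \<subseteq> closure ((\<lambda>x. r *\<^sub>R x) ` S)"
      by (rule closure_bounded_linear_image_subset[OF bounded_linear_scaleR_right])
    also have "\<dots> \<subseteq> closure S"
      using assms by (intro closure_mono) (auto simp: subspace_def)
    finally show ?thesis using that by auto
  qed
  moreover have "0 \<in> closure S" using assms closure_subset by (auto simp: subspace_def)
  ultimately show ?thesis by (simp add: subspace_def)
qed

lemma csubspace_closure:
  assumes "csubspace S" shows "csubspace (closure S)"
proof -
  have "subspace (closure S)"
    using assms by (intro subspace_closure csubspace_imp_subspace)
  moreover have "c *\<^sub>C x \<in> closure S" if "x \<in> closure S" for c x
  proof -
    have "(\<lambda>x. c *\<^sub>C x) ` closure S \<subseteq> closure ((\<lambda>x. c *\<^sub>C x) ` S)"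
      by (rule closure_bounded_linear_image_subset[OF bounded_linear_scaleC])
    also have "\<dots> \<subseteq> closure S"
      using assms by (intro closure_mono) (auto simp: csubspace_def)
    finally show ?thesis using that by auto
  qed
  ultimately show ?thesis by (simp add: csubspace_def subspace_def)
qed

lemma csubspace_cspan: "csubspace (cspan S)"
  unfolding cspan_def by (rule hull_in) (auto simp: csubspace_def)

lemma cspan_base: "x \<in> S \<Longrightarrow> x \<in> cspan S"
  unfolding cspan_def by (rule hull_inc)

lemma cspan_minimal: "S \<subseteq> T \<Longrightarrow> csubspace T \<Longrightarrow> cspan S \<subseteq> T"
  unfolding cspan_def by (rule hull_minimal)

text \<open>A generating set that absorbs complex scalars has a complex-invariant real span. Density
  and induction arguments can then run over real spans.\<close>

lemma cspan_eq_span: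
  assumes "\<And>c x. x \<in> S \<Longrightarrow> c *\<^sub>C x \<in> S"
  shows "cspan S = span S"
proof
  have "c *\<^sub>C x \<in> span S" if "x \<in> span S" for c x
    using that
  proof (induction rule: span_induct_alt)
    case base show ?case by (simp add: span_zero)
  next
    case (step r x y)
    then show ?case
      by (simp add: scaleC_add_right scaleC_scaleR_commute span_add span_scale span_base assms)
  qed
  then show "cspan S \<subseteq> span S"
    by (intro cspan_minimal) (auto simp: csubspace_def span_base span_zero span_add)
  show "span S \<subseteq> cspan S"
    by (intro span_minimal csubspace_imp_subspace csubspace_cspan) (auto intro: cspan_base)
qed

section \<open>Adjoints\<close>

lemma parallelogram:
  fixes x y :: "'a::real_inner"
  shows "(norm (x - y))\<^sup>2 = 2 * (norm x)\<^sup>2 + 2 * (norm y)\<^sup>2 - (norm (x + y))\<^sup>2"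
  by (simp add: power2_norm_eq_inner inner_simps inner_commute)

text \<open>The parallelogram law compares two near-minimisers with their midpoint, whose norm is
  bounded below. Hence a minimising sequence is Cauchy, and closure under midpoints is all the
  convexity required.\<close>

lemma midpoint_convex_minimal_norm:
  fixes S :: "'a::{real_inner,banach} set"
  assumes "closed S" "S \<noteq> {}" and mid: "\<And>x y. x \<in> S \<Longrightarrow> y \<in> S \<Longrightarrow> (1/2) *\<^sub>R (x + y) \<in> S"
  obtains z where "z \<in> S" "\<And>x. x \<in> S \<Longrightarrow> norm z \<le> norm x"
proof -
  define m where "m = (INF x\<in>S. (norm x)\<^sup>2)"
  have bdd: "bdd_below ((\<lambda>x. (norm x)\<^sup>2) ` S)" by (rule bdd_belowI[of _ 0]) auto
  have m_le: "m \<le> (norm x)\<^sup>2" if "x \<in> S" for x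
    unfolding m_def using bdd that by (rule cINF_lower)
  have "\<exists>x\<in>S. (norm x)\<^sup>2 < m + inverse (real (Suc n))" for n
  proof (rule ccontr)
    assume "\<not> ?thesis"
    then have "m + inverse (real (Suc n)) \<le> m"
      unfolding m_def using assms(2) by (intro cINF_greatest) (auto simp: not_less)
    then show False by simp
  qed
  then obtain u where u: "\<And>n. u n \<in> S" "\<And>n. (norm (u n))\<^sup>2 < m + inverse (real (Suc n))" by metis
  \<comment> \<open>The lower bound \<open>4 * m\<close> for the squared norm of the sum cancels the
    two terms \<open>2 * m\<close> of the near-minimisers; only their errors remain.\<close>
  have dist: "(dist (u i) (u j))\<^sup>2 \<le> 2 * inverse (real (Suc i)) + 2 * inverse (real (Suc j))" for i j
  proof -
    have "4 * m \<le> 4 * (norm ((1/2) *\<^sub>R (u i + u j)))\<^sup>2"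
      using m_le[OF mid[OF u(1) u(1)]] by simp
    also have "\<dots> = (norm (u i + u j))\<^sup>2" by (simp add: power2_eq_square)
    finally show ?thesis
      using u(2)[of i] u(2)[of j] by (simp add: dist_norm parallelogram)
  qed
  have "Cauchy u"
  proof (rule metric_CauchyI)
    fix e :: real assume e: "0 < e"
    then obtain n where n: "inverse (real (Suc n)) < e\<^sup>2 / 4"
      using reals_Archimedean[of "e\<^sup>2/4"] by auto
    have "dist (u i) (u j) < e" if "n \<le> i" "n \<le> j" for i j
    proof -
      have "inverse (real (Suc i)) \<le> inverse (real (Suc n))" "inverse (real (Suc j)) \<le> inverse (real (Suc n))"
        using that by (auto intro!: le_imp_inverse_le)
      then have "(dist (u i) (u j))\<^sup>2 < e\<^sup>2" using dist[of i j] n by linarith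
      then show ?thesis using e by (meson less_imp_le power2_less_imp_less)
    qed
    then show "\<exists>M. \<forall>i\<ge>M. \<forall>j\<ge>M. dist (u i) (u j) < e" by blast
  qed
  then obtain z where z: "u \<longlonglongrightarrow> z" using Cauchy_convergent_iff convergent_def by blast
  have "z \<in> S" using closed_sequentially[OF assms(1)] u(1) z by blast
  moreover have "(norm z)\<^sup>2 \<le> m"
  proof -
    have "(\<lambda>n. m + inverse (real (Suc n))) \<longlonglongrightarrow> m + 0"
      by (intro tendsto_intros LIMSEQ_inverse_real_of_nat)
    moreover have "(\<lambda>n. (norm (u n))\<^sup>2) \<longlonglongrightarrow> (norm z)\<^sup>2" by (intro tendsto_intros z)
    ultimately show ?thesis using u(2) by (intro LIMSEQ_le[where Y = "\<lambda>n. m + inverse (real (Suc n))"]) (auto intro: less_imp_le)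
  qed
  then have "(norm z)\<^sup>2 \<le> (norm x)\<^sup>2" if "x \<in> S" for x using m_le[OF that] by linarith
  then have "norm z \<le> norm x" if "x \<in> S" for x using that by (meson norm_ge_zero power2_le_imp_le)
  ultimately show ?thesis by (intro that[of z]) auto
qed

text \<open>The shortest vector \<open>z\<close> of the hyperplane where \<open>f\<close> is 1 is
  perpendicular to the kernel of \<open>f\<close>; dividing it by its squared norm gives the
  representing vector.\<close>

lemma riesz_representation:
  fixes f :: "'a::{real_inner,banach} \<Rightarrow> real"
  assumes "bounded_linear f"
  shows "\<exists>z. \<forall>x. f x = inner x z"
proof (cases "\<forall>x. f x = 0")
  case True then show ?thesis by (intro exI[of _ 0]) simp
next
  case False
  interpret f: bounded_linear f by fact
  from False obtain w where w: "f w \<noteq> 0" by blast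
  let ?S = "{x. f x = 1}"
  have "closed ?S"
    by (intro closed_Collect_eq f.continuous_on continuous_on_id continuous_on_const)
  moreover have "w /\<^sub>R f w \<in> ?S" using w by (simp add: f.scaleR)
  then have "?S \<noteq> {}" by blast
  ultimately obtain z where z: "f z = 1" "\<And>x. f x = 1 \<Longrightarrow> norm z \<le> norm x"
    by (rule midpoint_convex_minimal_norm) (auto simp: f.scaleR f.add)
  have orth: "inner h z = 0" if "f h = 0" for h
  proof (rule ccontr)
    assume ne: "inner h z \<noteq> 0"
    then have h: "inner h h > 0" by auto
    \<comment> \<open>This \<open>s\<close> minimises the norm of \<open>z - s *\<^sub>R h\<close>.
      Moving along the kernel stays in the hyperplane, so a nonzero \<open>inner h z\<close> would
      produce a shorter vector than \<open>z\<close>.\<close>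
    define s where "s = inner h z / inner h h"
    have "f (z - s *\<^sub>R h) = 1" by (simp add: f.diff f.scaleR that z)
    then have "(norm z)\<^sup>2 \<le> (norm (z - s *\<^sub>R h))\<^sup>2" using z(2) by (simp add: power_mono)
    also have "\<dots> = (norm z)\<^sup>2 - 2 * s * inner h z + s * (s * inner h h)"
      by (simp add: power2_norm_eq_inner inner_simps inner_commute algebra_simps)
    also have "s * inner h h = inner h z" using h by (simp add: s_def)
    finally have "s * inner h z \<le> 0" by simp
    moreover have "s * inner h z = (inner h z)\<^sup>2 / inner h h" by (simp add: s_def power2_eq_square)
    moreover have "(inner h z)\<^sup>2 / inner h h > 0" using h ne by simp
    ultimately show False by simp
  qed
  have zz: "inner z z \<noteq> 0" using z(1) f.zero by auto
  have "f x = inner x (z /\<^sub>R inner z z)" for x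
  proof -
    have "inner (x - f x *\<^sub>R z) z = 0" by (rule orth) (simp add: f.diff f.scaleR z)
    then show ?thesis using zz by (simp add: inner_simps divide_simps)
  qed
  then show ?thesis by blast
qed

lemma inner_adjoint_exists:
  fixes T :: "'a::{real_inner,banach} \<Rightarrow>\<^sub>L 'b::real_inner"
  shows "\<exists>S::'b \<Rightarrow>\<^sub>L 'a. \<forall>x y. inner (T x) y = inner x (blinfun_apply S y)"
proof -
  have "bounded_linear (\<lambda>x. inner (T x) y)" for y
    by (rule bounded_linear_compose[OF bounded_linear_inner_left blinfun.bounded_linear_right])
  from riesz_representation[OF this] obtain S where S: "\<And>y x. inner (T x) y = inner x (S y)" by metis
  have bl: "bounded_linear S"
  proof (rule bounded_linear_intro[where K = "norm T"])
    show "S (x + y) = S x + S y" for x y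
      by (rule vector_eq_ldot[THEN iffD1]) (simp add: S[symmetric] inner_add_right)
    show "S (r *\<^sub>R x) = r *\<^sub>R S x" for r x
      by (rule vector_eq_ldot[THEN iffD1]) (simp add: S[symmetric])
    show "norm (S y) \<le> norm y * norm T" for y
    proof -
      have "norm (S y) * norm (S y) = inner (T (S y)) y"
        by (simp only: S power2_norm_eq_inner[symmetric] power2_eq_square)
      also have "\<dots> \<le> norm (T (S y)) * norm y" by (rule norm_cauchy_schwarz)
      also have "\<dots> \<le> norm T * norm (S y) * norm y" by (intro mult_right_mono norm_blinfun) auto
      finally show ?thesis by (cases "norm (S y) = 0") (auto simp: mult_ac)
    qed
  qed
  then show ?thesis
    using S by (intro exI[of _ "Blinfun S"]) (simp add: bounded_linear_Blinfun_apply)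
qed

text \<open>In contrast to \<open>adj\<close>, the two spaces may differ. The real adjoint of a complex-linear
  operator is its complex adjoint.\<close>

definition hadj :: "('a::chilbert_space \<Rightarrow>\<^sub>L 'b::chilbert_space) \<Rightarrow> ('b \<Rightarrow>\<^sub>L 'a)"
  where "hadj T = (SOME S. \<forall>x y. inner (blinfun_apply T x) y = inner x (blinfun_apply S y))"

lemma inner_hadj: "inner (blinfun_apply T x) y = inner x (hadj T y)"
  unfolding hadj_def using someI_ex[OF inner_adjoint_exists[of T]] by blast

text \<open>The imaginary part is a real inner product against \<open>\<i> *\<^sub>C y\<close>.
  Complex linearity of \<open>T\<close> moves this factor to the other side, where the real adjoint
  applies.\<close>

lemma cinner_hadj:
  assumes "clin T" shows "cinner (blinfun_apply T x) y = cinner x (hadj T y)"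
proof -
  have *: "cinner u (\<i> *\<^sub>C v) = cinner ((-\<i>) *\<^sub>C u) v" for u v :: "'c::chilbert_space"
    by (simp add: cinner_simps)
  have "inner (T x) (\<i> *\<^sub>C y) = inner (T ((-\<i>) *\<^sub>C x)) y"
    by (simp only: inner_eq_Re_cinner * clinD[OF assms])
  also have "\<dots> = inner x (\<i> *\<^sub>C hadj T y)"
    by (simp only: inner_hadj) (simp only: inner_eq_Re_cinner *)
  finally show ?thesis by (simp add: cinner_eq_inner inner_hadj)
qed

lemma cinner_hadj': "clin T \<Longrightarrow> cinner (hadj T x) y = cinner x (blinfun_apply T y)"
  using cinner_hadj[of T y x] by (simp add: cinner_commute[of _ x] cinner_commute[of _ "hadj T x"])

lemma clin_hadj: "clin T \<Longrightarrow> clin (hadj T)"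
  unfolding clin_def[of "hadj T"]
  by (intro allI, rule cinner_eqI) (simp add: cinner_hadj' cinner_simps)

lemma hadj_eqI:
  assumes "clin T" "\<And>x y. cinner (blinfun_apply T x) y = cinner x (blinfun_apply S y)"
  shows "hadj T = S"
proof (rule blinfun_eqI, rule cinner_eqI)
  fix x y
  show "cinner (hadj T x) y = cinner (S x) y"
    using arg_cong[OF assms(2)[of y x], of cnj] by (simp add: cinner_hadj'[OF assms(1)] cinner_commute[symmetric])
qed

lemma hadj_hadj: "clin T \<Longrightarrow> hadj (hadj T) = T"
  by (rule hadj_eqI) (simp_all add: clin_hadj cinner_hadj')

lemma hadj_compose: "clin S \<Longrightarrow> clin T \<Longrightarrow> hadj (S o\<^sub>L T) = hadj T o\<^sub>L hadj S"
  by (rule hadj_eqI) (simp_all add: clin_compose cinner_hadj)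

lemma hadj_zero [simp]: "hadj 0 = 0"
  by (rule hadj_eqI) (simp_all add: clin_zero)

lemma hadj_add: "clin S \<Longrightarrow> clin T \<Longrightarrow> hadj (S + T) = hadj S + hadj T"
  by (rule hadj_eqI) (simp_all add: clin_add cinner_hadj blinfun.add_left cinner_simps)

lemma hadj_scaleC: "clin T \<Longrightarrow> hadj (c *\<^sub>C T) = cnj c *\<^sub>C hadj T"
  by (rule hadj_eqI) (simp_all add: clin_scaleC cinner_hadj scaleC_blinfun.rep_eq cinner_simps)

lemma hadj_id: "hadj id_blinfun = id_blinfun"
  by (rule hadj_eqI) (simp_all add: clin_id)

lemma norm_hadj_le: "norm (hadj T) \<le> norm T"
proof (rule norm_blinfun_bound)
  fix y
  have "norm (hadj T y) * norm (hadj T y) = inner (T (hadj T y)) y"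
    by (simp only: inner_hadj[of T "hadj T y" y] power2_norm_eq_inner[symmetric] power2_eq_square)
  also have "\<dots> \<le> norm (T (hadj T y)) * norm y" by (rule norm_cauchy_schwarz)
  also have "\<dots> \<le> norm T * norm (hadj T y) * norm y" by (intro mult_right_mono norm_blinfun) auto
  finally show "norm (hadj T y) \<le> norm T * norm y"
    by (cases "norm (hadj T y) = 0") (auto simp: mult_ac)
qed simp

text \<open>Settles existence and uniqueness behind the definite description in \<open>adj\<close>,
  so that all later work can use \<open>hadj\<close>.\<close>

lemma adj_eq_hadj: "T \<in> \<B> \<Longrightarrow> adj T = hadj T"
  unfolding adj_def
proof (rule the_equality)
  assume T: "T \<in> \<B>"
  then show "\<forall>x y. cinner (T x) y = cinner x (hadj T y)"
    by (simp add: bounded_ops_iff_clin cinner_hadj)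
  fix S assume "\<forall>x y. cinner (T x) y = cinner x (blinfun_apply S y)"
  with T show "S = hadj T" by (intro hadj_eqI[symmetric]) (auto simp: bounded_ops_iff_clin)
qed

lemma mem_diag_iff:
  assumes "A \<subseteq> \<B>" shows "d \<in> diag A \<longleftrightarrow> d \<in> A \<and> hadj d \<in> A"
proof
  have *: "adj a = hadj a" "hadj (hadj a) = a" if "a \<in> A" for a
    using assms that by (auto simp: adj_eq_hadj hadj_hadj bounded_ops_iff_clin)
  show "d \<in> A \<and> hadj d \<in> A" if "d \<in> diag A"
    using that * unfolding diag_def by auto
  show "d \<in> diag A" if "d \<in> A \<and> hadj d \<in> A"
  proof -
    have "adj (hadj d) = d" using that * by metis
    then show ?thesis using that unfolding diag_def by (metis IntI imageI)
  qed
qed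

text \<open>If range and kernel were not perpendicular, subtracting from \<open>P x\<close> its
  component along a kernel vector would shorten it, yet \<open>P\<close> would still send the result
  to \<open>P x\<close>, against contractivity. Selfadjointness of an idempotent is thus visible to
  an isometric isomorphism.\<close>

lemma contractive_idempotent_selfadjoint:
  assumes P: "clin P" "P o\<^sub>L P = P" "norm P \<le> 1"
  shows "hadj P = P"
proof -
  have PP: "P (P x) = P x" for x using P(2) by (metis blinfun_apply_blinfun_compose)
  have orth: "inner (P x) z = 0" if z: "P z = 0" for x z
  proof (rule ccontr)
    assume ne: "inner (P x) z \<noteq> 0"
    then have zz: "inner z z > 0" by auto
    define s where "s = inner (P x) z / inner z z"
    have "P (P x - s *\<^sub>R z) = P x" by (simp add: blinfun.diff_right blinfun.scaleR_right z PP)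
    then have "norm (P x) \<le> norm (P x - s *\<^sub>R z)"
      by (metis P(3) norm_blinfun mult_left_le_one_le norm_ge_zero order_trans)
    then have "(norm (P x))\<^sup>2 \<le> (norm (P x - s *\<^sub>R z))\<^sup>2" by (simp add: power_mono)
    also have "\<dots> = (norm (P x))\<^sup>2 - 2 * s * inner (P x) z + s * (s * inner z z)"
      by (simp add: power2_norm_eq_inner inner_simps inner_commute algebra_simps)
    also have "s * inner z z = inner (P x) z" using zz by (simp add: s_def)
    finally have "s * inner (P x) z \<le> 0" by simp
    moreover have "s * inner (P x) z = (inner (P x) z)\<^sup>2 / inner z z" by (simp add: s_def power2_eq_square)
    moreover have "(inner (P x) z)\<^sup>2 / inner z z > 0" using zz ne by simp
    ultimately show False by simp
  qed
  have "P x = hadj P x" for x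
  proof (rule vector_eq_ldot[THEN iffD1], rule allI)
    fix y
    have "inner (P y) (x - P x) = 0" by (rule orth) (simp add: blinfun.diff_right PP)
    moreover have "inner (P x) (y - P y) = 0" by (rule orth) (simp add: blinfun.diff_right PP)
    ultimately show "inner y (P x) = inner y (hadj P x)"
      by (simp add: inner_diff_right inner_hadj[symmetric] inner_commute)
  qed
  then show ?thesis by (metis blinfun_eqI)
qed

section \<open>Rank-one operators\<close>

definition rank1 :: "'b::chilbert_space \<Rightarrow> 'a::chilbert_space \<Rightarrow> ('a \<Rightarrow>\<^sub>L 'b)"
  where "rank1 \<xi> \<eta> = Blinfun (\<lambda>x. cinner x \<eta> *\<^sub>C \<xi>)"

lemma rank1_apply: "blinfun_apply (rank1 \<xi> \<eta>) x = cinner x \<eta> *\<^sub>C \<xi>"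
proof -
  have "bounded_linear (\<lambda>x. cinner x \<eta> *\<^sub>C \<xi>)"
  proof (rule bounded_linear_intro[where K = "norm \<eta> * norm \<xi>"])
    fix x
    show "norm (cinner x \<eta> *\<^sub>C \<xi>) \<le> norm x * (norm \<eta> * norm \<xi>)"
      using mult_right_mono[OF norm_cinner_le[of x \<eta>], of "norm \<xi>"]
      by (simp add: norm_scaleC mult_ac)
  qed (simp_all add: cinner_simps scaleC_add_left cinner_scaleR_left scaleC_scaleC[symmetric] scaleC_of_real)
  then show ?thesis by (simp add: rank1_def bounded_linear_Blinfun_apply)
qed

lemma clin_rank1: "clin (rank1 \<xi> \<eta>)"
  by (simp add: clin_def rank1_apply cinner_simps scaleC_scaleC)

lemma hadj_rank1: "hadj (rank1 \<xi> \<eta>) = rank1 \<eta> \<xi>"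
proof (rule hadj_eqI[OF clin_rank1])
  fix x y
  show "cinner (rank1 \<xi> \<eta> x) y = cinner x (rank1 \<eta> \<xi> y)"
    using cinner_commute[of \<xi> y] by (simp add: rank1_apply cinner_simps)
qed

lemma compose_rank1: "clin T \<Longrightarrow> T o\<^sub>L rank1 \<xi> \<eta> = rank1 (blinfun_apply T \<xi>) \<eta>"
  by (rule blinfun_eqI) (simp add: rank1_apply clinD)

lemma scaleC_rank1: "c *\<^sub>C rank1 \<xi> \<eta> = rank1 (c *\<^sub>C \<xi>) \<eta>"
  by (rule blinfun_eqI) (simp add: rank1_apply scaleC_blinfun.rep_eq scaleC_scaleC mult.commute)

lemma rank1_scaleC: "rank1 \<xi> (c *\<^sub>C \<eta>) = cnj c *\<^sub>C rank1 \<xi> \<eta>"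
  by (rule blinfun_eqI) (simp add: rank1_apply scaleC_blinfun.rep_eq scaleC_scaleC cinner_simps)

lemma rank1_rank1: "rank1 \<xi> \<eta> o\<^sub>L rank1 \<xi>' \<eta>' = cinner \<xi>' \<eta> *\<^sub>C rank1 \<xi> \<eta>'"
  by (simp add: compose_rank1 clin_rank1 rank1_apply scaleC_rank1)

lemma norm_rank1_le: "norm (rank1 \<xi> \<eta>) \<le> norm \<xi> * norm \<eta>"
proof (rule norm_blinfun_bound)
  fix x show "norm (rank1 \<xi> \<eta> x) \<le> norm \<xi> * norm \<eta> * norm x"
    using mult_right_mono[OF norm_cinner_le[of x \<eta>], of "norm \<xi>"]
    by (simp add: rank1_apply norm_scaleC mult_ac)
qed simp

text \<open>Sesquilinear polarization: statements that are linear in the operator pass from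
  multiples of rank-one projections to all rank-one operators.\<close>

lemma rank1_polarization:
  "4 *\<^sub>C rank1 \<xi> \<eta> = rank1 (\<xi> + \<eta>) (\<xi> + \<eta>) - rank1 (\<xi> - \<eta>) (\<xi> - \<eta>)
    + \<i> *\<^sub>C rank1 (\<xi> + \<i> *\<^sub>C \<eta>) (\<xi> + \<i> *\<^sub>C \<eta>) - \<i> *\<^sub>C rank1 (\<xi> - \<i> *\<^sub>C \<eta>) (\<xi> - \<i> *\<^sub>C \<eta>)"
proof (rule blinfun_eqI, rule cinner_eqI)
  fix x y
  show "cinner ((4 *\<^sub>C rank1 \<xi> \<eta>) x) y = cinner ((rank1 (\<xi> + \<eta>) (\<xi> + \<eta>) - rank1 (\<xi> - \<eta>) (\<xi> - \<eta>)
    + \<i> *\<^sub>C rank1 (\<xi> + \<i> *\<^sub>C \<eta>) (\<xi> + \<i> *\<^sub>C \<eta>) - \<i> *\<^sub>C rank1 (\<xi> - \<i> *\<^sub>C \<eta>) (\<xi> - \<i> *\<^sub>C \<eta>)) x) y"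
    by (simp add: blinfun.add_left blinfun.diff_left scaleC_blinfun.rep_eq rank1_apply cinner_simps)
      (simp add: algebra_simps)
qed

text \<open>The unit ball lands in the image of a closed disc of scalars under
  \<open>c \<mapsto> c *\<^sub>C \<xi>\<close>, which is compact.\<close>

lemma rank1_compact: "rank1 \<xi> \<eta> \<in> \<K>"
proof -
  let ?C = "(\<lambda>c. c *\<^sub>C \<xi>) ` cball 0 (norm \<eta>)"
  have "continuous_on (cball 0 (norm \<eta>)) (\<lambda>c. c *\<^sub>C \<xi>)"
  proof -
    have "bounded_linear (\<lambda>c. c *\<^sub>C \<xi>)"
      by (rule bounded_linear_intro[where K = "norm \<xi>"])
        (simp_all add: scaleC_add_left norm_scaleC scaleR_conv_of_real scaleC_scaleC[symmetric] scaleC_of_real)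
    then show ?thesis by (rule linear_continuous_on)
  qed
  then have C: "compact ?C" by (rule compact_continuous_image) (rule compact_cball)
  have "blinfun_apply (rank1 \<xi> \<eta>) ` cball 0 1 \<subseteq> ?C"
  proof
    fix z assume "z \<in> blinfun_apply (rank1 \<xi> \<eta>) ` cball 0 1"
    then obtain x where x: "norm x \<le> 1" "z = cinner x \<eta> *\<^sub>C \<xi>" by (auto simp: rank1_apply)
    have "cmod (cinner x \<eta>) \<le> 1 * norm \<eta>"
      by (rule order_trans[OF norm_cinner_le mult_right_mono[OF x(1) norm_ge_zero]])
    then show "z \<in> ?C" using x by auto
  qed
  then have "closure (blinfun_apply (rank1 \<xi> \<eta>) ` cball 0 1) \<subseteq> ?C"
    using C by (simp add: closure_minimal compact_imp_closed)
  then have "compact (closure (blinfun_apply (rank1 \<xi> \<eta>) ` cball 0 1))"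
    using compact_Int_closed[OF C closed_closure[of "blinfun_apply (rank1 \<xi> \<eta>) ` cball 0 1"]]
    by (simp add: inf.absorb2)
  then show ?thesis by (simp add: compact_ops_def bounded_ops_iff_clin clin_rank1)
qed

section \<open>Tensor products of operators\<close>

text \<open>A densely defined bounded operator is given by its graph; this avoids choosing
  representations of the vectors in its domain.\<close>

lemma bounded_linear_from_dense_graph:
  fixes G :: "('a::real_normed_vector \<times> 'b::banach) set"
  assumes G: "subspace G" and C: "0 \<le> C" and bound: "\<And>u v. (u, v) \<in> G \<Longrightarrow> norm v \<le> C * norm u"
    and dense: "closure (fst ` G) = UNIV"
  obtains T :: "'a \<Rightarrow>\<^sub>L 'b" where "\<And>u v. (u, v) \<in> G \<Longrightarrow> blinfun_apply T u = v" "norm T \<le> C"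
proof -
  let ?H = "closure G"
  have H: "subspace ?H" by (rule subspace_closure[OF G])
  have "closed {p::'a \<times> 'b. norm (snd p) \<le> C * norm (fst p)}"
    by (intro closed_Collect_le continuous_intros)
  then have "?H \<subseteq> {p. norm (snd p) \<le> C * norm (fst p)}"
    using bound by (intro closure_minimal) auto
  then have Hb: "norm v \<le> C * norm u" if "(u, v) \<in> ?H" for u v using that by auto
  \<comment> \<open>The bound, applied to the difference \<open>(0, v - v')\<close>, shows that the
    closure is still a graph.\<close>
  have uniq: "v = v'" if "(u, v) \<in> ?H" "(u, v') \<in> ?H" for u v v'
    using Hb[of 0 "v - v'"] subspace_diff[OF H that] by simp
  have ex: "\<exists>v. (u, v) \<in> ?H" for u
  proof -
    have "u \<in> closure (fst ` G)" using dense by simp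
    then obtain f where f: "\<And>n. f n \<in> fst ` G" "f \<longlonglongrightarrow> u" unfolding closure_sequential by blast
    then have "\<exists>v. (f n, v) \<in> G" for n by (metis imageE prod.collapse)
    then obtain g where g: "\<And>n. (f n, g n) \<in> G" by metis
    have "Cauchy g"
    proof (rule metric_CauchyI)
      fix e :: real assume e: "0 < e"
      have "Cauchy f" using f(2) by (rule LIMSEQ_imp_Cauchy)
      \<comment> \<open>\<open>C + 1\<close> in place of \<open>C\<close> avoids a division by zero
        when \<open>C = 0\<close>.\<close>
      moreover have "0 < e / (C + 1)" using e C by simp
      ultimately obtain M where M: "\<And>m n. m \<ge> M \<Longrightarrow> n \<ge> M \<Longrightarrow> dist (f m) (f n) < e / (C + 1)"
        using metric_CauchyD by metis
      have "dist (g m) (g n) < e" if "m \<ge> M" "n \<ge> M" for m n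
      proof -
        have "norm (g m - g n) \<le> C * norm (f m - f n)"
          using subspace_diff[OF G g[of m] g[of n]] by (intro bound) simp
        also have "\<dots> \<le> (C + 1) * norm (f m - f n)" by (intro mult_right_mono) auto
        also have "\<dots> < (C + 1) * (e / (C + 1))"
          using M[OF that] C by (intro mult_strict_left_mono) (auto simp: dist_norm)
        also have "\<dots> = e" using C by simp
        finally show ?thesis by (simp add: dist_norm)
      qed
      then show "\<exists>M. \<forall>m\<ge>M. \<forall>n\<ge>M. dist (g m) (g n) < e" by blast
    qed
    then obtain v where "g \<longlonglongrightarrow> v" using Cauchy_convergent_iff convergent_def by blast
    then have "(\<lambda>n. (f n, g n)) \<longlonglongrightarrow> (u, v)" using f(2) by (intro tendsto_Pair)
    then have "(u, v) \<in> ?H"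
      unfolding closure_sequential using g by (intro exI[of _ "\<lambda>n. (f n, g n)"]) auto
    then show ?thesis by blast
  qed
  define T where "T u = (THE v. (u, v) \<in> ?H)" for u
  have T: "(u, T u) \<in> ?H" for u
    unfolding T_def using ex[of u] uniq by (metis (mono_tags, lifting) theI)
  have Teq: "T u = v" if "(u, v) \<in> ?H" for u v using uniq that T by blast
  have bl: "bounded_linear T"
  proof (rule bounded_linear_intro[where K = C])
    show "T (x + y) = T x + T y" for x y using subspace_add[OF H T[of x] T[of y]] by (intro Teq) simp
    show "T (r *\<^sub>R x) = r *\<^sub>R T x" for r x using subspace_scale[OF H T[of x], of r] by (intro Teq) simp
    show "norm (T x) \<le> norm x * C" for x using Hb[OF T[of x]] by (simp add: mult.commute)
  qed
  show ?thesis
  proof (rule that[of "Blinfun T"])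
    show "blinfun_apply (Blinfun T) u = v" if "(u, v) \<in> G" for u v
      using that closure_subset[of G] by (auto simp: bounded_linear_Blinfun_apply[OF bl] intro: Teq)
    show "norm (Blinfun T) \<le> C"
      by (rule norm_blinfun_bound) (simp_all add: C bounded_linear_Blinfun_apply[OF bl] Hb T)
  qed
qed

locale tensor_space =
  fixes t :: "'a::chilbert_space \<Rightarrow> 'b::chilbert_space \<Rightarrow> 'c::chilbert_space"
  assumes hilbert_tensor: "hilbert_tensor t"
begin

lemma t_add_left: "t (x + x') y = t x y + t x' y"
  and t_add_right: "t x (y + y') = t x y + t x y'"
  and t_scaleC_left: "t (c *\<^sub>C x) y = c *\<^sub>C t x y"
  and t_scaleC_right: "t x (c *\<^sub>C y) = c *\<^sub>C t x y"
  and cinner_t: "cinner (t x y) (t x' y') = cinner x x' * cinner y y'"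
  using hilbert_tensor unfolding hilbert_tensor_def by blast+

lemma t_scaleR_left: "t (r *\<^sub>R x) y = r *\<^sub>R t x y"
  and t_scaleR_right: "t x (r *\<^sub>R y) = r *\<^sub>R t x y"
  by (metis t_scaleC_left scaleC_of_real) (metis t_scaleC_right scaleC_of_real)

lemma t_zero_left [simp]: "t 0 y = 0" and t_zero_right [simp]: "t x 0 = 0"
  using t_scaleC_left[of 0 0 y] t_scaleC_right[of x 0 0] by simp_all

lemma t_sum_right: "t x (sum f I) = (\<Sum>i\<in>I. t x (f i))"
  by (induction I rule: infinite_finite_induct) (simp_all add: t_add_right)

lemma norm_t: "norm (t x y) = norm x * norm y"
proof -
  have "complex_of_real ((norm (t x y))\<^sup>2) = of_real ((norm x * norm y)\<^sup>2)"
    using cinner_t[of x y x y] by (simp add: cinner_self power_mult_distrib)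
  then have "(norm (t x y))\<^sup>2 = (norm x * norm y)\<^sup>2" using of_real_eq_iff by blast
  then show ?thesis by (rule power2_eq_imp_eq) simp_all
qed

text \<open>With the factors exchanged, the construction of a \<otimes> 1 also yields 1 \<otimes>
  b.\<close>

lemma tensor_space_flip: "tensor_space (\<lambda>y x. t x y)"
proof
  have "{t x y |y x. True} = {t x y |x y. True}" by auto
  then show "hilbert_tensor (\<lambda>y x. t x y)"
    using hilbert_tensor unfolding hilbert_tensor_def by (simp add: mult.commute)
qed

lemma dense_span: "closure (span {t x y |x y. True}) = UNIV"
proof -
  have "cspan {t x y |x y. True} = span {t x y |x y. True}"
    by (rule cspan_eq_span) (auto, metis t_scaleC_left)
  then show ?thesis using hilbert_tensor unfolding hilbert_tensor_def by simp
qed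

text \<open>Only real linearity is asked for, so that complex linearity itself can be proved by
  comparing \<open>u \<mapsto> T (c *\<^sub>C u)\<close> with
  \<open>u \<mapsto> c *\<^sub>C T u\<close>.\<close>

lemma bounded_linear_ext:
  fixes f g :: "'c \<Rightarrow> 'd::real_normed_vector"
  assumes f: "bounded_linear f" and g: "bounded_linear g" and eq: "\<And>x y. f (t x y) = g (t x y)"
  shows "f = g"
proof
  fix z
  interpret f: bounded_linear f by fact
  interpret g: bounded_linear g by fact
  have "span {t x y |x y. True} \<subseteq> {z. f z = g z}"
    by (rule span_minimal) (auto simp: eq subspace_def f.add g.add f.scaleR g.scaleR f.zero g.zero)
  moreover have "closed {z. f z = g z}"
    by (intro closed_Collect_eq f.continuous_on g.continuous_on continuous_on_id)
  ultimately show "f z = g z" using closure_minimal[of _ "{z. f z = g z}"] dense_span by blast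
qed

lemma blinfun_ext: "(\<And>x y. blinfun_apply S (t x y) = blinfun_apply T (t x y)) \<Longrightarrow> S = T"
  using bounded_linear_ext[OF blinfun.bounded_linear_right blinfun.bounded_linear_right]
  by (metis blinfun_apply_inject)

lemma vec_ext:
  assumes "\<And>x y. cinner z (t x y) = cinner z' (t x y)" shows "z = z'"
proof -
  have "bounded_linear (\<lambda>u. inner z u)" "bounded_linear (\<lambda>u. inner z' u)"
    by (rule bounded_linear_inner_right)+
  then have "(\<lambda>u. inner z u) = (\<lambda>u. inner z' u)"
    by (rule bounded_linear_ext) (simp add: inner_eq_Re_cinner assms)
  then show ?thesis using vector_eq_rdot[of z z'] by metis
qed

lemma clinI:
  assumes "\<And>c x y. blinfun_apply T (c *\<^sub>C t x y) = c *\<^sub>C blinfun_apply T (t x y)"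
  shows "clin T"
  unfolding clin_def
proof (intro allI)
  fix c u
  have "(\<lambda>u. blinfun_apply T (c *\<^sub>C u)) = (\<lambda>u. c *\<^sub>C blinfun_apply T u)"
    by (rule bounded_linear_ext)
      (auto intro!: bounded_linear_compose[OF blinfun.bounded_linear_right bounded_linear_scaleC]
        bounded_linear_compose[OF bounded_linear_scaleC blinfun.bounded_linear_right] simp: assms)
  then show "blinfun_apply T (c *\<^sub>C u) = c *\<^sub>C blinfun_apply T u" by metis
qed

definition orthonormal :: "'b set \<Rightarrow> bool"
  where "orthonormal E \<longleftrightarrow> finite E \<and> (\<forall>e\<in>E. \<forall>e'\<in>E. cinner e e' = (if e = e' then 1 else 0))"

lemma norm_orthonormal_sum:
  assumes "orthonormal E"
  shows "(norm (\<Sum>e\<in>E. t (g e) e))\<^sup>2 = (\<Sum>e\<in>E. (norm (g e))\<^sup>2)"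
proof -
  have E: "finite E" "\<And>e e'. e \<in> E \<Longrightarrow> e' \<in> E \<Longrightarrow> cinner e e' = (if e = e' then 1 else 0)"
    using assms by (auto simp: orthonormal_def)
  have "cinner (\<Sum>e\<in>E. t (g e) e) (\<Sum>e\<in>E. t (g e) e) = (\<Sum>e\<in>E. \<Sum>e'\<in>E. cinner (g e) (g e') * cinner e e')"
    by (simp only: cinner_sum_left) (simp only: cinner_sum_right cinner_t)
  also have "\<dots> = (\<Sum>e\<in>E. \<Sum>e'\<in>E. if e = e' then cinner (g e) (g e') else 0)"
    by (intro sum.cong) (auto simp: E(2))
  also have "\<dots> = of_real (\<Sum>e\<in>E. (norm (g e))\<^sup>2)"
    using E(1) by (simp add: cinner_self)
  finally show ?thesis unfolding cinner_self using of_real_eq_iff by blast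
qed

text \<open>One Gram-Schmidt step in the second leg: the part of \<open>y\<close> in the span of
  \<open>E\<close> is absorbed into the coefficients, and a nonzero remainder contributes one new
  unit vector. As \<open>a\<close> is linear, the same new coefficients serve both sums.\<close>

lemma orthonormal_form_step:
  fixes a :: "'a \<Rightarrow>\<^sub>L 'a"
  assumes a: "clin a" and E: "orthonormal E"
  shows "\<exists>E' g'. orthonormal E' \<and> (\<Sum>e\<in>E. t (g e) e) + t x y = (\<Sum>e\<in>E'. t (g' e) e) \<and>
    (\<Sum>e\<in>E. t (a (g e)) e) + t (a x) y = (\<Sum>e\<in>E'. t (a (g' e)) e)"
proof -
  have fin: "finite E" and on: "\<And>e e'. e \<in> E \<Longrightarrow> e' \<in> E \<Longrightarrow> cinner e e' = (if e = e' then 1 else 0)"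
    using E by (auto simp: orthonormal_def)
  define r where "r = y - (\<Sum>e\<in>E. cinner y e *\<^sub>C e)"
  have y: "y = (\<Sum>e\<in>E. cinner y e *\<^sub>C e) + r" by (simp add: r_def)
  have orth: "cinner r e = 0" if "e \<in> E" for e
  proof -
    have "cinner (\<Sum>e\<in>E. cinner y e *\<^sub>C e) e = (\<Sum>e'\<in>E. if e' = e then cinner y e' else 0)"
      unfolding cinner_sum_left by (intro sum.cong) (auto simp: cinner_simps on that)
    then show ?thesis using fin that by (simp add: r_def cinner_simps)
  qed
  define g' where "g' e = g e + cinner y e *\<^sub>C x" for e
  have ty: "t z y = (\<Sum>e\<in>E. t (cinner y e *\<^sub>C z) e) + t z r" for z
    by (subst y) (simp add: t_add_right t_sum_right t_scaleC_left t_scaleC_right)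
  have 1: "(\<Sum>e\<in>E. t (g e) e) + t x y = (\<Sum>e\<in>E. t (g' e) e) + t x r"
    unfolding ty[of x] g'_def by (simp add: t_add_left sum.distrib)
  have 2: "(\<Sum>e\<in>E. t (a (g e)) e) + t (a x) y = (\<Sum>e\<in>E. t (a (g' e)) e) + t (a x) r"
    unfolding ty[of "a x"] g'_def by (simp add: t_add_left sum.distrib blinfun.add_right clinD[OF a])
  show ?thesis
  proof (cases "r = 0")
    case True
    then show ?thesis using E 1 2 by (intro exI[of _ E] exI[of _ g']) simp
  next
    case False
    then obtain e0 where e0: "norm e0 = 1" "r = of_real (norm r) *\<^sub>C e0" by (rule norm_unit_scale_exists)
    have o: "cinner e0 e = 0" if "e \<in> E" for e
      using orth[OF that] False e0(2) by (metis cinner_scaleC_left mult_eq_0_iff norm_eq_zero of_real_eq_0_iff)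
    then have o': "cinner e e0 = 0" if "e \<in> E" for e
      using that by (metis cinner_commute complex_cnj_zero)
    have notin: "e0 \<notin> E" using o[of e0] e0(1) by (auto simp: cinner_self)
    define h where "h = g'(e0 := norm r *\<^sub>R x)"
    have "t x r = t (h e0) e0" "t (a x) r = t (a (h e0)) e0"
      by (subst e0(2); simp add: h_def scaleC_of_real t_scaleR_left t_scaleR_right blinfun.scaleR_right)+
    moreover have "(\<Sum>e\<in>E. t (g' e) e) = (\<Sum>e\<in>E. t (h e) e)" "(\<Sum>e\<in>E. t (a (g' e)) e) = (\<Sum>e\<in>E. t (a (h e)) e)"
      using notin by (auto simp: h_def intro!: sum.cong)
    moreover have "orthonormal (insert e0 E)"
      using fin on o o' e0(1) notin by (auto simp: orthonormal_def cinner_self)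
    ultimately show ?thesis
      using 1 2 fin notin by (intro exI[of _ "insert e0 E"] exI[of _ h]) (simp add: add.commute)
  qed
qed

text \<open>With orthonormal second legs, Pythagoras reduces the bound to
  \<open>norm (a (g e)) \<le> norm a * norm (g e)\<close> term by term. Putting both coordinates of
  a graph element in this form at once gives boundedness and well-definedness together.\<close>

lemma tensor_left_exists:
  fixes a :: "'a \<Rightarrow>\<^sub>L 'a"
  assumes a: "clin a"
  obtains T where "clin T" "\<And>x y. blinfun_apply T (t x y) = t (a x) y" "norm T \<le> norm a"
proof -
  let ?G = "span {(t x y, t (a x) y) |x y. True}"
  have form: "\<exists>E g. orthonormal E \<and> fst p = (\<Sum>e\<in>E. t (g e) e) \<and> snd p = (\<Sum>e\<in>E. t (a (g e)) e)"
    if "p \<in> ?G" for p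
    using that
  proof (induction rule: span_induct_alt)
    case base
    show ?case by (intro exI[of _ "{}"]) (simp add: orthonormal_def)
  next
    case (step c p q)
    then obtain x y where p: "p = (t x y, t (a x) y)" by blast
    from step obtain E g where Eg: "orthonormal E" "fst q = (\<Sum>e\<in>E. t (g e) e)" "snd q = (\<Sum>e\<in>E. t (a (g e)) e)"
      by blast
    show ?case
      using orthonormal_form_step[OF a Eg(1), of g "c *\<^sub>R x" y]
      by (simp add: p Eg t_scaleR_left blinfun.scaleR_right add.commute)
  qed
  have bound: "norm v \<le> norm a * norm u" if "(u, v) \<in> ?G" for u v
  proof -
    from form[OF that] obtain E g where Eg: "orthonormal E" "u = (\<Sum>e\<in>E. t (g e) e)" "v = (\<Sum>e\<in>E. t (a (g e)) e)"
      by auto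
    have "(norm v)\<^sup>2 = (\<Sum>e\<in>E. (norm (a (g e)))\<^sup>2)"
      unfolding Eg(3) by (rule norm_orthonormal_sum[OF Eg(1)])
    also have "\<dots> \<le> (\<Sum>e\<in>E. (norm a * norm (g e))\<^sup>2)"
      by (intro sum_mono power_mono norm_blinfun) simp
    also have "\<dots> = (norm a)\<^sup>2 * (norm u)\<^sup>2"
      unfolding Eg(2) norm_orthonormal_sum[OF Eg(1)] by (simp add: power_mult_distrib sum_distrib_left)
    finally show ?thesis
      by (subst (asm) power_mult_distrib[symmetric], elim power2_le_imp_le) simp
  qed
  have "span (fst ` {(t x y, t (a x) y) |x y. True}) = fst ` ?G"
    by (rule linear_span_image) (rule linear_fst)
  moreover have "fst ` {(t x y, t (a x) y) |x y. True} = {t x y |x y. True}" by force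
  ultimately have dense: "closure (fst ` ?G) = UNIV" using dense_span by simp
  obtain T where T: "\<And>u v. (u, v) \<in> ?G \<Longrightarrow> blinfun_apply T u = v" "norm T \<le> norm a"
    using bounded_linear_from_dense_graph[OF subspace_span norm_ge_zero bound dense] by blast
  have Tt: "blinfun_apply T (t x y) = t (a x) y" for x y by (rule T(1)) (auto intro: span_base)
  moreover have "clin T"
  proof (rule clinI)
    show "T (c *\<^sub>C t x y) = c *\<^sub>C T (t x y)" for c x y
      using Tt[of "c *\<^sub>C x" y] by (simp add: Tt clinD[OF a] t_scaleC_left)
  qed
  ultimately show ?thesis using that T(2) by blast
qed

text \<open>The product of a \<otimes> 1 and 1 \<otimes> b, the latter taken from the flipped space,
  realises the definite description; totality of the elementary tensors makes it unique.\<close>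

lemma op_tensor:
  assumes a: "clin a" and b: "clin b"
  shows clin_op_tensor: "clin (op_tensor t a b)"
    and op_tensor_apply: "\<And>x y. blinfun_apply (op_tensor t a b) (t x y) = t (a x) (b y)"
    and norm_op_tensor_le: "norm (op_tensor t a b) \<le> norm a * norm b"
proof -
  obtain S where S: "clin S" "\<And>x y. blinfun_apply S (t x y) = t (a x) y" "norm S \<le> norm a"
    using tensor_left_exists[OF a] by blast
  obtain T where T: "clin T" "\<And>x y. blinfun_apply T (t x y) = t x (b y)" "norm T \<le> norm b"
    by (rule tensor_space.tensor_left_exists[OF tensor_space_flip b]) (rule that)
  have "op_tensor t a b = S o\<^sub>L T"
    unfolding op_tensor_def
  proof (rule the_equality)
    show "S o\<^sub>L T \<in> \<B> \<and> (\<forall>x y. blinfun_apply (S o\<^sub>L T) (t x y) = t (a x) (b y))"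
      by (simp add: bounded_ops_iff_clin clin_compose S T)
    show "c = S o\<^sub>L T" if "c \<in> \<B> \<and> (\<forall>x y. blinfun_apply c (t x y) = t (a x) (b y))" for c
      using that by (intro blinfun_ext) (simp add: S T)
  qed
  moreover have "norm (S o\<^sub>L T) \<le> norm a * norm b"
    by (rule order_trans[OF norm_blinfun_compose mult_mono[OF S(3) T(3)]]) simp_all
  ultimately show "clin (op_tensor t a b)" "norm (op_tensor t a b) \<le> norm a * norm b"
    "\<And>x y. blinfun_apply (op_tensor t a b) (t x y) = t (a x) (b y)"
    by (simp_all add: clin_compose S T)
qed

abbreviation op_tensor_infix (infixr "\<otimes>" 75) where "a \<otimes> b \<equiv> op_tensor t a b"

lemma op_tensor_compose:
  "clin a \<Longrightarrow> clin b \<Longrightarrow> clin c \<Longrightarrow> clin d \<Longrightarrow> (a \<otimes> b) o\<^sub>L (c \<otimes> d) = (a o\<^sub>L c) \<otimes> (b o\<^sub>L d)"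
  by (rule blinfun_ext) (simp add: op_tensor_apply clin_compose)

lemma op_tensor_add_left:
  "clin a \<Longrightarrow> clin b \<Longrightarrow> clin c \<Longrightarrow> (a + b) \<otimes> c = a \<otimes> c + b \<otimes> c"
  by (rule blinfun_ext) (simp add: op_tensor_apply clin_add blinfun.add_left t_add_left)

lemma op_tensor_add_right:
  "clin a \<Longrightarrow> clin b \<Longrightarrow> clin c \<Longrightarrow> a \<otimes> (b + c) = a \<otimes> b + a \<otimes> c"
  by (rule blinfun_ext) (simp add: op_tensor_apply clin_add blinfun.add_left t_add_right)

lemma op_tensor_scaleC_left: "clin a \<Longrightarrow> clin b \<Longrightarrow> (c *\<^sub>C a) \<otimes> b = c *\<^sub>C (a \<otimes> b)"
  by (rule blinfun_ext) (simp add: op_tensor_apply clin_scaleC scaleC_blinfun.rep_eq t_scaleC_left)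

lemma op_tensor_scaleC_right: "clin a \<Longrightarrow> clin b \<Longrightarrow> a \<otimes> (c *\<^sub>C b) = c *\<^sub>C (a \<otimes> b)"
  by (rule blinfun_ext) (simp add: op_tensor_apply clin_scaleC scaleC_blinfun.rep_eq t_scaleC_right)

lemma op_tensor_zero_left: "clin b \<Longrightarrow> 0 \<otimes> b = 0"
  by (rule blinfun_ext) (simp add: op_tensor_apply clin_zero)

lemma op_tensor_zero_right: "clin b \<Longrightarrow> b \<otimes> 0 = 0"
  by (rule blinfun_ext) (simp add: op_tensor_apply clin_zero)

lemma op_tensor_diff_left:
  "clin a \<Longrightarrow> clin b \<Longrightarrow> clin c \<Longrightarrow> clin (a - b) \<Longrightarrow> (a - b) \<otimes> c = a \<otimes> c - b \<otimes> c"
  using op_tensor_add_left[of "a - b" b c] by simp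

lemma op_tensor_sum_left:
  "finite I \<Longrightarrow> (\<And>i. i \<in> I \<Longrightarrow> clin (a i)) \<Longrightarrow> clin b \<Longrightarrow> sum a I \<otimes> b = (\<Sum>i\<in>I. a i \<otimes> b)"
  by (induction I rule: finite_induct) (simp_all add: op_tensor_zero_left op_tensor_add_left clin_sum)

lemma hadj_op_tensor: "clin a \<Longrightarrow> clin b \<Longrightarrow> hadj (a \<otimes> b) = hadj a \<otimes> hadj b"
proof (rule hadj_eqI[OF clin_op_tensor])
  assume ab: "clin a" "clin b"
  fix z w
  have "hadj (a \<otimes> b) = hadj a \<otimes> hadj b"
    by (rule blinfun_ext, rule vec_ext)
      (simp add: cinner_hadj' ab clin_op_tensor op_tensor_apply clin_hadj cinner_t)
  then show "cinner ((a \<otimes> b) z) w = cinner z ((hadj a \<otimes> hadj b) w)"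
    by (metis cinner_hadj clin_op_tensor ab)
qed

section \<open>Slice maps\<close>

definition tensR :: "'b \<Rightarrow> ('a \<Rightarrow>\<^sub>L 'c)" where "tensR y = Blinfun (\<lambda>x. t x y)"

definition tensL :: "'a \<Rightarrow> ('b \<Rightarrow>\<^sub>L 'c)" where "tensL x = Blinfun (\<lambda>y. t x y)"

lemma tensR_apply [simp]: "blinfun_apply (tensR y) x = t x y"
  unfolding tensR_def
  by (subst bounded_linear_Blinfun_apply)
    (auto intro!: bounded_linear_intro[where K = "norm y"] simp: t_add_left t_scaleR_left norm_t)

lemma tensL_apply [simp]: "blinfun_apply (tensL x) y = t x y"
  unfolding tensL_def
  by (subst bounded_linear_Blinfun_apply)
    (auto intro!: bounded_linear_intro[where K = "norm x"] simp: t_add_right t_scaleR_right norm_t)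

lemma clin_tensR: "clin (tensR y)" and clin_tensL: "clin (tensL x)"
  by (simp_all add: clin_def t_scaleC_left t_scaleC_right)

text \<open>The slice maps \<open>id \<otimes> \<omega>\<close> and \<open>\<omega> \<otimes> id\<close> for the vector functionals
  \<open>\<omega> = \<langle>\<cdot> \<xi>, \<eta>\<rangle>\<close>.\<close>

definition sliceL :: "'b \<Rightarrow> 'b \<Rightarrow> ('c \<Rightarrow>\<^sub>L 'c) \<Rightarrow> ('a \<Rightarrow>\<^sub>L 'a)"
  where "sliceL \<xi> \<eta> X = hadj (tensR \<eta>) o\<^sub>L (X o\<^sub>L tensR \<xi>)"

definition sliceR :: "'a \<Rightarrow> 'a \<Rightarrow> ('c \<Rightarrow>\<^sub>L 'c) \<Rightarrow> ('b \<Rightarrow>\<^sub>L 'b)"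
  where "sliceR v w X = hadj (tensL w) o\<^sub>L (X o\<^sub>L tensL v)"

lemma cinner_sliceL: "cinner (sliceL \<xi> \<eta> X x) y = cinner (X (t x \<xi>)) (t y \<eta>)"
  by (simp add: sliceL_def cinner_hadj' clin_tensR)

lemma cinner_sliceR: "cinner (sliceR v w X x) y = cinner (X (t v x)) (t w y)"
  by (simp add: sliceR_def cinner_hadj' clin_tensL)

lemma clin_sliceL: "clin X \<Longrightarrow> clin (sliceL \<xi> \<eta> X)"
  by (simp add: sliceL_def clin_compose clin_tensR clin_hadj)

lemma clin_sliceR: "clin X \<Longrightarrow> clin (sliceR \<xi> \<eta> X)"
  by (simp add: sliceR_def clin_compose clin_tensL clin_hadj)

lemma bounded_linear_sliceL: "bounded_linear (sliceL \<xi> \<eta>)"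
  unfolding sliceL_def
  by (intro bounded_linear_compose[OF bounded_bilinear.bounded_linear_right[OF bounded_bilinear_blinfun_compose]
    bounded_bilinear.bounded_linear_left[OF bounded_bilinear_blinfun_compose]])

lemma bounded_linear_sliceR: "bounded_linear (sliceR \<xi> \<eta>)"
  unfolding sliceR_def
  by (intro bounded_linear_compose[OF bounded_bilinear.bounded_linear_right[OF bounded_bilinear_blinfun_compose]
    bounded_bilinear.bounded_linear_left[OF bounded_bilinear_blinfun_compose]])

text \<open>Matrix coefficients against elementary tensors determine an operator, so operator
  identities can be checked slice by slice.\<close>

lemma sliceL_ext:
  assumes "\<And>\<xi> \<eta>. sliceL \<xi> \<eta> X = sliceL \<xi> \<eta> Y" shows "X = Y"
  by (rule blinfun_ext, rule vec_ext) (metis assms cinner_sliceL)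

lemma sliceL_op_tensor:
  assumes "clin a" "clin b" shows "sliceL \<xi> \<eta> (a \<otimes> b) = cinner (b \<xi>) \<eta> *\<^sub>C a"
  by (rule blinfun_eqI, rule cinner_eqI)
    (simp add: cinner_sliceL op_tensor_apply assms cinner_t scaleC_blinfun.rep_eq cinner_simps)

lemma sliceR_op_tensor:
  assumes "clin a" "clin b" shows "sliceR v w (a \<otimes> b) = cinner (a v) w *\<^sub>C b"
  by (rule blinfun_eqI, rule cinner_eqI)
    (simp add: cinner_sliceR op_tensor_apply assms cinner_t scaleC_blinfun.rep_eq cinner_simps)

lemma hadj_sliceL: "clin X \<Longrightarrow> hadj (sliceL \<xi> \<eta> X) = sliceL \<eta> \<xi> (hadj X)"
  by (simp add: sliceL_def hadj_compose clin_tensR clin_hadj clin_compose hadj_hadj compose_assoc)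

lemma op_tensor_id_tensR: "clin a \<Longrightarrow> (a \<otimes> id_blinfun) o\<^sub>L tensR \<xi> = tensR \<xi> o\<^sub>L a"
  by (rule blinfun_eqI) (simp add: op_tensor_apply clin_id)

lemma hadj_tensR_op_tensor_id:
  assumes "clin a" shows "hadj (tensR \<xi>) o\<^sub>L (a \<otimes> id_blinfun) = a o\<^sub>L hadj (tensR \<xi>)"
proof -
  have "hadj ((hadj a \<otimes> id_blinfun) o\<^sub>L tensR \<xi>) = hadj (tensR \<xi> o\<^sub>L hadj a)"
    by (simp add: op_tensor_id_tensR clin_hadj assms)
  then show ?thesis
    by (simp add: hadj_compose clin_op_tensor clin_id clin_hadj assms clin_tensR hadj_op_tensor hadj_id hadj_hadj)
qed

text \<open>With its companion for right multiplication: the slice map id \<otimes> \<omega> is a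
  bimodule map over the first factor.\<close>

lemma sliceL_compose_left:
  "clin a \<Longrightarrow> sliceL \<xi> \<eta> ((a \<otimes> id_blinfun) o\<^sub>L X) = a o\<^sub>L sliceL \<xi> \<eta> X"
  by (simp add: sliceL_def hadj_tensR_op_tensor_id flip: compose_assoc)

lemma sliceL_compose_right:
  "clin a \<Longrightarrow> sliceL \<xi> \<eta> (X o\<^sub>L (a \<otimes> id_blinfun)) = sliceL \<xi> \<eta> X o\<^sub>L a"
  by (simp add: sliceL_def op_tensor_id_tensR compose_assoc)

text \<open>The outer rank-one factors feed a single vector into each side of the second leg, so
  only one slice of \<open>X\<close> survives. This is how an operator in a rank-one corner is
  recognised as an elementary tensor.\<close>

lemma rank1_compress:
  assumes X: "clin X"
  shows "(id_blinfun \<otimes> rank1 \<xi> \<eta>) o\<^sub>L (X o\<^sub>L (id_blinfun \<otimes> rank1 \<xi>' \<eta>')) =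
    sliceL \<xi>' \<eta> X \<otimes> rank1 \<xi> \<eta>'"
proof (rule blinfun_ext, rule vec_ext)
  fix x u y w
  have h: "hadj (id_blinfun \<otimes> rank1 \<xi> \<eta>) = id_blinfun \<otimes> rank1 \<eta> \<xi>"
    by (simp add: hadj_op_tensor clin_id clin_rank1 hadj_id hadj_rank1)
  have "cinner (((id_blinfun \<otimes> rank1 \<xi> \<eta>) o\<^sub>L (X o\<^sub>L (id_blinfun \<otimes> rank1 \<xi>' \<eta>'))) (t x u)) (t y w)
    = cinner (X (t x (rank1 \<xi>' \<eta>' u))) (t y (rank1 \<eta> \<xi> w))"
    by (simp add: cinner_hadj[OF clin_op_tensor[OF clin_id clin_rank1]] h op_tensor_apply clin_id clin_rank1)
  also have "\<dots> = cinner u \<eta>' * cnj (cinner w \<xi>) * cinner (X (t x \<xi>')) (t y \<eta>)"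
    by (simp add: rank1_apply t_scaleC_right clinD[OF X] cinner_simps)
  also have "\<dots> = cinner ((sliceL \<xi>' \<eta> X \<otimes> rank1 \<xi> \<eta>') (t x u)) (t y w)"
    using cinner_commute[of \<xi> w]
    by (simp add: op_tensor_apply clin_sliceL X clin_rank1 rank1_apply cinner_t cinner_sliceL cinner_simps)
  finally show "cinner (((id_blinfun \<otimes> rank1 \<xi> \<eta>) o\<^sub>L (X o\<^sub>L (id_blinfun \<otimes> rank1 \<xi>' \<eta>'))) (t x u)) (t y w)
    = cinner ((sliceL \<xi>' \<eta> X \<otimes> rank1 \<xi> \<eta>') (t x u)) (t y w)" .
qed

text \<open>\<open>op_tensor\<close> is controlled only on complex-linear operators, hence the
  eventual hypothesis on \<open>f\<close>.\<close>

lemma tendsto_op_tensor_left: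
  assumes f: "(f \<longlongrightarrow> a) F" and cl: "\<forall>\<^sub>F x in F. clin (f x)" and a: "clin a" and k: "clin k"
  shows "((\<lambda>x. f x \<otimes> k) \<longlongrightarrow> a \<otimes> k) F"
proof -
  have "((\<lambda>x. norm (f x - a) * norm k) \<longlongrightarrow> 0 * norm k) F"
    using f by (intro tendsto_intros) (rule tendsto_norm_zero[OF Lim_null[THEN iffD1]])
  moreover have "\<forall>\<^sub>F x in F. norm (f x \<otimes> k - a \<otimes> k) \<le> norm (f x - a) * norm k"
    using cl
  proof eventually_elim
    case (elim x)
    then have "f x \<otimes> k - a \<otimes> k = (f x - a) \<otimes> k"
      using a k by (simp add: op_tensor_diff_left clin_diff)
    then show ?case using elim a k by (simp add: norm_op_tensor_le clin_diff)
  qed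
  ultimately have "((\<lambda>x. f x \<otimes> k - a \<otimes> k) \<longlongrightarrow> 0) F"
    using Lim_null_comparison[of "\<lambda>x. f x \<otimes> k - a \<otimes> k" "\<lambda>x. norm (f x - a) * norm k" F] by simp
  then show ?thesis by (rule Lim_null[THEN iffD2])
qed

end

section \<open>Spatial tensor products\<close>

lemma selfadjoint_idempotent_norm_le:
  assumes "hadj P = P" "P o\<^sub>L P = P" shows "norm P \<le> 1"
proof (rule norm_blinfun_bound)
  fix x
  have "norm (P x) * norm (P x) = inner (P x) (P x)"
    by (simp add: power2_norm_eq_inner[symmetric] power2_eq_square)
  also have "\<dots> = inner x (P x)"
    by (metis assms blinfun_apply_blinfun_compose inner_hadj)
  also have "\<dots> \<le> norm x * norm (P x)" by (rule norm_cauchy_schwarz)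
  finally show "norm (P x) \<le> 1 * norm x" by (cases "norm (P x) = 0") auto
qed simp

text \<open>An argument with thirds of \<open>e\<close>: eventual contractivity, uniform in the
  vector, transports the limit from a nearby \<open>w\<close>. Convergence to the identity then
  needs checking on generators only.\<close>

lemma closed_subspace_tendsto_contractions:
  fixes T :: "'f \<Rightarrow> 'v::real_normed_vector \<Rightarrow> 'v"
  assumes F: "F \<noteq> bot" and lin: "\<And>f. bounded_linear (T f)"
    and contr: "\<forall>\<^sub>F f in F. \<forall>v. norm (T f v) \<le> norm v"
  shows "closed {v. ((\<lambda>f. T f v) \<longlongrightarrow> v) F}" "subspace {v. ((\<lambda>f. T f v) \<longlongrightarrow> v) F}"
proof -
  let ?S = "{v. ((\<lambda>f. T f v) \<longlongrightarrow> v) F}"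
  show "subspace ?S"
    unfolding subspace_def
    by (auto simp: bounded_linear.linear[OF lin, THEN linear_0] bounded_linear.linear[OF lin, THEN linear_add]
      bounded_linear.linear[OF lin, THEN linear_scale] intro!: tendsto_intros)
  have "v \<in> ?S" if "v \<in> closure ?S" for v
  proof -
    have "\<forall>\<^sub>F f in F. dist (T f v) v < e" if e: "0 < e" for e
    proof -
      obtain w where w: "w \<in> ?S" "dist w v < e / 3"
        using \<open>v \<in> closure ?S\<close> e unfolding closure_approachable by (meson divide_pos_pos zero_less_numeral)
      have "\<forall>\<^sub>F f in F. dist (T f w) w < e / 3"
        using w(1) e by (auto dest: tendstoD[of _ _ _ "e/3"])
      then show ?thesis
        using contr
      proof eventually_elim
        case (elim f)
        have "norm (T f v - T f w) \<le> norm (v - w)"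
          using elim(2) by (metis linear_diff bounded_linear.linear[OF lin])
        moreover have "norm (T f v - v) \<le> norm (T f v - T f w) + norm (T f w - w) + norm (w - v)"
          using norm_triangle_ineq[of "T f v - T f w" "T f w - w"] norm_triangle_ineq[of "T f v - w" "w - v"]
          by simp
        ultimately show ?case
          using elim(1) w(2) by (simp add: dist_norm norm_minus_commute)
      qed
    qed
    then have "((\<lambda>f. T f v) \<longlongrightarrow> v) F" by (rule tendstoI)
    then show ?thesis by simp
  qed
  then have "closure ?S \<subseteq> ?S" by blast
  then show "closed ?S" by (simp only: closure_subset_eq)
qed

lemma bounded_linear_compose_left: "bounded_linear (\<lambda>X. X o\<^sub>L (Y::'a::real_normed_vector \<Rightarrow>\<^sub>L 'b::real_normed_vector))"
  by (rule bounded_bilinear.bounded_linear_left[OF bounded_bilinear_blinfun_compose])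

lemma bounded_linear_compose_right: "bounded_linear (\<lambda>X::'a::real_normed_vector \<Rightarrow>\<^sub>L 'b::real_normed_vector. Y o\<^sub>L X)"
  by (rule bounded_bilinear.bounded_linear_right[OF bounded_bilinear_blinfun_compose])

lemma tendsto_compose_left: "(f \<longlongrightarrow> a) F \<Longrightarrow> ((\<lambda>x. f x o\<^sub>L T) \<longlongrightarrow> a o\<^sub>L T) F"
  by (rule bounded_linear.tendsto[OF bounded_linear_compose_left])

lemma tendsto_compose_right: "(f \<longlongrightarrow> a) F \<Longrightarrow> ((\<lambda>x. T o\<^sub>L f x) \<longlongrightarrow> T o\<^sub>L a) F"
  by (rule bounded_linear.tendsto[OF bounded_linear_compose_right])

lemma bounded_linear_closed_vimage:
  assumes "bounded_linear f" "closed S" shows "closed (f -` S)"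
  using assms by (intro continuous_closed_vimage) (simp_all add: linear_continuous_at)

lemma bounded_linear_subspace_vimage:
  assumes "bounded_linear f" "subspace S" shows "subspace (f -` S)"
  using assms by (simp add: bounded_linear.linear linear_subspace_vimage)

lemma subalgebra_clin: "subalgebra A \<Longrightarrow> a \<in> A \<Longrightarrow> clin a"
  by (auto simp: subalgebra_def bounded_ops_iff_clin[symmetric])

lemma subalgebra_mult: "subalgebra A \<Longrightarrow> a \<in> A \<Longrightarrow> b \<in> A \<Longrightarrow> a o\<^sub>L b \<in> A"
  by (simp add: subalgebra_def)

lemma subalgebra_scaleC: "subalgebra A \<Longrightarrow> a \<in> A \<Longrightarrow> c *\<^sub>C a \<in> A"
  by (simp add: subalgebra_def csubspace_def)

lemma subalgebra_add: "subalgebra A \<Longrightarrow> a \<in> A \<Longrightarrow> b \<in> A \<Longrightarrow> a + b \<in> A"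
  by (simp add: subalgebra_def csubspace_def)

lemma subalgebra_zero: "subalgebra A \<Longrightarrow> 0 \<in> A"
  by (simp add: subalgebra_def csubspace_def)

lemma subalgebra_diff: "subalgebra A \<Longrightarrow> a \<in> A \<Longrightarrow> b \<in> A \<Longrightarrow> a - b \<in> A"
  by (simp add: subalgebra_def csubspace_diff)

lemma subalgebra_sum: "subalgebra A \<Longrightarrow> (\<And>i. i \<in> I \<Longrightarrow> f i \<in> A) \<Longrightarrow> sum f I \<in> A"
  by (simp add: subalgebra_def csubspace_sum)

text \<open>Multiplication is extended one factor at a time: with the left factor in
  \<open>E\<close>, the admissible right factors form a closed subspace; afterwards the left factor
  is released in the same way.\<close>

lemma subalgebra_closure_span:
  fixes E :: "('a::chilbert_space \<Rightarrow>\<^sub>L 'a) set"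
  assumes E: "E \<subseteq> \<B>" and scale: "\<And>c x. x \<in> E \<Longrightarrow> c *\<^sub>C x \<in> E"
    and mult: "\<And>x y. x \<in> E \<Longrightarrow> y \<in> E \<Longrightarrow> x o\<^sub>L y \<in> E"
  shows "subalgebra (closure (span E))"
proof -
  let ?N = "closure (span E)"
  have cs: "csubspace ?N"
    using csubspace_closure[OF csubspace_cspan[of E]] cspan_eq_span[OF scale] by metis
  have "span E \<subseteq> {T. clin T}"
    using E by (intro span_minimal) (auto simp: subspace_def clin_zero clin_add bounded_ops_iff_clin
        scaleC_of_real[symmetric] clin_scaleC)
  then have sub: "?N \<subseteq> \<B>"
    using closure_minimal[OF _ closed_clin, of "span E"] by (auto simp: bounded_ops_iff_clin)
  have closed_left: "?N \<subseteq> (\<lambda>x. x o\<^sub>L y) -` ?N" if "\<And>x. x \<in> E \<Longrightarrow> x o\<^sub>L y \<in> ?N" for y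
    using that
    by (intro closure_minimal span_minimal bounded_linear_closed_vimage bounded_linear_subspace_vimage
      bounded_linear_compose_left closed_closure subspace_closure subspace_span) auto
  have closed_right: "?N \<subseteq> (\<lambda>y. x o\<^sub>L y) -` ?N" if "\<And>y. y \<in> E \<Longrightarrow> x o\<^sub>L y \<in> ?N" for x
    using that
    by (intro closure_minimal span_minimal bounded_linear_closed_vimage bounded_linear_subspace_vimage
      bounded_linear_compose_right closed_closure subspace_closure subspace_span) auto
  have inN: "x \<in> E \<Longrightarrow> x \<in> ?N" for x using closure_subset span_base by blast
  have "x o\<^sub>L y \<in> ?N" if "x \<in> E" "y \<in> ?N" for x y
    using closed_right[of x] mult[OF that(1)] inN that(2) by blast
  then have "x o\<^sub>L y \<in> ?N" if "x \<in> ?N" "y \<in> ?N" for x y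
    using closed_left[of y] that by blast
  then show ?thesis unfolding subalgebra_def using sub cs by blast
qed

locale tensor_algebra = tensor_space t
  for t :: "'a::chilbert_space \<Rightarrow> 'b::chilbert_space \<Rightarrow> 'c::chilbert_space" +
  fixes A :: "('a \<Rightarrow>\<^sub>L 'a) set" and K :: "('b \<Rightarrow>\<^sub>L 'b) set"
  assumes A: "subalgebra A" "closed A" and K: "subalgebra K" "closed K"
begin

abbreviation "N \<equiv> spatial_tensor t A K"

lemma clin_A: "a \<in> A \<Longrightarrow> clin a" and clin_K: "k \<in> K \<Longrightarrow> clin k"
  using subalgebra_clin A K by auto

text \<open>Elementary tensors are already closed under products and complex scalars, so the
  generated closed algebra is the closure of their real span. Properties defining a closed subspace
  can then be tested on elementary tensors.\<close>

lemma N_eq_closure_span: "N = closure (span {a \<otimes> k |a k. a \<in> A \<and> k \<in> K})" (is "_ = closure (span ?E)")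
  and subalgebra_N: "subalgebra N" and closed_N: "closed N"
proof -
  have sub: "subalgebra (closure (span ?E))"
  proof (rule subalgebra_closure_span)
    show "?E \<subseteq> \<B>" by (auto simp: bounded_ops_iff_clin intro!: clin_op_tensor clin_A clin_K)
    show "c *\<^sub>C x \<in> ?E" if "x \<in> ?E" for c x
    proof -
      from that obtain a k where "x = a \<otimes> k" "a \<in> A" "k \<in> K" by blast
      then have "c *\<^sub>C x = (c *\<^sub>C a) \<otimes> k" "c *\<^sub>C a \<in> A"
        by (simp_all add: op_tensor_scaleC_left clin_A clin_K subalgebra_scaleC A)
      then show ?thesis using \<open>k \<in> K\<close> by blast
    qed
    show "x o\<^sub>L y \<in> ?E" if "x \<in> ?E" "y \<in> ?E" for x y
    proof -
      from that obtain a k b l where "x = a \<otimes> k" "a \<in> A" "k \<in> K" "y = b \<otimes> l" "b \<in> A" "l \<in> K" by blast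
      then have "x o\<^sub>L y = (a o\<^sub>L b) \<otimes> (k o\<^sub>L l)" "a o\<^sub>L b \<in> A" "k o\<^sub>L l \<in> K"
        by (simp_all add: op_tensor_compose clin_A clin_K subalgebra_mult A K)
      then show ?thesis by blast
    qed
  qed
  show "N = closure (span ?E)"
    unfolding spatial_tensor_def
  proof (rule hull_unique)
    show "?E \<subseteq> closure (span ?E)" using closure_subset span_superset by (rule order_trans[rotated])
    show "subalgebra (closure (span ?E)) \<and> closed (closure (span ?E))" using sub by simp
    show "closure (span ?E) \<subseteq> C" if "?E \<subseteq> C" "subalgebra C \<and> closed C" for C
      using that by (intro closure_minimal span_minimal csubspace_imp_subspace) (auto simp: subalgebra_def)
  qed
  then show "subalgebra N" "closed N" using sub by simp_all
qed

lemma clin_N: "X \<in> N \<Longrightarrow> clin X"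
  using subalgebra_clin subalgebra_N by blast

lemma op_tensor_in_N: "a \<in> A \<Longrightarrow> k \<in> K \<Longrightarrow> a \<otimes> k \<in> N"
  unfolding N_eq_closure_span using closure_subset by (fast intro: span_base)

lemma N_subset:
  assumes "closed S" "subspace S" "\<And>a k. a \<in> A \<Longrightarrow> k \<in> K \<Longrightarrow> a \<otimes> k \<in> S"
  shows "N \<subseteq> S"
  unfolding N_eq_closure_span using assms by (intro closure_minimal span_minimal) auto

text \<open>Slices of elementary tensors are multiples of the first factor, and since
  \<open>A\<close> is closed its preimage under the bounded slice map is a closed subspace.\<close>

lemma sliceL_N: assumes "X \<in> N" shows "sliceL \<xi> \<eta> X \<in> A"
proof -
  have "N \<subseteq> sliceL \<xi> \<eta> -` A"
  proof (rule N_subset)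
    show "closed (sliceL \<xi> \<eta> -` A)"
      by (rule bounded_linear_closed_vimage[OF bounded_linear_sliceL A(2)])
    show "subspace (sliceL \<xi> \<eta> -` A)"
      using A(1) by (intro bounded_linear_subspace_vimage bounded_linear_sliceL csubspace_imp_subspace)
        (simp add: subalgebra_def)
  qed (simp add: sliceL_op_tensor clin_A clin_K subalgebra_scaleC A)
  then show ?thesis using assms by auto
qed

lemma sliceR_N: assumes "X \<in> N" shows "sliceR \<xi> \<eta> X \<in> K"
proof -
  have "N \<subseteq> sliceR \<xi> \<eta> -` K"
  proof (rule N_subset)
    show "closed (sliceR \<xi> \<eta> -` K)"
      by (rule bounded_linear_closed_vimage[OF bounded_linear_sliceR K(2)])
    show "subspace (sliceR \<xi> \<eta> -` K)"
      using K(1) by (intro bounded_linear_subspace_vimage bounded_linear_sliceR csubspace_imp_subspace)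
        (simp add: subalgebra_def)
  qed (simp add: sliceR_op_tensor clin_A clin_K subalgebra_scaleC K)
  then show ?thesis using assms by auto
qed

text \<open>Taking the adjoint only swaps the two vectors of the slice, so the adjoint of a slice of
  \<open>X\<close> is another slice of \<open>X\<close> and lies in \<open>A\<close> too.\<close>

lemma sliceL_selfadjoint_diag: "X \<in> N \<Longrightarrow> hadj X = X \<Longrightarrow> sliceL \<xi> \<eta> X \<in> diag A"
  using A(1) by (subst mem_diag_iff) (auto simp: subalgebra_def hadj_sliceL clin_N intro: sliceL_N)

end

section \<open>Minimal projections\<close>

text \<open>The \<open>p i\<close> are the minimal projections of a diagonal that is \<open>*\<close>-isomorphic to
  \<open>c\<^sub>0(\<Gamma>)\<close>.\<close>

locale tensor_frame = tensor_algebra t A K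
  for t :: "'a::chilbert_space \<Rightarrow> 'b::chilbert_space \<Rightarrow> 'c::chilbert_space"
    and A :: "('a \<Rightarrow>\<^sub>L 'a) set" and K :: "('b \<Rightarrow>\<^sub>L 'b) set" +
  fixes \<Gamma> :: "'i set" and p :: "'i \<Rightarrow> ('a \<Rightarrow>\<^sub>L 'a)"
  assumes p_in: "i \<in> \<Gamma> \<Longrightarrow> p i \<in> A"
    and hadj_p: "i \<in> \<Gamma> \<Longrightarrow> hadj (p i) = p i"
    and p_p: "i \<in> \<Gamma> \<Longrightarrow> j \<in> \<Gamma> \<Longrightarrow> p i o\<^sub>L p j = (if i = j then p i else 0)"
    and p_nonzero: "i \<in> \<Gamma> \<Longrightarrow> p i \<noteq> 0"
    and p_minimal: "d \<in> diag A \<Longrightarrow> i \<in> \<Gamma> \<Longrightarrow> \<exists>c. p i o\<^sub>L d = c *\<^sub>C p i \<and> d o\<^sub>L p i = c *\<^sub>C p i"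
    and p_approx_left: "a \<in> A \<Longrightarrow> ((\<lambda>F. sum p F o\<^sub>L a) \<longlongrightarrow> a) (finite_subsets_at_top \<Gamma>)"
    and p_approx_right: "a \<in> A \<Longrightarrow> ((\<lambda>F. a o\<^sub>L sum p F) \<longlongrightarrow> a) (finite_subsets_at_top \<Gamma>)"
    and p_strong: "((\<lambda>F. sum p F x) \<longlongrightarrow> x) (finite_subsets_at_top \<Gamma>)"
    and rank1_in: "rank1 \<xi> \<eta> \<in> K"
begin

abbreviation "fin \<equiv> finite_subsets_at_top \<Gamma>"

lemma clin_p: "i \<in> \<Gamma> \<Longrightarrow> clin (p i)"
  using clin_A p_in by blast

lemma clin_sum_p: "F \<subseteq> \<Gamma> \<Longrightarrow> clin (sum p F)"
  by (rule clin_sum) (use clin_p in auto)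

lemma sum_p_in: "F \<subseteq> \<Gamma> \<Longrightarrow> sum p F \<in> A"
  by (rule subalgebra_sum[OF A(1)]) (use p_in in auto)

lemma p_sum_p: "finite F \<Longrightarrow> F \<subseteq> \<Gamma> \<Longrightarrow> i \<in> \<Gamma> \<Longrightarrow> p i o\<^sub>L sum p F = (if i \<in> F then p i else 0)"
  by (simp add: compose_sum p_p subset_iff cong: sum.cong)

lemma sum_p_p: "finite F \<Longrightarrow> F \<subseteq> \<Gamma> \<Longrightarrow> i \<in> \<Gamma> \<Longrightarrow> sum p F o\<^sub>L p i = (if i \<in> F then p i else 0)"
  by (simp add: sum_compose p_p subset_iff cong: sum.cong)

lemma sum_p_sum_p:
  assumes "finite F" "F \<subseteq> \<Gamma>" "finite G" "G \<subseteq> F" shows "sum p F o\<^sub>L sum p G = sum p G"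
proof -
  have "sum p F o\<^sub>L sum p G = (\<Sum>i\<in>G. sum p F o\<^sub>L p i)" by (rule compose_sum)
  also have "\<dots> = sum p G" by (rule sum.cong[OF refl], subst sum_p_p) (use assms in auto)
  finally show ?thesis .
qed

lemma hadj_sum_p: "finite F \<Longrightarrow> F \<subseteq> \<Gamma> \<Longrightarrow> hadj (sum p F) = sum p F"
proof (induction F rule: finite_induct)
  case empty
  then show ?case by simp
qed (simp add: hadj_add clin_p clin_sum_p hadj_p)

lemma eventually_fin: "\<forall>\<^sub>F F in fin. finite F \<and> F \<subseteq> \<Gamma>"
  unfolding eventually_finite_subsets_at_top by auto

lemma eventually_fin_superset: "finite F0 \<Longrightarrow> F0 \<subseteq> \<Gamma> \<Longrightarrow> \<forall>\<^sub>F F in fin. finite F \<and> F \<subseteq> \<Gamma> \<and> F0 \<subseteq> F"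
  unfolding eventually_finite_subsets_at_top by (intro exI[of _ F0]) auto

lemma norm_sum_p_le: "finite F \<Longrightarrow> F \<subseteq> \<Gamma> \<Longrightarrow> norm (sum p F) \<le> 1"
  by (rule selfadjoint_idempotent_norm_le) (simp_all add: hadj_sum_p sum_p_sum_p)

lemma norm_sum_p_id_le: 
  assumes "finite F" "F \<subseteq> \<Gamma>" shows "norm (sum p F \<otimes> id_blinfun) \<le> 1"
proof -
  have "norm (sum p F \<otimes> id_blinfun) \<le> norm (sum p F) * norm (id_blinfun :: 'b \<Rightarrow>\<^sub>L 'b)"
    by (rule norm_op_tensor_le) (simp_all add: clin_sum_p assms clin_id)
  also have "\<dots> \<le> 1 * 1"
    by (intro mult_mono norm_sum_p_le norm_blinfun_id_le assms) auto
  finally show ?thesis by simp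
qed

text \<open>The operators \<open>sum p F \<otimes> id_blinfun\<close> may lie outside
  \<open>N\<close>, but they are contractions, so convergence spreads from elementary tensors to all
  of \<open>N\<close>.\<close>

lemma N_approx_right:
  assumes "X \<in> N" shows "((\<lambda>F. X o\<^sub>L (sum p F \<otimes> id_blinfun)) \<longlongrightarrow> X) fin"
proof -
  let ?S = "{X. ((\<lambda>F. X o\<^sub>L (sum p F \<otimes> id_blinfun)) \<longlongrightarrow> X) fin}"
  have "norm (X o\<^sub>L (sum p F \<otimes> id_blinfun)) \<le> norm X" if "finite F \<and> F \<subseteq> \<Gamma>" for X :: "'c \<Rightarrow>\<^sub>L 'c" and F
    by (rule order_trans[OF norm_blinfun_compose]) (use that norm_sum_p_id_le in \<open>auto intro: mult_left_le\<close>)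
  then have "\<forall>\<^sub>F F in fin. \<forall>X::'c \<Rightarrow>\<^sub>L 'c. norm (X o\<^sub>L (sum p F \<otimes> id_blinfun)) \<le> norm X"
    using eventually_fin by (auto elim!: eventually_mono)
  note S = closed_subspace_tendsto_contractions[OF finite_subsets_at_top_neq_bot bounded_linear_compose_left this]
  have "N \<subseteq> ?S"
  proof (rule N_subset[OF S])
    fix a k assume ak: "a \<in> A" "k \<in> K"
    have cl: "\<forall>\<^sub>F F in fin. clin (a o\<^sub>L sum p F)"
      using eventually_fin by eventually_elim (simp add: clin_compose clin_A ak clin_sum_p)
    have "((\<lambda>F. (a o\<^sub>L sum p F) \<otimes> k) \<longlongrightarrow> a \<otimes> k) fin"
      by (rule tendsto_op_tensor_left[OF p_approx_right cl]) (use ak clin_A clin_K in auto)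
    moreover have "\<forall>\<^sub>F F in fin. (a o\<^sub>L sum p F) \<otimes> k = (a \<otimes> k) o\<^sub>L (sum p F \<otimes> id_blinfun)"
      using eventually_fin
      by eventually_elim (simp add: op_tensor_compose clin_A clin_K ak clin_sum_p clin_id)
    ultimately show "a \<otimes> k \<in> ?S" using tendsto_cong by fastforce
  qed
  then show ?thesis using assms by auto
qed

lemma eq_zero_if_all_corners_zero:
  assumes "X \<in> N" "\<And>j. j \<in> \<Gamma> \<Longrightarrow> X o\<^sub>L (p j \<otimes> id_blinfun) = 0" shows "X = 0"
proof -
  have "\<forall>\<^sub>F F in fin. X o\<^sub>L (sum p F \<otimes> id_blinfun) = 0"
    using eventually_fin
  proof eventually_elim
    case (elim F)
    then have "sum p F \<otimes> id_blinfun = (\<Sum>i\<in>F. p i \<otimes> id_blinfun)"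
      by (intro op_tensor_sum_left) (auto simp: clin_p clin_id)
    then show ?case using assms(2) elim by (simp add: compose_sum subset_iff)
  qed
  then have "((\<lambda>F. X o\<^sub>L (sum p F \<otimes> id_blinfun)) \<longlongrightarrow> 0) fin"
    by (rule tendsto_eventually)
  then show ?thesis
    using N_approx_right[OF assms(1)] tendsto_unique[OF finite_subsets_at_top_neq_bot] by blast
qed

lemma p_unit_vector:
  assumes "i \<in> \<Gamma>" obtains v where "norm v = 1" "p i v = v"
proof -
  obtain u where u: "p i u \<noteq> 0" using p_nonzero[OF assms] by (metis blinfun_eqI zero_blinfun.rep_eq)
  obtain v where v: "norm v = 1" "p i u = of_real (norm (p i u)) *\<^sub>C v"
    using norm_unit_scale_exists[OF u] by blast
  have v': "v = of_real (inverse (norm (p i u))) *\<^sub>C p i u"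
    by (subst v(2)) (use u in \<open>simp add: scaleC_scaleC flip: of_real_mult\<close>)
  have "p i (p i u) = p i u" by (metis assms p_p blinfun_apply_blinfun_compose)
  then have "p i v = v" unfolding v' by (simp add: clinD clin_p assms)
  with v(1) that show ?thesis by blast
qed

text \<open>Slicing at a unit vector fixed by \<open>p i\<close> recovers the second factor.\<close>

lemma op_tensor_p_inject:
  assumes "i \<in> \<Gamma>" "clin x" "clin y" "p i \<otimes> x = p i \<otimes> y" shows "x = y"
proof -
  obtain v where v: "norm v = 1" "p i v = v" using p_unit_vector[OF assms(1)] by blast
  have "sliceR v v (p i \<otimes> z) = z" if "clin z" for z
    using that by (simp add: sliceR_op_tensor clin_p assms(1) v cinner_self)
  then show ?thesis using assms by metis
qed

definition proj :: "'i \<Rightarrow> 'b \<Rightarrow> ('c \<Rightarrow>\<^sub>L 'c)" where "proj i \<xi> = p i \<otimes> rank1 \<xi> \<xi>"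

lemma proj_in: "i \<in> \<Gamma> \<Longrightarrow> proj i \<xi> \<in> N"
  by (simp add: proj_def op_tensor_in_N p_in rank1_in)

lemma hadj_proj: "i \<in> \<Gamma> \<Longrightarrow> hadj (proj i \<xi>) = proj i \<xi>"
  by (simp add: proj_def hadj_op_tensor clin_p clin_rank1 hadj_p hadj_rank1)

lemma proj_proj: "i \<in> \<Gamma> \<Longrightarrow> j \<in> \<Gamma> \<Longrightarrow>
  proj i \<xi> o\<^sub>L proj j \<eta> = (if i = j then cinner \<eta> \<xi> *\<^sub>C (p i \<otimes> rank1 \<xi> \<eta>) else 0)"
  by (simp add: proj_def op_tensor_compose clin_p clin_rank1 p_p rank1_rank1 op_tensor_zero_left
    op_tensor_scaleC_right clin_scaleC)

lemma proj_idem: "i \<in> \<Gamma> \<Longrightarrow> norm \<xi> = 1 \<Longrightarrow> proj i \<xi> o\<^sub>L proj i \<xi> = proj i \<xi>"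
  by (simp add: proj_proj cinner_self_unit) (simp add: proj_def)

lemma p_rank1_nonzero:
  assumes "i \<in> \<Gamma>" "norm \<xi> = 1" "norm \<eta> = 1" shows "p i \<otimes> rank1 \<xi> \<eta> \<noteq> 0"
proof
  assume "p i \<otimes> rank1 \<xi> \<eta> = 0"
  then have "sliceL \<eta> \<xi> (p i \<otimes> rank1 \<xi> \<eta>) = 0"
    by (simp add: linear_0 bounded_linear.linear bounded_linear_sliceL)
  then show False
    using p_nonzero assms by (simp add: sliceL_op_tensor clin_p clin_rank1 rank1_apply cinner_simps cinner_self_unit)
qed

lemma proj_nonzero: "i \<in> \<Gamma> \<Longrightarrow> norm \<xi> = 1 \<Longrightarrow> proj i \<xi> \<noteq> 0"
  by (simp add: proj_def p_rank1_nonzero)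

lemma norm_proj_le: "i \<in> \<Gamma> \<Longrightarrow> norm \<xi> = 1 \<Longrightarrow> norm (proj i \<xi>) \<le> 1"
  by (simp add: selfadjoint_idempotent_norm_le hadj_proj proj_idem)

text \<open>Some column of \<open>Q\<close> is nonzero because the columns determine an element of
  \<open>N\<close>. Its second factor is a nonzero idempotent, and any unit vector in the range of
  that idempotent can serve as \<open>f\<close>.\<close>

lemma projection_dominates_proj:
  assumes Q: "Q \<in> N" "hadj Q = Q" "Q o\<^sub>L Q = Q" "Q \<noteq> 0"
  obtains j f where "j \<in> \<Gamma>" "norm f = 1" "Q o\<^sub>L proj j f = proj j f" "proj j f o\<^sub>L Q = proj j f"
proof -
  let ?e = "\<lambda>j. p j \<otimes> id_blinfun"
  have Qcl: "clin Q" using Q(1) by (rule clin_N)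
  obtain j where j: "j \<in> \<Gamma>" "Q o\<^sub>L ?e j \<noteq> 0" using eq_zero_if_all_corners_zero[OF Q(1)] Q(4) by blast
  have pj: "clin (p j)" using j clin_p by blast
  \<comment> \<open>Minimality turns each slice into a scalar, the same one on the left and on the
    right. This agreement is what makes \<open>Q\<close> commute with \<open>?e j\<close>.\<close>
  have "\<exists>c. p j o\<^sub>L sliceL \<xi> \<eta> Q = c *\<^sub>C p j \<and> sliceL \<xi> \<eta> Q o\<^sub>L p j = c *\<^sub>C p j" for \<xi> \<eta>
    by (rule p_minimal[OF sliceL_selfadjoint_diag[OF Q(1,2)] j(1)])
  then obtain c where c: "\<And>\<xi> \<eta>. p j o\<^sub>L sliceL \<xi> \<eta> Q = c \<xi> \<eta> *\<^sub>C p j"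
    "\<And>\<xi> \<eta>. sliceL \<xi> \<eta> Q o\<^sub>L p j = c \<xi> \<eta> *\<^sub>C p j" by metis
  have comm: "?e j o\<^sub>L Q = Q o\<^sub>L ?e j"
    by (rule sliceL_ext) (simp add: sliceL_compose_left sliceL_compose_right pj c)
  obtain v where v: "norm v = 1" "p j v = v" using p_unit_vector[OF j(1)] by blast
  define x where "x = sliceR v v Q"
  have x: "clin x" by (simp add: x_def clin_sliceR Qcl)
  \<comment> \<open>The family of scalars is the sesquilinear form of one bounded operator, found by
    slicing the other leg at a vector fixed by \<open>p j\<close>.\<close>
  have cx: "c \<xi> \<eta> = cinner (x \<xi>) \<eta>" for \<xi> \<eta>
  proof -
    have "cinner (x \<xi>) \<eta> = cinner (sliceL \<xi> \<eta> Q (p j v)) v"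
      by (simp add: x_def cinner_sliceR cinner_sliceL v)
    also have "\<dots> = cinner ((sliceL \<xi> \<eta> Q o\<^sub>L p j) v) v" by simp
    also have "\<dots> = c \<xi> \<eta>" by (simp add: c scaleC_blinfun.rep_eq v cinner_simps cinner_self)
    finally show ?thesis by simp
  qed
  have Qe: "Q o\<^sub>L ?e j = p j \<otimes> x"
    by (rule sliceL_ext) (simp add: sliceL_compose_right pj c cx sliceL_op_tensor x)
  have "(p j \<otimes> x) o\<^sub>L (p j \<otimes> x) = p j \<otimes> x"
  proof -
    have "(Q o\<^sub>L ?e j) o\<^sub>L (Q o\<^sub>L ?e j) = Q o\<^sub>L ((?e j o\<^sub>L Q) o\<^sub>L ?e j)" by (simp add: compose_assoc)
    also have "\<dots> = (Q o\<^sub>L Q) o\<^sub>L (?e j o\<^sub>L ?e j)" by (simp add: comm compose_assoc)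
    also have "?e j o\<^sub>L ?e j = ?e j" by (simp add: op_tensor_compose pj clin_id p_p j)
    finally show ?thesis by (simp add: Qe Q(3))
  qed
  then have xx: "x o\<^sub>L x = x"
    by (intro op_tensor_p_inject[OF j(1)]) (simp_all add: x clin_compose op_tensor_compose pj p_p j(1))
  have "x \<noteq> 0" using j(2) by (auto simp: Qe op_tensor_zero_right pj)
  then obtain y where y: "x y \<noteq> 0" by (metis blinfun_eqI zero_blinfun.rep_eq)
  obtain f where f: "norm f = 1" "x y = of_real (norm (x y)) *\<^sub>C f"
    using norm_unit_scale_exists[OF y] by blast
  have f': "f = of_real (inverse (norm (x y))) *\<^sub>C x y"
    by (subst f(2)) (use y in \<open>simp add: scaleC_scaleC flip: of_real_mult\<close>)
  have "x (x y) = x y" by (metis xx blinfun_apply_blinfun_compose)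
  then have xf: "x f = f" unfolding f' by (simp add: clinD x)
  have 1: "Q o\<^sub>L proj j f = proj j f"
  proof -
    have "proj j f = ?e j o\<^sub>L proj j f"
      by (simp add: proj_def op_tensor_compose pj clin_id clin_rank1 p_p j)
    then have "Q o\<^sub>L proj j f = (Q o\<^sub>L ?e j) o\<^sub>L proj j f" by (metis compose_assoc)
    also have "\<dots> = proj j f"
      by (simp add: Qe proj_def op_tensor_compose pj x clin_rank1 p_p j compose_rank1 xf)
    finally show ?thesis .
  qed
  have "hadj (Q o\<^sub>L proj j f) = proj j f o\<^sub>L Q"
    by (simp add: hadj_compose Qcl clin_N proj_in j hadj_proj Q(2))
  then have "proj j f o\<^sub>L Q = proj j f" by (simp add: 1 hadj_proj j)
  with 1 that[OF j(1) f(1)] show ?thesis by blast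
qed

text \<open>Compression by a rank-one operator removes the freedom in the second leg, minimality of
  \<open>p i\<close> that in the first, so \<open>Y\<close> is a multiple of
  \<open>proj i \<xi>\<close>. Idempotence of a nonzero \<open>Y\<close> forces the factor
  1.\<close>

lemma proj_minimal:
  assumes i: "i \<in> \<Gamma>" "norm \<xi> = 1" and Y: "Y \<in> N" "hadj Y = Y" "Y o\<^sub>L Y = Y" "Y \<noteq> 0"
    and dom: "proj i \<xi> o\<^sub>L Y = Y" "Y o\<^sub>L proj i \<xi> = Y"
  shows "Y = proj i \<xi>"
proof -
  have pi: "clin (p i)" using i clin_p by blast
  let ?y = "sliceL \<xi> \<xi> Y" and ?e = "p i \<otimes> id_blinfun" and ?r = "id_blinfun \<otimes> rank1 \<xi> \<xi>"
  have y: "clin ?y" by (simp add: clin_sliceL clin_N Y)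
  obtain c where c: "p i o\<^sub>L ?y = c *\<^sub>C p i"
    using p_minimal[OF sliceL_selfadjoint_diag[OF Y(1,2)] i(1)] by blast
  have P: "proj i \<xi> = ?e o\<^sub>L ?r" "proj i \<xi> = ?r o\<^sub>L ?e"
    by (simp_all add: proj_def op_tensor_compose pi clin_id clin_rank1)
  have "Y = proj i \<xi> o\<^sub>L (Y o\<^sub>L proj i \<xi>)" by (simp add: dom)
  also have "\<dots> = ?e o\<^sub>L ((?r o\<^sub>L (Y o\<^sub>L ?r)) o\<^sub>L ?e)"
    by (subst P(1), subst P(2)) (simp add: compose_assoc)
  also have "\<dots> = ?e o\<^sub>L ((?y \<otimes> rank1 \<xi> \<xi>) o\<^sub>L ?e)"
    by (simp add: rank1_compress clin_N Y)
  also have "\<dots> = (p i o\<^sub>L ?y o\<^sub>L p i) \<otimes> rank1 \<xi> \<xi>"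
    by (simp add: op_tensor_compose pi clin_id clin_rank1 y clin_compose compose_assoc)
  also have "\<dots> = c *\<^sub>C proj i \<xi>"
    by (simp add: c scaleC_compose_left p_p i op_tensor_scaleC_left pi clin_rank1 proj_def)
  finally have Yc: "Y = c *\<^sub>C proj i \<xi>" .
  have "Y o\<^sub>L Y = (c *\<^sub>C proj i \<xi>) o\<^sub>L Y" using Yc by simp
  then have "Y = c *\<^sub>C Y" by (simp add: scaleC_compose_left dom Y(3))
  then have "(c - 1) *\<^sub>C Y = 0" using scaleC_add_left[of "c - 1" 1 Y] by simp
  then have "c = 1" using Y(4) norm_scaleC[of "c - 1" Y] by simp
  then show ?thesis using Yc by simp
qed

end

section \<open>Isometric isomorphisms\<close>

definition isometric_iso ::
    "(('a::chilbert_space \<Rightarrow>\<^sub>L 'a) \<Rightarrow> ('b::chilbert_space \<Rightarrow>\<^sub>L 'b)) \<Rightarrow>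
      ('a \<Rightarrow>\<^sub>L 'a) set \<Rightarrow> ('b \<Rightarrow>\<^sub>L 'b) set \<Rightarrow> bool"
  where "isometric_iso \<phi> A B \<longleftrightarrow> algebra_isomorphism \<phi> A B \<and> (\<forall>a\<in>A. norm (\<phi> a) = norm a)"

lemma algebra_isomorphism_inverse:
  assumes \<phi>: "algebra_isomorphism \<phi> A B" and A: "subalgebra A"
  shows "algebra_isomorphism (inv_into A \<phi>) B A"
proof -
  have bij: "bij_betw \<phi> A B" using \<phi> by (simp add: algebra_isomorphism_def)
  have eq: "inv_into A \<phi> b = a" if "a \<in> A" "\<phi> a = b" for a b
    using bij that by (metis bij_betw_inv_into_left)
  have inv: "inv_into A \<phi> b \<in> A" "\<phi> (inv_into A \<phi> b) = b" if "b \<in> B" for b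
    using bij that by (metis bij_betw_imp_surj_on inv_into_into) (metis bij bij_betw_inv_into_right that)
  have "inv_into A \<phi> (x + y) = inv_into A \<phi> x + inv_into A \<phi> y"
    "inv_into A \<phi> (c *\<^sub>C x) = c *\<^sub>C inv_into A \<phi> x"
    "inv_into A \<phi> (x o\<^sub>L y) = inv_into A \<phi> x o\<^sub>L inv_into A \<phi> y" if "x \<in> B" "y \<in> B" for x y c
    by (rule eq; use \<phi> A inv that in \<open>simp add: algebra_isomorphism_def subalgebra_add subalgebra_scaleC subalgebra_mult\<close>)+
  then show ?thesis
    unfolding algebra_isomorphism_def using bij_betw_inv_into[OF bij] by blast
qed

lemma isometric_iso_inverse:
  assumes "isometric_iso \<phi> A B" "subalgebra A" shows "isometric_iso (inv_into A \<phi>) B A"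
proof -
  have "norm (inv_into A \<phi> b) = norm b" if "b \<in> B" for b
  proof -
    have "bij_betw \<phi> A B" using assms(1) by (simp add: isometric_iso_def algebra_isomorphism_def)
    then have "inv_into A \<phi> b \<in> A" "\<phi> (inv_into A \<phi> b) = b"
      using that by (auto simp: bij_betw_inv_into_right bij_betwE[OF bij_betw_inv_into])
    then show ?thesis using assms(1) unfolding isometric_iso_def by metis
  qed
  then show ?thesis
    using assms algebra_isomorphism_inverse unfolding isometric_iso_def by blast
qed

section \<open>Images of minimal projections\<close>

locale frame_iso = L: tensor_frame t A K \<Gamma> p + R: tensor_frame t' B K' \<Delta> q
  for t :: "'a::chilbert_space \<Rightarrow> 'h::chilbert_space \<Rightarrow> 'c::chilbert_space" and A K and \<Gamma> :: "'i set" and p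
    and t' :: "'b::chilbert_space \<Rightarrow> 'h \<Rightarrow> 'd::chilbert_space" and B K' and \<Delta> :: "'j set" and q +
  fixes \<phi> :: "('c \<Rightarrow>\<^sub>L 'c) \<Rightarrow> ('d \<Rightarrow>\<^sub>L 'd)"
  assumes iso: "isometric_iso \<phi> L.N R.N"
begin

lemma phi_bij: "bij_betw \<phi> L.N R.N"
  and phi_add: "x \<in> L.N \<Longrightarrow> y \<in> L.N \<Longrightarrow> \<phi> (x + y) = \<phi> x + \<phi> y"
  and phi_scaleC: "x \<in> L.N \<Longrightarrow> \<phi> (c *\<^sub>C x) = c *\<^sub>C \<phi> x"
  and phi_mult: "x \<in> L.N \<Longrightarrow> y \<in> L.N \<Longrightarrow> \<phi> (x o\<^sub>L y) = \<phi> x o\<^sub>L \<phi> y"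
  and phi_norm: "x \<in> L.N \<Longrightarrow> norm (\<phi> x) = norm x"
  using iso by (auto simp: isometric_iso_def algebra_isomorphism_def)

lemma phi_in: "x \<in> L.N \<Longrightarrow> \<phi> x \<in> R.N"
  using phi_bij by (meson bij_betwE)

lemma phi_inject: "x \<in> L.N \<Longrightarrow> y \<in> L.N \<Longrightarrow> \<phi> x = \<phi> y \<longleftrightarrow> x = y"
  using phi_bij by (meson bij_betw_imp_inj_on inj_on_eq_iff)

lemma phi_surj: "y \<in> R.N \<Longrightarrow> \<exists>x\<in>L.N. \<phi> x = y"
  using bij_betw_imp_surj_on[OF phi_bij, symmetric] by auto

lemma phi_zero: "\<phi> 0 = 0"
  using phi_norm[OF subalgebra_zero[OF L.subalgebra_N]] by simp

lemma phi_diff: "x \<in> L.N \<Longrightarrow> y \<in> L.N \<Longrightarrow> \<phi> (x - y) = \<phi> x - \<phi> y"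
  using phi_add[of "x - y" y] by (simp add: subalgebra_diff L.subalgebra_N)

lemma phi_tendsto_iff:
  assumes "\<forall>\<^sub>F i in F. f i \<in> L.N" "x \<in> L.N"
  shows "((\<lambda>i. \<phi> (f i)) \<longlongrightarrow> \<phi> x) F \<longleftrightarrow> (f \<longlongrightarrow> x) F"
proof -
  have "\<forall>\<^sub>F i in F. dist (\<phi> (f i)) (\<phi> x) = dist (f i) x"
    using assms(1)
  proof eventually_elim
    case (elim i)
    then show ?case
      using phi_norm[of "f i - x"] assms(2) by (simp add: dist_norm phi_diff subalgebra_diff L.subalgebra_N)
  qed
  then have "((\<lambda>i. dist (\<phi> (f i)) (\<phi> x)) \<longlongrightarrow> 0) F \<longleftrightarrow> ((\<lambda>i. dist (f i) x) \<longlongrightarrow> 0) F"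
    by (rule tendsto_cong)
  then show ?thesis by (simp only: tendsto_dist_iff[of _ x] tendsto_dist_iff[of _ "\<phi> x"])
qed

lemma phi_contractive_idempotent:
  assumes "X \<in> L.N" "X o\<^sub>L X = X" "norm X \<le> 1"
  shows "hadj (\<phi> X) = \<phi> X" "\<phi> X o\<^sub>L \<phi> X = \<phi> X"
proof -
  show id: "\<phi> X o\<^sub>L \<phi> X = \<phi> X" using assms phi_mult by metis
  show "hadj (\<phi> X) = \<phi> X"
    by (rule contractive_idempotent_selfadjoint[OF _ id]) (simp_all add: R.clin_N phi_in assms phi_norm)
qed

text \<open>A minimal projection \<open>p\<^sub>i \<otimes> \<theta>\<close> is sent to a projection that dominates
  some \<open>q\<^sub>j \<otimes> \<theta>'\<close>; the preimage of the latter is nonzero and below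
  \<open>p\<^sub>i \<otimes> \<theta>\<close>.\<close>

lemma phi_proj:
  assumes i: "i \<in> \<Gamma>" "norm \<xi> = 1"
  obtains j f where "j \<in> \<Delta>" "norm f = 1" "\<phi> (L.proj i \<xi>) = R.proj j f"
proof -
  let ?P = "L.proj i \<xi>"
  have P: "?P \<in> L.N" "?P o\<^sub>L ?P = ?P" "norm ?P \<le> 1" "?P \<noteq> 0"
    using i by (simp_all add: L.proj_in L.proj_idem L.norm_proj_le L.proj_nonzero)
  have nz: "\<phi> ?P \<noteq> 0" using P phi_norm by (metis norm_eq_zero)
  obtain j f where jf: "j \<in> \<Delta>" "norm f = 1" "\<phi> ?P o\<^sub>L R.proj j f = R.proj j f" "R.proj j f o\<^sub>L \<phi> ?P = R.proj j f"
    using R.projection_dominates_proj[OF phi_in[OF P(1)] phi_contractive_idempotent[OF P(1,2,3)] nz] by metis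
  let ?R = "R.proj j f"
  obtain Y where Y: "Y \<in> L.N" "\<phi> Y = ?R" using phi_surj[OF R.proj_in[OF jf(1)]] by blast
  have YY: "Y o\<^sub>L Y = Y"
    using Y jf by (subst phi_inject[symmetric]) (simp_all add: phi_mult R.proj_idem subalgebra_mult L.subalgebra_N)
  have PY: "?P o\<^sub>L Y = Y" "Y o\<^sub>L ?P = Y"
    using Y jf P by (subst phi_inject[symmetric]; simp add: phi_mult subalgebra_mult L.subalgebra_N)+
  \<comment> \<open>Isometry makes the idempotent \<open>Y\<close> contractive and hence
    selfadjoint, although no adjoint has been transported by the inverse map.\<close>
  have "norm Y \<le> 1" using Y R.norm_proj_le[OF jf(1,2)] phi_norm by metis
  then have "hadj Y = Y" by (intro contractive_idempotent_selfadjoint L.clin_N Y YY)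
  moreover have "Y \<noteq> 0" using Y R.proj_nonzero[OF jf(1,2)] phi_zero by metis
  ultimately have "Y = ?P" using L.proj_minimal[OF i Y(1) _ YY _ PY] by blast
  then show ?thesis using that jf Y by metis
qed

text \<open>For non-orthogonal unit vectors the product of the two projections is nonzero, while
  images with different indices would multiply to 0. Orthogonal vectors are linked through a third
  one.\<close>

lemma phi_proj_uniform:
  assumes i: "i \<in> \<Gamma>"
  shows "\<exists>j. \<forall>\<xi>. norm \<xi> = 1 \<longrightarrow> j \<in> \<Delta> \<and> (\<exists>f. norm f = 1 \<and> \<phi> (L.proj i \<xi>) = R.proj j f)"
proof (cases "\<exists>\<xi>0::'h. norm \<xi>0 = 1")
  \<comment> \<open>\<open>j \<in> \<Delta>\<close> stands under the implication, so the claim is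
    vacuous when there is no unit vector.\<close>
  case False then show ?thesis by blast
next
  case True
  then obtain \<xi>0 :: 'h where \<xi>0: "norm \<xi>0 = 1" by blast
  have same: "j = k" if "norm \<xi> = 1" "norm \<eta> = 1" "cinner \<eta> \<xi> \<noteq> 0" "j \<in> \<Delta>" "k \<in> \<Delta>"
    "\<phi> (L.proj i \<xi>) = R.proj j f" "\<phi> (L.proj i \<eta>) = R.proj k g" for j k \<xi> \<eta> f g
  proof (rule ccontr)
    assume "j \<noteq> k"
    then have "\<phi> (L.proj i \<xi> o\<^sub>L L.proj i \<eta>) = \<phi> 0"
      using that i by (simp add: phi_mult L.proj_in R.proj_proj phi_zero)
    then have "L.proj i \<xi> o\<^sub>L L.proj i \<eta> = 0"
      using i by (simp add: phi_inject subalgebra_mult subalgebra_zero L.subalgebra_N L.proj_in)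
    then have "norm (cinner \<eta> \<xi> *\<^sub>C op_tensor t (p i) (rank1 \<xi> \<eta>)) = 0"
      using i by (simp add: L.proj_proj)
    then show False using that(3) L.p_rank1_nonzero[OF i that(1,2)] by (simp add: norm_scaleC)
  qed
  obtain j f where j: "j \<in> \<Delta>" "norm f = 1" "\<phi> (L.proj i \<xi>0) = R.proj j f" using phi_proj[OF i \<xi>0] by metis
  have "\<exists>f. norm f = 1 \<and> \<phi> (L.proj i \<xi>) = R.proj j f" if \<xi>: "norm \<xi> = 1" for \<xi>
  proof -
    obtain k g where k: "k \<in> \<Delta>" "norm g = 1" "\<phi> (L.proj i \<xi>) = R.proj k g" using phi_proj[OF i \<xi>] by metis
    have "j = k"
    proof (cases "cinner \<xi> \<xi>0 = 0")
      case False
      then show ?thesis using same[OF \<xi>0 \<xi>] j k by metis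
    next
      case True
      then have o: "cinner \<xi>0 \<xi> = 0" by (metis cinner_commute complex_cnj_zero)
      have ne: "\<xi> + \<xi>0 \<noteq> 0" using o \<xi>0 by (metis add_eq_0_iff cinner_minus_right cinner_self_unit neg_equal_0_iff_equal zero_neq_one)
      define r where "r = complex_of_real (inverse (norm (\<xi> + \<xi>0)))"
      \<comment> \<open>The normalised sum of two orthonormal vectors has inner product
        \<open>r \<noteq> 0\<close> with either of them.\<close>
      define \<zeta> where "\<zeta> = r *\<^sub>C (\<xi> + \<xi>0)"
      have r: "r \<noteq> 0" using ne by (simp add: r_def)
      have \<zeta>: "norm \<zeta> = 1" using ne by (simp add: \<zeta>_def r_def norm_scaleC norm_inverse)
      have "cinner \<zeta> \<xi>0 \<noteq> 0" "cinner \<zeta> \<xi> \<noteq> 0"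
        using r True o \<xi>0 \<xi> by (simp_all add: \<zeta>_def cinner_simps cinner_self_unit)
      moreover obtain l h where l: "l \<in> \<Delta>" "norm h = 1" "\<phi> (L.proj i \<zeta>) = R.proj l h" using phi_proj[OF i \<zeta>] by metis
      ultimately have "j = l" "k = l" using same[OF \<xi>0 \<zeta>] same[OF \<xi> \<zeta>] j k by metis+
      then show ?thesis by simp
    qed
    then show ?thesis using k by blast
  qed
  then show ?thesis using j(1) by blast
qed

end

lemma frame_iso_inverse:
  assumes "frame_iso t A K \<Gamma> p t' B K' \<Delta> q \<phi>"
  shows "frame_iso t' B K' \<Delta> q t A K \<Gamma> p (inv_into (spatial_tensor t A K) \<phi>)"
proof -
  interpret frame_iso t A K \<Gamma> p t' B K' \<Delta> q \<phi> by fact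
  show ?thesis
    by unfold_locales (rule isometric_iso_inverse[OF iso L.subalgebra_N])
qed

section \<open>Matching the index sets\<close>

text \<open>Taking images under a bijection carries the filter of finite subsets of
  \<open>\<Delta>\<close> to that of \<open>\<Gamma>\<close>, so every limit in the locale
  survives.\<close>

lemma (in tensor_frame) tensor_frame_reindex:
  assumes \<sigma>: "bij_betw \<sigma> \<Delta> \<Gamma>" shows "tensor_frame t A K \<Delta> (p \<circ> \<sigma>)"
proof -
  have in\<Gamma>: "\<sigma> j \<in> \<Gamma>" if "j \<in> \<Delta>" for j using \<sigma> that by (metis bij_betwE)
  have inj: "\<sigma> i = \<sigma> j \<longleftrightarrow> i = j" if "i \<in> \<Delta>" "j \<in> \<Delta>" for i j
    using \<sigma> that by (meson bij_betw_imp_inj_on inj_on_eq_iff)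
  have lim: "((\<lambda>F. f (sum (p \<circ> \<sigma>) F)) \<longlongrightarrow> l) (finite_subsets_at_top \<Delta>)"
    if "((\<lambda>F. f (sum p F)) \<longlongrightarrow> l) fin" for l :: "'z::topological_space" and f
  proof -
    have "filterlim (\<lambda>F. \<sigma> ` F) fin (finite_subsets_at_top \<Delta>)"
      using filtermap_image_finite_subsets_at_top[of \<sigma> \<Delta>] \<sigma>
      by (simp add: bij_betw_def filterlim_def)
    then have "((\<lambda>F. f (sum p (\<sigma> ` F))) \<longlongrightarrow> l) (finite_subsets_at_top \<Delta>)"
      by (rule filterlim_compose[OF that])
    moreover have "\<forall>\<^sub>F F in finite_subsets_at_top \<Delta>. f (sum p (\<sigma> ` F)) = f (sum (p \<circ> \<sigma>) F)"
      by (rule eventually_finite_subsets_at_top_weakI)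
        (simp add: sum.reindex[OF inj_on_subset[OF bij_betw_imp_inj_on[OF \<sigma>]]])
    ultimately show ?thesis by (rule Lim_transform_eventually)
  qed
  show ?thesis
  proof unfold_locales
    show "((\<lambda>F. sum (p \<circ> \<sigma>) F o\<^sub>L a) \<longlongrightarrow> a) (finite_subsets_at_top \<Delta>)" if "a \<in> A" for a
      by (rule lim[OF p_approx_left[OF that]])
    show "((\<lambda>F. a o\<^sub>L sum (p \<circ> \<sigma>) F) \<longlongrightarrow> a) (finite_subsets_at_top \<Delta>)" if "a \<in> A" for a
      by (rule lim[OF p_approx_right[OF that]])
    show "((\<lambda>F. sum (p \<circ> \<sigma>) F x) \<longlongrightarrow> x) (finite_subsets_at_top \<Delta>)" for x
      by (rule lim[OF p_strong])
    show "\<exists>c. (p \<circ> \<sigma>) i o\<^sub>L d = c *\<^sub>C (p \<circ> \<sigma>) i \<and> d o\<^sub>L (p \<circ> \<sigma>) i = c *\<^sub>C (p \<circ> \<sigma>) i"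
      if "d \<in> diag A" "i \<in> \<Delta>" for d i using p_minimal[OF that(1) in\<Gamma>[OF that(2)]] by simp
  qed (simp_all add: p_in hadj_p p_p p_nonzero rank1_in in\<Gamma> inj)
qed

text \<open>Both index sets are identified, so that the isomorphism matches projections with the
  same index.\<close>

locale matched_iso = frame_iso t A K \<Gamma> p t' B K' \<Gamma> q \<phi>
  for t :: "'a::chilbert_space \<Rightarrow> 'h::chilbert_space \<Rightarrow> 'c::chilbert_space" and A K and \<Gamma> :: "'i set" and p
    and t' :: "'b::chilbert_space \<Rightarrow> 'h \<Rightarrow> 'd::chilbert_space" and B K' q \<phi> +
  assumes matched: "i \<in> \<Gamma> \<Longrightarrow> norm \<xi> = 1 \<Longrightarrow> \<exists>f. norm f = 1 \<and> \<phi> (L.proj i \<xi>) = R.proj i f"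
    and matched_inv: "i \<in> \<Gamma> \<Longrightarrow> norm f = 1 \<Longrightarrow> \<exists>\<xi>. norm \<xi> = 1 \<and> \<phi> (L.proj i \<xi>) = R.proj i f"

text \<open>\<open>matched\<close> and \<open>matched_inv\<close> exchange their roles, so results
  about \<phi> also apply to its inverse; surjectivity arguments rest on this.\<close>

lemma matched_iso_inverse:
  assumes "matched_iso t A K \<Gamma> p t' B K' q \<phi>"
  shows "matched_iso t' B K' \<Gamma> q t A K p (inv_into (spatial_tensor t A K) \<phi>)"
proof -
  interpret matched_iso t A K \<Gamma> p t' B K' q \<phi> by fact
  have inv: "inv_into L.N \<phi> (\<phi> x) = x" if "x \<in> L.N" for x
    using phi_bij that by (rule bij_betw_inv_into_left)
  show ?thesis
  proof (intro matched_iso.intro frame_iso_inverse matched_iso_axioms.intro)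
    show "frame_iso t A K \<Gamma> p t' B K' \<Gamma> q \<phi>" by unfold_locales
    show "\<exists>f. norm f = 1 \<and> inv_into L.N \<phi> (R.proj i \<xi>) = L.proj i f" if "i \<in> \<Gamma>" "norm \<xi> = 1" for i \<xi>
      using matched_inv[OF that] inv[OF L.proj_in[OF that(1)]] by metis
    show "\<exists>\<xi>. norm \<xi> = 1 \<and> inv_into L.N \<phi> (R.proj i \<xi>) = L.proj i f" if "i \<in> \<Gamma>" "norm f = 1" for i f
      using matched[OF that] inv[OF L.proj_in[OF that(1)]] by metis
  qed
qed

text \<open>The index maps of \<phi> and of its inverse undo each other because a projection
  determines its index.\<close>

lemma (in frame_iso) matched_iso_exists:
  fixes \<xi>0 :: 'h
  assumes \<xi>0: "norm \<xi>0 = 1"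
  obtains \<sigma> where "matched_iso t A K \<Gamma> p t' B K' (q \<circ> \<sigma>) \<phi>"
proof -
  interpret I: frame_iso t' B K' \<Delta> q t A K \<Gamma> p "inv_into L.N \<phi>"
    by (rule frame_iso_inverse) unfold_locales
  have \<phi>I: "\<phi> (inv_into L.N \<phi> x) = x" if "x \<in> R.N" for x
    using phi_bij that by (rule bij_betw_inv_into_right)
  from phi_proj_uniform obtain \<sigma> where \<sigma>: "\<And>i \<xi>. i \<in> \<Gamma> \<Longrightarrow> norm \<xi> = 1 \<Longrightarrow>
      \<sigma> i \<in> \<Delta> \<and> (\<exists>f. norm f = 1 \<and> \<phi> (L.proj i \<xi>) = R.proj (\<sigma> i) f)" by metis
  from I.phi_proj_uniform obtain \<tau> where \<tau>: "\<And>j f. j \<in> \<Delta> \<Longrightarrow> norm f = 1 \<Longrightarrow>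
      \<tau> j \<in> \<Gamma> \<and> (\<exists>\<xi>. norm \<xi> = 1 \<and> inv_into L.N \<phi> (R.proj j f) = L.proj (\<tau> j) \<xi>)" by metis
  have \<tau>': "\<exists>\<xi>. norm \<xi> = 1 \<and> \<phi> (L.proj (\<tau> j) \<xi>) = R.proj j f" if "j \<in> \<Delta>" "norm f = 1" for j f
    using \<tau>[OF that] \<phi>I[OF R.proj_in[OF that(1)]] by metis
  \<comment> \<open>With distinct indices the product of the two projections would be 0, but here it
    is a nonzero idempotent multiplied by itself.\<close>
  have Luniq: "i = j" if "i \<in> \<Gamma>" "j \<in> \<Gamma>" "norm \<xi> = 1" "L.proj i \<xi> = L.proj j \<eta>" for i j \<xi> \<eta>
    using L.proj_proj[OF that(1,2), of \<xi> \<eta>] L.proj_idem[OF that(1,3)] L.proj_nonzero[OF that(1,3)] that(4) by metis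
  have Runiq: "i = j" if "i \<in> \<Delta>" "j \<in> \<Delta>" "norm \<xi> = 1" "R.proj i \<xi> = R.proj j \<eta>" for i j \<xi> \<eta>
    using R.proj_proj[OF that(1,2), of \<xi> \<eta>] R.proj_idem[OF that(1,3)] R.proj_nonzero[OF that(1,3)] that(4) by metis
  have \<sigma>\<tau>: "\<sigma> (\<tau> j) = j" if j: "j \<in> \<Delta>" for j
    using \<tau>[OF j \<xi>0] \<tau>'[OF j \<xi>0] \<sigma> Runiq[OF j] \<xi>0 j by metis
  have \<tau>\<sigma>: "\<tau> (\<sigma> i) = i" if i: "i \<in> \<Gamma>" for i
  proof -
    obtain f where f: "\<sigma> i \<in> \<Delta>" "norm f = 1" "\<phi> (L.proj i \<xi>0) = R.proj (\<sigma> i) f" using \<sigma>[OF i \<xi>0] by blast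
    then obtain \<xi> where \<xi>: "norm \<xi> = 1" "\<phi> (L.proj (\<tau> (\<sigma> i)) \<xi>) = R.proj (\<sigma> i) f" "\<tau> (\<sigma> i) \<in> \<Gamma>"
      using \<tau>' \<tau> by metis
    then have "L.proj (\<tau> (\<sigma> i)) \<xi> = L.proj i \<xi>0" using f i by (metis L.proj_in phi_inject)
    then show ?thesis using Luniq \<xi> i by metis
  qed
  have bij: "bij_betw \<sigma> \<Gamma> \<Delta>"
    by (rule bij_betw_byWitness[of _ \<tau>]) (use \<sigma>\<tau> \<tau>\<sigma> \<sigma> \<tau> \<xi>0 in blast)+
  interpret R': tensor_frame t' B K' \<Gamma> "q \<circ> \<sigma>" by (rule R.tensor_frame_reindex[OF bij])
  have proj: "R'.proj i f = R.proj (\<sigma> i) f" for i f by (simp add: R'.proj_def R.proj_def)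
  show ?thesis
  proof (rule that[of \<sigma>], unfold_locales)
    show "isometric_iso \<phi> L.N R.N" by (rule iso)
    show "\<exists>f. norm f = 1 \<and> \<phi> (L.proj i \<xi>) = R'.proj i f" if "i \<in> \<Gamma>" "norm \<xi> = 1" for i \<xi>
      unfolding proj using \<sigma>[OF that] by blast
    show "\<exists>\<xi>. norm \<xi> = 1 \<and> \<phi> (L.proj i \<xi>) = R'.proj i f" if "i \<in> \<Gamma>" "norm f = 1" for i f
      unfolding proj using \<tau>'[OF _ that(2), of "\<sigma> i"] \<tau>\<sigma>[OF that(1)] \<sigma>[OF that(1) \<xi>0] by metis
  qed
qed

section \<open>The compact factor\<close>

text \<open>Expanding the form at \<open>x + y\<close> and at \<open>x + \<i> *\<^sub>C y\<close>
  gives two equations for the mixed terms whose only solution is 0; complex scalars are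
  essential.\<close>

lemma quadratic_form_zero:
  assumes "clin D" "\<And>g. norm g = 1 \<Longrightarrow> cinner (blinfun_apply D g) g = 0" shows "D = 0"
proof -
  have q: "cinner (D x) x = 0" for x
  proof (cases "x = 0")
    case False
    then obtain g where g: "norm g = 1" "x = of_real (norm x) *\<^sub>C g" by (rule norm_unit_scale_exists)
    show ?thesis by (subst (1 2) g(2)) (simp add: clinD assms(1) cinner_simps assms(2)[OF g(1)])
  qed simp
  show ?thesis
  proof (rule blinfun_eqI, rule cinner_eqI)
    fix x y
    have "cinner (D (x + y)) (x + y) = 0" "cinner (D (x + \<i> *\<^sub>C y)) (x + \<i> *\<^sub>C y) = 0"
      by (rule q)+
    then have 1: "cinner (D x) y + cinner (D y) x = 0" and 2: "\<i> * cinner (D y) x - \<i> * cinner (D x) y = 0"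
      by (simp_all add: blinfun.add_right clinD assms(1) cinner_simps q)
    from 2 have "cinner (D y) x = cinner (D x) y" by simp
    with 1 show "cinner (D x) y = cinner (blinfun_apply 0 x) y" by simp
  qed
qed

lemma (in tensor_frame) unit_ext:
  fixes X Y :: "'c \<Rightarrow>\<^sub>L 'c"
  assumes "\<And>x g. norm g = 1 \<Longrightarrow> X (t x g) = Y (t x g)" shows "X = Y"
proof (rule blinfun_ext)
  fix x y
  show "X (t x y) = Y (t x y)"
  proof (cases "y = 0")
    case False
    then obtain g where g: "norm g = 1" "y = of_real (norm y) *\<^sub>C g" by (rule norm_unit_scale_exists)
    have "t x y = norm y *\<^sub>R t x g"
      by (subst g(2)) (simp add: t_scaleR_right scaleC_of_real)
    then show ?thesis using assms[OF g(1)] by (simp add: blinfun.scaleR_right)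
  qed simp
qed

context matched_iso
begin

text \<open>The second factors \<open>d\<close> with an image of the desired kind form a complex
  vector space, to which polarization applies. That the new factor lies in \<open>K'\<close> is left
  open here; it follows later by slicing.\<close>

lemma phi_p_rank1:
  assumes i: "i \<in> \<Gamma>"
  shows "\<exists>x. clin x \<and> \<phi> (op_tensor t (p i) (rank1 \<xi> \<eta>)) = op_tensor t' (q i) x"
proof -
  have pc: "clin (p i)" and qc: "clin (q i)" using i L.clin_p R.clin_p by blast+
  have inN: "op_tensor t (p i) (rank1 \<xi> \<eta>) \<in> L.N" for \<xi> \<eta>
    by (simp add: L.op_tensor_in_N L.p_in L.rank1_in i)
  define S where "S = {d. clin d \<and> op_tensor t (p i) d \<in> L.N \<and>
    (\<exists>x. clin x \<and> \<phi> (op_tensor t (p i) d) = op_tensor t' (q i) x)}"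
  have add: "d + e \<in> S" if de: "d \<in> S" "e \<in> S" for d e
  proof -
    obtain x y where "clin x" "\<phi> (op_tensor t (p i) d) = op_tensor t' (q i) x"
      "clin y" "\<phi> (op_tensor t (p i) e) = op_tensor t' (q i) y" using de unfolding S_def by blast
    then have "clin (x + y)" "\<phi> (op_tensor t (p i) (d + e)) = op_tensor t' (q i) (x + y)"
      using de pc qc by (simp_all add: S_def clin_add L.op_tensor_add_right R.op_tensor_add_right phi_add)
    then show ?thesis
      using de pc unfolding S_def
      by (auto simp: clin_add L.op_tensor_add_right subalgebra_add L.subalgebra_N)
  qed
  have scale: "c *\<^sub>C d \<in> S" if d: "d \<in> S" for c d
  proof -
    obtain x where "clin x" "\<phi> (op_tensor t (p i) d) = op_tensor t' (q i) x" using d unfolding S_def by blast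
    then have "clin (c *\<^sub>C x)" "\<phi> (op_tensor t (p i) (c *\<^sub>C d)) = op_tensor t' (q i) (c *\<^sub>C x)"
      using d pc qc by (simp_all add: S_def clin_scaleC L.op_tensor_scaleC_right R.op_tensor_scaleC_right phi_scaleC)
    then show ?thesis
      using d pc unfolding S_def
      by (auto simp: clin_scaleC L.op_tensor_scaleC_right subalgebra_scaleC L.subalgebra_N)
  qed
  have diff: "d - e \<in> S" if "d \<in> S" "e \<in> S" for d e
    using add[OF that(1) scale[OF that(2), of "-1"]] by (simp add: scaleC_minus_one)
  have sq: "rank1 \<zeta> \<zeta> \<in> S" for \<zeta>
  proof (cases "\<zeta> = 0")
    case True
    then have "rank1 \<zeta> \<zeta> = 0" using scaleC_rank1[of 0 0 \<zeta>] by simp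
    then show ?thesis
      unfolding S_def using R.op_tensor_zero_right[OF qc] L.op_tensor_zero_right[OF pc]
      by (auto simp: clin_zero phi_zero subalgebra_zero L.subalgebra_N intro!: exI[of _ 0])
  next
    case False
    then obtain g where g: "norm g = 1" "\<zeta> = of_real (norm \<zeta>) *\<^sub>C g" by (rule norm_unit_scale_exists)
    from matched[OF i g(1)] have "rank1 g g \<in> S"
      unfolding S_def L.proj_def R.proj_def using inN clin_rank1 by blast
    moreover have "rank1 \<zeta> \<zeta> = of_real (norm \<zeta>) *\<^sub>C of_real (norm \<zeta>) *\<^sub>C rank1 g g"
      by (subst (1 2) g(2)) (simp add: scaleC_rank1[symmetric] rank1_scaleC)
    ultimately show ?thesis by (simp add: scale)
  qed
  have "rank1 \<xi> \<eta> = (1/4) *\<^sub>C 4 *\<^sub>C rank1 \<xi> \<eta>" by (simp add: scaleC_scaleC)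
  also have "\<dots> \<in> S" unfolding rank1_polarization by (intro scale add diff sq)
  finally show ?thesis unfolding S_def by blast
qed

text \<open>\<open>d\<close> need not be a norm limit of finite-rank operators, so linearity and
  polarization do not reach it. Multiplying by \<open>L.proj j \<xi>\<close> replaces
  \<open>d\<close> by a rank-one operator, and such products determine the image.\<close>

lemma phi_p_compact_factor:
  assumes i: "i \<in> \<Gamma>" and d: "d \<in> K"
  shows "\<exists>c\<in>K'. \<phi> (op_tensor t (p i) d) = op_tensor t' (q i) c"
proof -
  let ?Z = "\<phi> (op_tensor t (p i) d)"
  have pc: "clin (p i)" and qc: "clin (q i)" using i L.clin_p R.clin_p by blast+
  have dc: "clin d" using d by (rule L.clin_K)
  have pd: "op_tensor t (p i) d \<in> L.N" by (simp add: L.op_tensor_in_N L.p_in i d)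
  then have Z: "?Z \<in> R.N" and Zc: "clin ?Z" by (simp_all add: phi_in R.clin_N)
  let ?e = "\<lambda>j. op_tensor t' (q j) id_blinfun"
  have Zproj: "\<exists>x. clin x \<and> ?Z o\<^sub>L R.proj j g = (if i = j then op_tensor t' (q i) x else 0)"
    if j: "j \<in> \<Gamma>" and g: "norm g = 1" for j g
  proof -
    obtain \<xi> where \<xi>: "norm \<xi> = 1" "\<phi> (L.proj j \<xi>) = R.proj j g" using matched_inv[OF j g] by blast
    have "?Z o\<^sub>L R.proj j g = \<phi> (op_tensor t (p i) d o\<^sub>L L.proj j \<xi>)"
      using \<xi>(2) by (simp add: phi_mult pd L.proj_in j)
    also have "op_tensor t (p i) d o\<^sub>L L.proj j \<xi> = (if i = j then op_tensor t (p i) (rank1 (d \<xi>) \<xi>) else 0)"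
      using i j by (simp add: L.proj_def L.op_tensor_compose pc dc L.clin_p clin_rank1 L.p_p compose_rank1
        L.op_tensor_zero_left)
    finally show ?thesis using phi_p_rank1[OF i, of "d \<xi>" \<xi>] by (auto simp: phi_zero intro: clin_zero)
  qed
  \<comment> \<open>On vectors with second leg \<open>g\<close>, a rank-one projection onto
    \<open>g\<close> acts like the identity, so columns of \<open>?Z\<close> can be read off from
    products that \<phi> controls.\<close>
  have projapp: "R.proj j g (t' x g) = ?e j (t' x g)" if "j \<in> \<Gamma>" "norm g = 1" for j x g
    using that by (simp add: R.proj_def R.op_tensor_apply R.clin_p clin_rank1 clin_id rank1_apply cinner_self_unit)
  have off: "?Z o\<^sub>L ?e j = 0" if "j \<in> \<Gamma>" "j \<noteq> i" for j
  proof (rule R.unit_ext)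
    fix x g assume g: "norm (g::'h) = 1"
    have "(?Z o\<^sub>L ?e j) (t' x g) = (?Z o\<^sub>L R.proj j g) (t' x g)" by (simp add: projapp that g)
    also have "?Z o\<^sub>L R.proj j g = 0" using Zproj[OF that(1) g] that(2) by auto
    finally show "(?Z o\<^sub>L ?e j) (t' x g) = blinfun_apply 0 (t' x g)" .
  qed
  obtain v where v: "norm v = 1" "q i v = v" using R.p_unit_vector[OF i] by blast
  \<comment> \<open>The operators \<open>y\<close> found for different \<open>g\<close> have to be
    pieces of one operator. Slicing supplies it, and places it in \<open>K'\<close>.\<close>
  define c where "c = R.sliceR v v ?Z"
  have c: "c \<in> K'" "clin c" by (simp_all add: c_def R.sliceR_N Z R.clin_sliceR Zc)
  have Ze: "?Z o\<^sub>L ?e i = op_tensor t' (q i) c"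
  proof (rule R.unit_ext)
    fix x g assume g: "norm (g::'h) = 1"
    obtain y where y: "clin y" "?Z o\<^sub>L R.proj i g = op_tensor t' (q i) y" using Zproj[OF i g] by auto
    have Zx: "?Z (t' (q i x) g) = t' (q i x) (y g)" for x
    proof -
      have "?Z (t' (q i x) g) = (?Z o\<^sub>L R.proj i g) (t' x g)"
        by (simp add: projapp i g R.op_tensor_apply qc clin_id)
      then show ?thesis by (simp add: y R.op_tensor_apply qc)
    qed
    have "c g = y g"
    proof (rule cinner_eqI)
      fix w
      show "cinner (c g) w = cinner (y g) w"
        using Zx[of v] by (simp add: c_def R.cinner_sliceR v R.cinner_t cinner_self_unit)
    qed
    then show "(?Z o\<^sub>L ?e i) (t' x g) = op_tensor t' (q i) c (t' x g)"
      using Zx by (simp add: R.op_tensor_apply qc clin_id c)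
  qed
  have "?Z - op_tensor t' (q i) c = 0"
  proof (rule R.eq_zero_if_all_corners_zero)
    show "?Z - op_tensor t' (q i) c \<in> R.N"
      by (intro subalgebra_diff R.subalgebra_N Z R.op_tensor_in_N R.p_in i c)
    show "(?Z - op_tensor t' (q i) c) o\<^sub>L ?e j = 0" if "j \<in> \<Gamma>" for j
      using off[OF that] Ze
      by (cases "j = i") (simp_all add: diff_compose R.op_tensor_compose qc c R.clin_p that i clin_id R.p_p
        R.op_tensor_zero_left)
  qed
  then show ?thesis using c(1) by (intro bexI[of _ c]) simp_all
qed

text \<open>The coefficient \<open>cinner (e \<xi>) \<xi>\<close> is read off from a product with
  \<open>L.proj i \<xi>\<close> on both sides, hence it survives a map that is only linear and
  multiplicative.\<close>

lemma compact_factor_hadj: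
  assumes i: "i \<in> \<Gamma>" and d: "d \<in> K" "hadj d \<in> K" and c: "c \<in> K'" "c' \<in> K'"
    and eq: "\<phi> (op_tensor t (p i) d) = op_tensor t' (q i) c" "\<phi> (op_tensor t (p i) (hadj d)) = op_tensor t' (q i) c'"
  shows "c' = hadj c"
proof -
  have pc: "clin (p i)" and qc: "clin (q i)" using i L.clin_p R.clin_p by blast+
  have cc: "clin c" "clin c'" using c R.clin_K by blast+
  have coeff: "cinner (b g) g = cinner (e \<xi>) \<xi>"
    if "e \<in> K" "b \<in> K'" "\<phi> (op_tensor t (p i) e) = op_tensor t' (q i) b" "norm \<xi> = 1" "norm g = 1"
      "\<phi> (L.proj i \<xi>) = R.proj i g" for e b \<xi> g
  proof -
    have ec: "clin e" and bc: "clin b" using that L.clin_K R.clin_K by blast+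
    have eN: "op_tensor t (p i) e \<in> L.N" using that by (simp add: L.op_tensor_in_N L.p_in i)
    have "L.proj i \<xi> o\<^sub>L (op_tensor t (p i) e o\<^sub>L L.proj i \<xi>) = cinner (e \<xi>) \<xi> *\<^sub>C L.proj i \<xi>"
      using i by (simp add: L.proj_def L.op_tensor_compose pc ec clin_rank1 clin_compose L.p_p compose_rank1
        rank1_apply scaleC_rank1[symmetric] L.op_tensor_scaleC_right)
    then have "\<phi> (L.proj i \<xi> o\<^sub>L (op_tensor t (p i) e o\<^sub>L L.proj i \<xi>)) = \<phi> (cinner (e \<xi>) \<xi> *\<^sub>C L.proj i \<xi>)"
      by simp
    then have "R.proj i g o\<^sub>L (op_tensor t' (q i) b o\<^sub>L R.proj i g) = cinner (e \<xi>) \<xi> *\<^sub>C R.proj i g"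
      using that i by (simp add: phi_mult phi_scaleC eN L.proj_in subalgebra_mult L.subalgebra_N)
    moreover have "R.proj i g o\<^sub>L (op_tensor t' (q i) b o\<^sub>L R.proj i g) = cinner (b g) g *\<^sub>C R.proj i g"
      using i by (simp add: R.proj_def R.op_tensor_compose qc bc clin_rank1 clin_compose R.p_p compose_rank1
        rank1_apply scaleC_rank1[symmetric] R.op_tensor_scaleC_right)
    ultimately have "(cinner (b g) g - cinner (e \<xi>) \<xi>) *\<^sub>C R.proj i g = 0"
      using scaleC_add_left[of "cinner (b g) g - cinner (e \<xi>) \<xi>" "cinner (e \<xi>) \<xi>" "R.proj i g"] by simp
    then show ?thesis
      using R.proj_nonzero[OF i that(5)] norm_scaleC[of "cinner (b g) g - cinner (e \<xi>) \<xi>" "R.proj i g"] by simp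
  qed
  have "c' - hadj c = 0"
  proof (rule quadratic_form_zero)
    show "clin (c' - hadj c)" by (simp add: clin_diff cc clin_hadj)
    fix g :: 'h assume g: "norm g = 1"
    obtain \<xi> where \<xi>: "norm \<xi> = 1" "\<phi> (L.proj i \<xi>) = R.proj i g" using matched_inv[OF i g] by blast
    have "cinner (c' g) g = cinner (hadj d \<xi>) \<xi>" by (rule coeff[OF d(2) c(2) eq(2) \<xi>(1) g \<xi>(2)])
    also have "\<dots> = cnj (cinner (d \<xi>) \<xi>)"
      using cinner_commute[of "hadj d \<xi>" \<xi>] by (simp add: cinner_hadj L.clin_K d(1))
    also have "cinner (d \<xi>) \<xi> = cinner (c g) g" by (rule coeff[OF d(1) c(1) eq(1) \<xi>(1) g \<xi>(2), symmetric])
    also have "cnj (cinner (c g) g) = cinner (hadj c g) g"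
      using cinner_commute[of "hadj c g" g] by (simp add: cinner_hadj cc)
    finally show "cinner ((c' - hadj c) g) g = 0" by (simp add: blinfun.diff_left cinner_simps)
  qed
  then show ?thesis by simp
qed

text \<open>A single index provides an algebra isomorphism \<open>\<kappa>\<close> from
  \<open>K\<close> onto \<open>K'\<close>; the restriction to diagonals is where both an element and
  its adjoint are available.\<close>

lemma star_isomorphic_diag:
  assumes i: "i \<in> \<Gamma>" shows "star_isomorphic (diag K) (diag K')"
proof -
  interpret I: matched_iso t' B K' \<Gamma> q t A K p "inv_into L.N \<phi>"
    by (rule matched_iso_inverse) unfold_locales
  have pc: "clin (p i)" and qc: "clin (q i)" using i L.clin_p R.clin_p by blast+
  have K: "K \<subseteq> \<B>" "K' \<subseteq> \<B>" using L.K R.K by (auto simp: subalgebra_def)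
  obtain \<kappa> where \<kappa>: "\<And>d. d \<in> K \<Longrightarrow> \<kappa> d \<in> K'"
    "\<And>d. d \<in> K \<Longrightarrow> \<phi> (op_tensor t (p i) d) = op_tensor t' (q i) (\<kappa> d)"
    using phi_p_compact_factor[OF i] by metis
  have eqI: "\<kappa> d = c" if "d \<in> K" "c \<in> K'" "\<phi> (op_tensor t (p i) d) = op_tensor t' (q i) c" for d c
    using R.op_tensor_p_inject[OF i, of "\<kappa> d" c] that \<kappa> by (simp add: R.clin_K)
  have inN: "op_tensor t (p i) d \<in> L.N" if "d \<in> K" for d by (simp add: L.op_tensor_in_N L.p_in i that)
  have surj: "\<exists>d\<in>K. \<kappa> d = c" if c: "c \<in> K'" for c
  proof -
    obtain d where d: "d \<in> K" "inv_into L.N \<phi> (op_tensor t' (q i) c) = op_tensor t (p i) d"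
      using I.phi_p_compact_factor[OF i c] by blast
    have "op_tensor t' (q i) c \<in> R.N" by (simp add: R.op_tensor_in_N R.p_in i c)
    then have "\<phi> (op_tensor t (p i) d) = op_tensor t' (q i) c"
      using bij_betw_inv_into_right[OF phi_bij] d(2) by metis
    then show ?thesis using eqI[OF d(1) c] d(1) by blast
  qed
  have inj: "d = e" if "d \<in> K" "e \<in> K" "\<kappa> d = \<kappa> e" for d e
  proof -
    have "\<phi> (op_tensor t (p i) d) = \<phi> (op_tensor t (p i) e)" by (simp add: \<kappa>(2) that)
    then show ?thesis
      using that by (intro L.op_tensor_p_inject[OF i]) (simp_all add: L.clin_K phi_inject inN)
  qed
  have add: "\<kappa> (d + e) = \<kappa> d + \<kappa> e" if "d \<in> K" "e \<in> K" for d e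
    using that by (intro eqI) (simp_all add: subalgebra_add L.K R.K \<kappa> L.op_tensor_add_right R.op_tensor_add_right
      pc qc L.clin_K R.clin_K phi_add inN)
  have scale: "\<kappa> (a *\<^sub>C d) = a *\<^sub>C \<kappa> d" if "d \<in> K" for a d
    using that by (intro eqI) (simp_all add: subalgebra_scaleC L.K R.K \<kappa> L.op_tensor_scaleC_right
      R.op_tensor_scaleC_right pc qc L.clin_K R.clin_K phi_scaleC inN)
  have mult: "\<kappa> (d o\<^sub>L e) = \<kappa> d o\<^sub>L \<kappa> e" if "d \<in> K" "e \<in> K" for d e
  proof (intro eqI)
    have "op_tensor t (p i) (d o\<^sub>L e) = op_tensor t (p i) d o\<^sub>L op_tensor t (p i) e"
      using that i by (simp add: L.op_tensor_compose pc L.clin_K L.p_p)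
    then show "\<phi> (op_tensor t (p i) (d o\<^sub>L e)) = op_tensor t' (q i) (\<kappa> d o\<^sub>L \<kappa> e)"
      using that i by (simp add: phi_mult inN \<kappa> R.op_tensor_compose qc R.clin_K R.p_p)
  qed (use that \<kappa> in \<open>simp_all add: subalgebra_mult L.K R.K\<close>)
  have star: "\<kappa> (hadj d) = hadj (\<kappa> d)" if "d \<in> K" "hadj d \<in> K" for d
    by (rule compact_factor_hadj[OF i that]) (simp_all add: that \<kappa>)
  have in_diag: "\<kappa> d \<in> diag K'" if "d \<in> diag K" for d
    using that star[of d] \<kappa>(1)[of d] \<kappa>(1)[of "hadj d"] by (simp add: mem_diag_iff K)
  have diagK: "d \<in> K" "hadj d \<in> K" if "d \<in> diag K" for d
    using that by (simp_all add: mem_diag_iff K)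
  have "bij_betw \<kappa> (diag K) (diag K')"
    unfolding bij_betw_def
  proof
    show "inj_on \<kappa> (diag K)" by (rule inj_onI) (use inj diagK in blast)
    show "\<kappa> ` diag K = diag K'"
    proof (intro equalityI subsetI)
      fix c assume "c \<in> diag K'"
      then have c: "c \<in> K'" "hadj c \<in> K'" by (simp_all add: mem_diag_iff K)
      obtain d d' where d: "d \<in> K" "\<kappa> d = c" "d' \<in> K" "\<kappa> d' = hadj c" using surj c by metis
      have "\<phi> (op_tensor t (p i) d) = op_tensor t' (q i) c" "\<phi> (op_tensor t (p i) d') = op_tensor t' (q i) (hadj c)"
        using d \<kappa>(2) by metis+
      then have "inv_into L.N \<phi> (op_tensor t' (q i) c) = op_tensor t (p i) d"
        "inv_into L.N \<phi> (op_tensor t' (q i) (hadj c)) = op_tensor t (p i) d'"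
        using bij_betw_inv_into_left[OF phi_bij] inN d by metis+
      \<comment> \<open>The adjoint lemma for the inverse isomorphism shows that the preimages of
        \<open>c\<close> and \<open>hadj c\<close> are adjoint, so \<open>d\<close> lies in the
        diagonal.\<close>
      then have "d' = hadj d" by (intro I.compact_factor_hadj[OF i c d(1,3)])
      then show "c \<in> \<kappa> ` diag K" using d by (auto simp: mem_diag_iff K)
    qed (use in_diag in blast)
  qed
  moreover have "\<kappa> (adj d) = adj (\<kappa> d)" if "d \<in> diag K" for d
    using star[OF diagK[OF that]] diagK[OF that] \<kappa>(1) K by (simp add: adj_eq_hadj subset_iff)
  ultimately have "star_isomorphism \<kappa> (diag K) (diag K')"
    unfolding star_isomorphism_def algebra_isomorphism_def by (simp add: add scale mult diagK)
  then show ?thesis unfolding star_isomorphic_def by blast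
qed

end

section \<open>The non-compact factor\<close>

lemma isometry_hadj_compose:
  assumes "\<And>x. norm (blinfun_apply T x) = norm x" shows "hadj T o\<^sub>L T = id_blinfun"
proof (rule blinfun_eqI, rule vector_eq_ldot[THEN iffD1], rule allI)
  fix x y
  have "(norm (T (x + y)))\<^sup>2 = (norm (x + y))\<^sup>2" by (simp add: assms)
  then have "inner (T x) (T y) = inner x y"
    using assms[of x] assms[of y]
    by (simp add: blinfun.add_right power2_norm_eq_inner inner_simps inner_commute)
      (simp add: norm_eq_sqrt_inner inner_commute)
  then show "inner x ((hadj T o\<^sub>L T) y) = inner x (id_blinfun y)" by (simp add: inner_hadj)
qed

lemma (in tensor_frame) p_orthogonal:
  assumes "i \<in> \<Gamma>" "j \<in> \<Gamma>" "i \<noteq> j" shows "cinner (p i x) (p j y) = 0"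
proof -
  have "cinner (p i x) (p j y) = cinner x ((p i o\<^sub>L p j) y)"
    by (simp add: cinner_hadj clin_p hadj_p assms)
  then show ?thesis by (simp add: p_p assms)
qed

lemma cinner_zero_imp_orthogonal: "cinner x y = 0 \<Longrightarrow> orthogonal x (y::'a::chilbert_space)"
  by (simp add: orthogonal_def inner_eq_Re_cinner)

text \<open>The isometry \<open>x \<mapsto> \<Sum>i. p i x \<otimes> f i\<close>.\<close>

lemma (in tensor_frame) twist_isometry:
  assumes f: "\<And>i. i \<in> \<Gamma> \<Longrightarrow> norm (f i) = 1"
  obtains T where "clin T" "hadj T o\<^sub>L T = id_blinfun" "\<And>i. i \<in> \<Gamma> \<Longrightarrow> T o\<^sub>L p i = tensR (f i) o\<^sub>L p i"
    "norm T \<le> 1"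
proof -
  define S where "S F x = (\<Sum>i\<in>F. t (p i x) (f i))" for F x
  have S_add: "S F (x + y) = S F x + S F y" for F x y
    by (simp add: S_def blinfun.add_right t_add_left sum.distrib)
  have S_scaleR: "S F (r *\<^sub>R x) = r *\<^sub>R S F x" for F x r
    by (simp add: S_def blinfun.scaleR_right t_scaleR_left scaleR_sum_right)
  \<comment> \<open>Both Pythagorean sums rest on the orthogonal ranges of the \<open>p i\<close>;
    the \<open>f i\<close> only have to be unit vectors.\<close>
  have norm_S: "norm (S F x) = norm (sum p F x)" if F: "finite F" "F \<subseteq> \<Gamma>" for F x
  proof -
    have "(norm (S F x))\<^sup>2 = (\<Sum>i\<in>F. (norm (t (p i x) (f i)))\<^sup>2)"
      unfolding S_def using F
      by (intro norm_sum_Pythagorean)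
        (auto simp: pairwise_def intro!: cinner_zero_imp_orthogonal simp: cinner_t p_orthogonal subset_iff)
    also have "\<dots> = (\<Sum>i\<in>F. (norm (p i x))\<^sup>2)"
      using F f by (intro sum.cong) (auto simp: norm_t)
    also have "\<dots> = (norm (sum p F x))\<^sup>2"
      unfolding blinfun.sum_left using F
      by (intro norm_sum_Pythagorean[symmetric])
        (auto simp: pairwise_def intro!: cinner_zero_imp_orthogonal simp: p_orthogonal subset_iff)
    finally show ?thesis by (rule power2_eq_imp_eq) simp_all
  qed
  \<comment> \<open>\<open>G\<close> is the graph over those vectors for which the partial sums are
    eventually constant. They include all \<open>sum p F x\<close>, hence are dense.\<close>
  define G where "G = {z. \<forall>\<^sub>F F in fin. sum p F (fst z) = fst z \<and> S F (fst z) = snd z}"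
  have sub: "subspace G"
    unfolding subspace_def
  proof (intro conjI ballI allI)
    show "0 \<in> G" by (simp add: G_def S_def)
    show "z + w \<in> G" if "z \<in> G" "w \<in> G" for z w
      using that unfolding G_def mem_Collect_eq
      by eventually_elim (simp add: S_add blinfun.add_right)
    show "r *\<^sub>R z \<in> G" if "z \<in> G" for r z
      using that unfolding G_def mem_Collect_eq
      by eventually_elim (simp add: S_scaleR blinfun.scaleR_right)
  qed
  have bound: "norm v \<le> 1 * norm u" if "(u, v) \<in> G" for u v
  proof -
    have "\<forall>\<^sub>F F in fin. norm v \<le> norm u"
      using that[unfolded G_def mem_Collect_eq] eventually_fin
    proof eventually_elim
      case (elim F)
      then show ?case using norm_S[of F u] by simp
    qed
    then show ?thesis by (simp add: eventually_const)
  qed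
  have G_p: "(sum p F x, S F x) \<in> G" if F: "finite F" "F \<subseteq> \<Gamma>" for F x
    unfolding G_def mem_Collect_eq using eventually_fin_superset[OF F]
  proof eventually_elim
    case (elim F')
    then have 1: "sum p F' (sum p F x) = sum p F x"
      using sum_p_sum_p[of F' F] by (metis F(1) blinfun_apply_blinfun_compose)
    have "S F' (sum p F x) = (\<Sum>i\<in>F'. if i \<in> F then t (p i x) (f i) else 0)"
      unfolding S_def
    proof (rule sum.cong[OF refl])
      fix i assume "i \<in> F'"
      then have "p i (sum p F x) = (p i o\<^sub>L sum p F) x" "i \<in> \<Gamma>" using elim by auto
      then show "t (p i (sum p F x)) (f i) = (if i \<in> F then t (p i x) (f i) else 0)"
        by (simp add: p_sum_p F)
    qed
    also have "\<dots> = S F x"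
      using elim F by (simp add: S_def sum.If_cases Int_absorb1)
    finally show ?case using 1 by simp
  qed
  have dense: "closure (fst ` G) = UNIV"
  proof -
    have "x \<in> closure (fst ` G)" for x
    proof (rule Lim_in_closed_set[OF closed_closure _ finite_subsets_at_top_neq_bot p_strong[of x]])
      show "\<forall>\<^sub>F F in fin. sum p F x \<in> closure (fst ` G)"
        using eventually_fin
      proof eventually_elim
        case (elim F)
        then have "sum p F x \<in> fst ` G" 
          using G_p[of F x] image_eqI[of "sum p F x" fst "(sum p F x, S F x)" G] by simp
        then show ?case by (rule subsetD[OF closure_subset])
      qed
    qed
    then show ?thesis by blast
  qed
  obtain T :: "'a \<Rightarrow>\<^sub>L 'c" where T: "\<And>u v. (u, v) \<in> G \<Longrightarrow> T u = v" "norm T \<le> 1"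
    by (rule bounded_linear_from_dense_graph[OF sub zero_le_one _ dense]) (rule bound, assumption, rule that)
  have T_p: "T (sum p F x) = S F x" if "finite F" "F \<subseteq> \<Gamma>" for F x using T(1) G_p that by blast
  have T_lim: "((\<lambda>F. S F x) \<longlongrightarrow> T x) fin" for x
  proof -
    have "((\<lambda>F. T (sum p F x)) \<longlongrightarrow> T x) fin"
      by (rule blinfun.tendsto[OF tendsto_const p_strong])
    then show ?thesis
      by (rule Lim_transform_eventually) (use eventually_fin in \<open>eventually_elim, simp add: T_p\<close>)
  qed
  show ?thesis
  proof (rule that[of T])
    show "clin T"
      unfolding clin_def
    proof (intro allI)
      fix c x
      have "((\<lambda>F. c *\<^sub>C S F x) \<longlongrightarrow> c *\<^sub>C T x) fin"
        by (rule bounded_linear.tendsto[OF bounded_linear_scaleC T_lim])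
      moreover have "\<forall>\<^sub>F F in fin. c *\<^sub>C S F x = S F (c *\<^sub>C x)"
        using eventually_fin
        by eventually_elim (auto simp: S_def scaleC_sum_right clinD clin_p t_scaleC_left intro!: sum.cong)
      ultimately have "((\<lambda>F. S F (c *\<^sub>C x)) \<longlongrightarrow> c *\<^sub>C T x) fin"
        by (rule Lim_transform_eventually)
      then show "T (c *\<^sub>C x) = c *\<^sub>C T x"
        by (rule tendsto_unique[OF finite_subsets_at_top_neq_bot T_lim])
    qed
    have "norm (T x) = norm x" for x
    proof (rule tendsto_unique[OF finite_subsets_at_top_neq_bot[of \<Gamma>]])
      show "((\<lambda>F. norm (S F x)) \<longlongrightarrow> norm (T x)) fin" by (intro tendsto_norm T_lim)
      have "((\<lambda>F. norm (sum p F x)) \<longlongrightarrow> norm x) fin" by (intro tendsto_norm p_strong)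
      then show "((\<lambda>F. norm (S F x)) \<longlongrightarrow> norm x) fin"
        by (rule Lim_transform_eventually) (use eventually_fin in \<open>eventually_elim, simp add: norm_S\<close>)
    qed
    then show "hadj T o\<^sub>L T = id_blinfun" by (rule isometry_hadj_compose)
    show "T o\<^sub>L p i = tensR (f i) o\<^sub>L p i" if "i \<in> \<Gamma>" for i
      by (rule blinfun_eqI) (use T_p[of "{i}"] that in \<open>simp add: S_def\<close>)
    show "norm T \<le> 1" by (rule T(2))
  qed
qed

lemma (in tensor_space) norm_op_tensor_unit:
  assumes a: "clin a" and \<xi>: "norm \<xi> = 1" shows "norm (op_tensor t a (rank1 \<xi> \<xi>)) = norm a"
proof (rule antisym)
  have "norm (op_tensor t a (rank1 \<xi> \<xi>)) \<le> norm a * norm (rank1 \<xi> \<xi>)"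
    by (rule norm_op_tensor_le[OF a clin_rank1])
  also have "\<dots> \<le> norm a * 1" using norm_rank1_le[of \<xi> \<xi>] \<xi> by (intro mult_left_mono) auto
  finally show "norm (op_tensor t a (rank1 \<xi> \<xi>)) \<le> norm a" by simp
  show "norm a \<le> norm (op_tensor t a (rank1 \<xi> \<xi>))"
  proof (rule norm_blinfun_bound)
    fix x
    have "norm (a x) = norm (op_tensor t a (rank1 \<xi> \<xi>) (t x \<xi>))"
      by (simp add: op_tensor_apply a clin_rank1 rank1_apply cinner_self_unit \<xi> norm_t)
    also have "\<dots> \<le> norm (op_tensor t a (rank1 \<xi> \<xi>)) * norm (t x \<xi>)" by (rule norm_blinfun)
    finally show "norm (a x) \<le> norm (op_tensor t a (rank1 \<xi> \<xi>)) * norm x" by (simp add: norm_t \<xi>)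
  qed simp
qed

lemma tendsto_in_closed:
  assumes "(f \<longlongrightarrow> x) F" "F \<noteq> bot" "closed S" "\<forall>\<^sub>F i in F. f i \<in> S" shows "x \<in> S"
  using Lim_in_closed_set[OF assms(3,4,2,1)] .

text \<open>Conjugation by \<open>T\<close> carries each \<open>q i\<close> to the image of
  \<open>p i\<close> \<otimes> \<theta>, which aligns the approximate units of both sides. Since
  \<open>\<psi> a\<close> and the image of \<open>a\<close> \<otimes> \<theta> are compressions of
  each other by contractions, \<open>\<psi>\<close> is isometric and both bounds can be taken to be
  1.\<close>

lemma (in matched_iso) bicontinuously_isomorphic:
  fixes \<xi>0 :: 'h
  assumes \<xi>0: "norm \<xi>0 = 1" shows "bicontinuously_isomorphic A B"
proof -
  let ?th = "rank1 \<xi>0 \<xi>0"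
  have th: "clin ?th" by (rule clin_rank1)
  have thth: "?th o\<^sub>L ?th = ?th" by (simp add: rank1_rank1 cinner_self_unit \<xi>0)
  obtain f where f: "\<And>i. i \<in> \<Gamma> \<Longrightarrow> norm (f i) = 1" "\<And>i. i \<in> \<Gamma> \<Longrightarrow> \<phi> (L.proj i \<xi>0) = R.proj i (f i)"
    using matched[OF _ \<xi>0] by metis
  obtain T where T: "clin T" "hadj T o\<^sub>L T = id_blinfun" "\<And>i. i \<in> \<Gamma> \<Longrightarrow> T o\<^sub>L q i = R.tensR (f i) o\<^sub>L q i"
    "norm T \<le> 1" using R.twist_isometry[of f] f(1) by blast
  let ?T' = "hadj T"
  have T': "clin ?T'" by (rule clin_hadj[OF T(1)])
  have T'T: "?T' o\<^sub>L (T o\<^sub>L X) = X" "?T' o\<^sub>L (T o\<^sub>L Y) = Y"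
    for X :: "'b \<Rightarrow>\<^sub>L 'b" and Y :: "'d \<Rightarrow>\<^sub>L 'b"
    by (simp_all add: T(2) flip: compose_assoc)
  have q_T': "q i o\<^sub>L ?T' = q i o\<^sub>L hadj (R.tensR (f i))" if i: "i \<in> \<Gamma>" for i
  proof -
    have "hadj (T o\<^sub>L q i) = hadj (R.tensR (f i) o\<^sub>L q i)" by (simp add: T(3) i)
    then show ?thesis by (simp add: hadj_compose T(1) R.clin_p i R.clin_tensR R.hadj_p)
  qed
  have proj_T: "R.proj i (f i) = T o\<^sub>L (q i o\<^sub>L ?T')" if i: "i \<in> \<Gamma>" for i
  proof (rule R.blinfun_ext)
    fix x y
    have "hadj (R.tensR (f i)) (t' x y) = cinner y (f i) *\<^sub>C x"
      by (rule cinner_eqI) (simp add: cinner_hadj' R.clin_tensR R.cinner_t cinner_simps)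
    then have "(T o\<^sub>L (q i o\<^sub>L ?T')) (t' x y) = (T o\<^sub>L q i) (cinner y (f i) *\<^sub>C x)"
      by (simp add: q_T' i)
    also have "\<dots> = t' (q i (cinner y (f i) *\<^sub>C x)) (f i)" by (simp add: T(3) i)
    finally show "R.proj i (f i) (t' x y) = (T o\<^sub>L (q i o\<^sub>L ?T')) (t' x y)"
      by (simp add: R.proj_def R.op_tensor_apply R.clin_p i clin_rank1 rank1_apply clinD
        R.t_scaleC_left R.t_scaleC_right)
  qed
  have atN: "op_tensor t a ?th \<in> L.N" if "a \<in> A" for a by (simp add: L.op_tensor_in_N that L.rank1_in)
  have phi_sum: "\<phi> (op_tensor t (sum p F) ?th) = T o\<^sub>L (sum q F o\<^sub>L ?T')" if F: "finite F" "F \<subseteq> \<Gamma>" for F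
    using F
  proof (induction F rule: finite_induct)
    case empty
    then show ?case by (simp add: L.op_tensor_zero_left th phi_zero)
  next
    case (insert i F)
    have "op_tensor t (sum p (insert i F)) ?th = L.proj i \<xi>0 + op_tensor t (sum p F) ?th"
      using insert by (simp add: L.proj_def L.op_tensor_add_left L.clin_p L.clin_sum_p th)
    then have "\<phi> (op_tensor t (sum p (insert i F)) ?th) = R.proj i (f i) + (T o\<^sub>L (sum q F o\<^sub>L ?T'))"
      using insert by (simp add: phi_add L.proj_in atN L.sum_p_in f)
    then show ?case using insert by (simp add: proj_T add_compose compose_add)
  qed
  define \<psi> where "\<psi> a = ?T' o\<^sub>L (\<phi> (op_tensor t a ?th) o\<^sub>L T)" for a
  \<comment> \<open>An equivalence, because both directions occur: forwards for elements
    \<open>a\<close> \<otimes> \<theta>, backwards for the preimage of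
    \<open>T o\<^sub>L (b o\<^sub>L hadj T)\<close>.\<close>
  have at_left: "((\<lambda>F. op_tensor t (sum p F) ?th o\<^sub>L X) \<longlongrightarrow> X) L.fin \<longleftrightarrow>
      ((\<lambda>F. T o\<^sub>L (sum q F o\<^sub>L (?T' o\<^sub>L \<phi> X))) \<longlongrightarrow> \<phi> X) L.fin" if X: "X \<in> L.N" for X
  proof -
    have 1: "\<forall>\<^sub>F F in L.fin. op_tensor t (sum p F) ?th o\<^sub>L X \<in> L.N"
      using L.eventually_fin by eventually_elim (simp add: subalgebra_mult L.subalgebra_N X atN L.sum_p_in)
    have "\<forall>\<^sub>F F in L.fin. \<phi> (op_tensor t (sum p F) ?th o\<^sub>L X) = T o\<^sub>L (sum q F o\<^sub>L (?T' o\<^sub>L \<phi> X))"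
      using L.eventually_fin by eventually_elim (simp add: phi_mult X atN L.sum_p_in phi_sum compose_assoc)
    from tendsto_cong[OF this] phi_tendsto_iff[OF 1 X] show ?thesis by simp
  qed
  have at_right: "((\<lambda>F. X o\<^sub>L op_tensor t (sum p F) ?th) \<longlongrightarrow> X) L.fin \<longleftrightarrow>
      ((\<lambda>F. \<phi> X o\<^sub>L (T o\<^sub>L (sum q F o\<^sub>L ?T'))) \<longlongrightarrow> \<phi> X) L.fin" if X: "X \<in> L.N" for X
  proof -
    have 1: "\<forall>\<^sub>F F in L.fin. X o\<^sub>L op_tensor t (sum p F) ?th \<in> L.N"
      using L.eventually_fin by eventually_elim (simp add: subalgebra_mult L.subalgebra_N X atN L.sum_p_in)
    have "\<forall>\<^sub>F F in L.fin. \<phi> (X o\<^sub>L op_tensor t (sum p F) ?th) = \<phi> X o\<^sub>L (T o\<^sub>L (sum q F o\<^sub>L ?T'))"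
      using L.eventually_fin by eventually_elim (simp add: phi_mult X atN L.sum_p_in phi_sum)
    from tendsto_cong[OF this] phi_tendsto_iff[OF 1 X] show ?thesis by simp
  qed
  have lim_left: "((\<lambda>F. T o\<^sub>L (sum q F o\<^sub>L (?T' o\<^sub>L \<phi> (op_tensor t a ?th)))) \<longlongrightarrow> \<phi> (op_tensor t a ?th)) L.fin"
    if a: "a \<in> A" for a
  proof -
    have cl: "\<forall>\<^sub>F F in L.fin. clin (sum p F o\<^sub>L a)"
      using L.eventually_fin by eventually_elim (simp add: clin_compose L.clin_A a L.clin_sum_p)
    have "((\<lambda>F. op_tensor t (sum p F o\<^sub>L a) ?th) \<longlongrightarrow> op_tensor t a ?th) L.fin"
      by (rule L.tendsto_op_tensor_left[OF L.p_approx_left[OF a] cl L.clin_A[OF a] th])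
    moreover have "\<forall>\<^sub>F F in L.fin. op_tensor t (sum p F o\<^sub>L a) ?th = op_tensor t (sum p F) ?th o\<^sub>L op_tensor t a ?th"
      using L.eventually_fin by eventually_elim (simp add: L.op_tensor_compose L.clin_A a L.clin_sum_p th thth)
    ultimately have "((\<lambda>F. op_tensor t (sum p F) ?th o\<^sub>L op_tensor t a ?th) \<longlongrightarrow> op_tensor t a ?th) L.fin"
      by (rule Lim_transform_eventually)
    then show ?thesis using at_left[OF atN[OF a]] by simp
  qed
  have lim_right: "((\<lambda>F. \<phi> (op_tensor t a ?th) o\<^sub>L (T o\<^sub>L (sum q F o\<^sub>L ?T'))) \<longlongrightarrow> \<phi> (op_tensor t a ?th)) L.fin"
    if a: "a \<in> A" for a
  proof -
    have cl: "\<forall>\<^sub>F F in L.fin. clin (a o\<^sub>L sum p F)"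
      using L.eventually_fin by eventually_elim (simp add: clin_compose L.clin_A a L.clin_sum_p)
    have "((\<lambda>F. op_tensor t (a o\<^sub>L sum p F) ?th) \<longlongrightarrow> op_tensor t a ?th) L.fin"
      by (rule L.tendsto_op_tensor_left[OF L.p_approx_right[OF a] cl L.clin_A[OF a] th])
    moreover have "\<forall>\<^sub>F F in L.fin. op_tensor t (a o\<^sub>L sum p F) ?th = op_tensor t a ?th o\<^sub>L op_tensor t (sum p F) ?th"
      using L.eventually_fin by eventually_elim (simp add: L.op_tensor_compose L.clin_A a L.clin_sum_p th thth)
    ultimately have "((\<lambda>F. op_tensor t a ?th o\<^sub>L op_tensor t (sum p F) ?th) \<longlongrightarrow> op_tensor t a ?th) L.fin"
      by (rule Lim_transform_eventually)
    then show ?thesis using at_right[OF atN[OF a]] by simp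
  qed
  \<comment> \<open>\<open>T o\<^sub>L hadj T\<close> fixes every member of the net because
    \<open>hadj T o\<^sub>L T\<close> is the identity; so it fixes the limit, and cutting down to
    the range of \<open>T\<close> loses nothing.\<close>
  have range_left: "T o\<^sub>L (?T' o\<^sub>L \<phi> (op_tensor t a ?th)) = \<phi> (op_tensor t a ?th)" if a: "a \<in> A" for a
  proof (rule tendsto_unique[OF finite_subsets_at_top_neq_bot[of \<Gamma>]])
    show "((\<lambda>F. T o\<^sub>L (sum q F o\<^sub>L (?T' o\<^sub>L \<phi> (op_tensor t a ?th)))) \<longlongrightarrow> \<phi> (op_tensor t a ?th)) L.fin"
      by (rule lim_left[OF a])
    show "((\<lambda>F. T o\<^sub>L (sum q F o\<^sub>L (?T' o\<^sub>L \<phi> (op_tensor t a ?th)))) \<longlongrightarrow> T o\<^sub>L (?T' o\<^sub>L \<phi> (op_tensor t a ?th))) L.fin"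
      using tendsto_compose_right[OF lim_left[OF a], of "T o\<^sub>L ?T'"] by (simp add: compose_assoc T'T)
  qed
  have range_right: "\<phi> (op_tensor t a ?th) o\<^sub>L (T o\<^sub>L ?T') = \<phi> (op_tensor t a ?th)" if a: "a \<in> A" for a
  proof (rule tendsto_unique[OF finite_subsets_at_top_neq_bot[of \<Gamma>]])
    show "((\<lambda>F. \<phi> (op_tensor t a ?th) o\<^sub>L (T o\<^sub>L (sum q F o\<^sub>L ?T'))) \<longlongrightarrow> \<phi> (op_tensor t a ?th)) L.fin"
      by (rule lim_right[OF a])
    show "((\<lambda>F. \<phi> (op_tensor t a ?th) o\<^sub>L (T o\<^sub>L (sum q F o\<^sub>L ?T'))) \<longlongrightarrow> \<phi> (op_tensor t a ?th) o\<^sub>L (T o\<^sub>L ?T')) L.fin"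
      using tendsto_compose_left[OF lim_right[OF a], of "T o\<^sub>L ?T'"] by (simp add: compose_assoc)
        (simp add: T(2) flip: compose_assoc)
  qed
  have psi_mult: "\<psi> (a o\<^sub>L b) = \<psi> a o\<^sub>L \<psi> b" if "a \<in> A" "b \<in> A" for a b
  proof -
    have "op_tensor t (a o\<^sub>L b) ?th = op_tensor t a ?th o\<^sub>L op_tensor t b ?th"
      using that by (simp add: L.op_tensor_compose L.clin_A th thth)
    then have "\<psi> (a o\<^sub>L b) = ?T' o\<^sub>L ((\<phi> (op_tensor t a ?th) o\<^sub>L (T o\<^sub>L ?T')) o\<^sub>L (\<phi> (op_tensor t b ?th) o\<^sub>L T))"
      using that by (simp add: \<psi>_def phi_mult atN range_right compose_assoc)
    then show ?thesis by (simp add: \<psi>_def compose_assoc)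
  qed
  have psi_add: "\<psi> (a + b) = \<psi> a + \<psi> b" if "a \<in> A" "b \<in> A" for a b
    using that by (simp add: \<psi>_def L.op_tensor_add_left L.clin_A th phi_add atN add_compose compose_add)
  have psi_scaleC: "\<psi> (c *\<^sub>C a) = c *\<^sub>C \<psi> a" if "a \<in> A" for a c
    using that by (simp add: \<psi>_def L.op_tensor_scaleC_left L.clin_A th phi_scaleC atN scaleC_compose_left
      scaleC_compose_right T')
  have T_psi: "T o\<^sub>L (\<psi> a o\<^sub>L ?T') = \<phi> (op_tensor t a ?th)" if "a \<in> A" for a
    using range_left[OF that] range_right[OF that] by (simp add: \<psi>_def flip: compose_assoc)
  have T'_le: "norm ?T' \<le> 1" using norm_hadj_le T(4) by (rule order_trans)
  have norm_sandwich: "norm (U o\<^sub>L (X o\<^sub>L V)) \<le> norm X" if "norm U \<le> 1" "norm V \<le> 1"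
    for U :: "'x::real_normed_vector \<Rightarrow>\<^sub>L 'y::real_normed_vector" and X :: "'z::real_normed_vector \<Rightarrow>\<^sub>L 'x"
      and V :: "'w::real_normed_vector \<Rightarrow>\<^sub>L 'z"
  proof -
    have "norm (U o\<^sub>L (X o\<^sub>L V)) \<le> norm U * norm (X o\<^sub>L V)" by (rule norm_blinfun_compose)
    also have "\<dots> \<le> 1 * (norm X * norm V)" using that by (intro mult_mono norm_blinfun_compose) auto
    also have "\<dots> \<le> norm X" using that by (simp add: mult_left_le)
    finally show ?thesis .
  qed
  have psi_norm: "norm (\<psi> a) = norm a" if a: "a \<in> A" for a
  proof (rule antisym)
    have *: "norm (\<phi> (op_tensor t a ?th)) = norm a"
      by (simp add: phi_norm atN a L.norm_op_tensor_unit L.clin_A \<xi>0)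
    show "norm (\<psi> a) \<le> norm a" unfolding \<psi>_def *[symmetric] by (rule norm_sandwich[OF T'_le T(4)])
    show "norm a \<le> norm (\<psi> a)"
      unfolding *[symmetric] T_psi[OF a, symmetric] by (rule norm_sandwich[OF T(4) T'_le])
  qed
  have psi_in: "\<psi> a \<in> B" if a: "a \<in> A" for a
  proof -
    let ?Z = "\<phi> (op_tensor t a ?th)"
    have Z: "?Z \<in> R.N" by (simp add: phi_in atN a)
    \<comment> \<open>Next to \<open>q i\<close> and \<open>q j\<close> the isometry is a tensoring
      map, so a corner of \<open>\<psi> a\<close> is a corner of a slice.\<close>
    have corner: "q i o\<^sub>L (\<psi> a o\<^sub>L q j) \<in> B" if "i \<in> \<Gamma>" "j \<in> \<Gamma>" for i j
    proof -
      have "q i o\<^sub>L (\<psi> a o\<^sub>L q j) = (q i o\<^sub>L ?T') o\<^sub>L (?Z o\<^sub>L (T o\<^sub>L q j))" by (simp add: \<psi>_def compose_assoc)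
      also have "\<dots> = q i o\<^sub>L (R.sliceL (f j) (f i) ?Z o\<^sub>L q j)"
        by (simp add: q_T' T(3) that R.sliceL_def compose_assoc)
      also have "\<dots> \<in> B" by (intro subalgebra_mult R.A(1) R.p_in that R.sliceL_N Z)
      finally show ?thesis .
    qed
    have psi_left: "((\<lambda>F. sum q F o\<^sub>L \<psi> a) \<longlongrightarrow> \<psi> a) L.fin"
      using tendsto_compose_right[OF tendsto_compose_left[OF lim_left[OF a], of T], of ?T']
      by (simp add: \<psi>_def compose_assoc T'T)
    have psi_right: "((\<lambda>F. \<psi> a o\<^sub>L sum q F) \<longlongrightarrow> \<psi> a) L.fin"
      using tendsto_compose_right[OF tendsto_compose_left[OF lim_right[OF a], of T], of ?T']
      by (simp add: \<psi>_def compose_assoc T(2))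
    \<comment> \<open>The two limits are taken one after the other, which leaves finite sums of
      corners.\<close>
    have row: "q i o\<^sub>L \<psi> a \<in> B" if i: "i \<in> \<Gamma>" for i
    proof (rule tendsto_in_closed[OF tendsto_compose_right[OF psi_right] finite_subsets_at_top_neq_bot R.A(2)])
      show "\<forall>\<^sub>F F in L.fin. q i o\<^sub>L (\<psi> a o\<^sub>L sum q F) \<in> B"
        using L.eventually_fin
        by eventually_elim (auto simp: compose_sum intro!: subalgebra_sum R.A(1) corner i)
    qed
    show ?thesis
    proof (rule tendsto_in_closed[OF psi_left finite_subsets_at_top_neq_bot R.A(2)])
      show "\<forall>\<^sub>F F in L.fin. sum q F o\<^sub>L \<psi> a \<in> B"
        using L.eventually_fin
        by eventually_elim (auto simp: sum_compose intro!: subalgebra_sum R.A(1) row)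
    qed
  qed
  have psi_surj: "\<exists>a\<in>A. \<psi> a = b" if b: "b \<in> B" for b
  proof -
    let ?X = "T o\<^sub>L (b o\<^sub>L ?T')"
    \<comment> \<open>Conversely, this conjugate is the elementary tensor of a corner of
      \<open>b\<close> with a rank-one operator from \<open>f j\<close> to \<open>f i\<close>, which
      \<open>K'\<close> contains.\<close>
    have corner: "T o\<^sub>L ((q i o\<^sub>L (b o\<^sub>L q j)) o\<^sub>L ?T') \<in> R.N" if ij: "i \<in> \<Gamma>" "j \<in> \<Gamma>" for i j
    proof -
      have c: "clin (q i o\<^sub>L (b o\<^sub>L q j))" by (simp add: clin_compose R.clin_p ij R.clin_A b)
      have "T o\<^sub>L ((q i o\<^sub>L (b o\<^sub>L q j)) o\<^sub>L ?T') = R.tensR (f i) o\<^sub>L ((q i o\<^sub>L (b o\<^sub>L q j)) o\<^sub>L hadj (R.tensR (f j)))"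
        using T(3)[OF ij(1)] q_T'[OF ij(2)] by (metis compose_assoc)
      also have "\<dots> = op_tensor t' (q i o\<^sub>L (b o\<^sub>L q j)) (rank1 (f i) (f j))"
      proof (rule R.blinfun_ext)
        fix x y
        have "hadj (R.tensR (f j)) (t' x y) = cinner y (f j) *\<^sub>C x"
          by (rule cinner_eqI) (simp add: cinner_hadj' R.clin_tensR R.cinner_t cinner_simps)
        then show "(R.tensR (f i) o\<^sub>L ((q i o\<^sub>L (b o\<^sub>L q j)) o\<^sub>L hadj (R.tensR (f j)))) (t' x y)
          = op_tensor t' (q i o\<^sub>L (b o\<^sub>L q j)) (rank1 (f i) (f j)) (t' x y)"
          using clinD[OF c, of "cinner y (f j)" x]
          by (simp add: R.op_tensor_apply c clin_rank1 rank1_apply R.t_scaleC_left R.t_scaleC_right)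
      qed
      also have "\<dots> \<in> R.N" by (intro R.op_tensor_in_N subalgebra_mult R.A(1) R.p_in ij b R.rank1_in)
      finally show ?thesis .
    qed
    have row: "T o\<^sub>L ((q i o\<^sub>L b) o\<^sub>L ?T') \<in> R.N" if i: "i \<in> \<Gamma>" for i
    proof (rule tendsto_in_closed[OF _ finite_subsets_at_top_neq_bot[of \<Gamma>] R.closed_N])
      show "((\<lambda>F. T o\<^sub>L ((q i o\<^sub>L (b o\<^sub>L sum q F)) o\<^sub>L ?T')) \<longlongrightarrow> T o\<^sub>L ((q i o\<^sub>L b) o\<^sub>L ?T')) L.fin"
        by (intro tendsto_compose_left tendsto_compose_right R.p_approx_right b)
      show "\<forall>\<^sub>F F in L.fin. T o\<^sub>L ((q i o\<^sub>L (b o\<^sub>L sum q F)) o\<^sub>L ?T') \<in> R.N"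
        using L.eventually_fin
        by eventually_elim (auto simp: compose_sum sum_compose intro!: subalgebra_sum R.subalgebra_N corner i)
    qed
    have X: "?X \<in> R.N"
    proof (rule tendsto_in_closed[OF _ finite_subsets_at_top_neq_bot[of \<Gamma>] R.closed_N])
      show "((\<lambda>F. T o\<^sub>L ((sum q F o\<^sub>L b) o\<^sub>L ?T')) \<longlongrightarrow> ?X) L.fin"
        by (intro tendsto_compose_left tendsto_compose_right R.p_approx_left b)
      show "\<forall>\<^sub>F F in L.fin. T o\<^sub>L ((sum q F o\<^sub>L b) o\<^sub>L ?T') \<in> R.N"
        using L.eventually_fin
        by eventually_elim (auto simp: compose_sum sum_compose intro!: subalgebra_sum R.subalgebra_N row)
    qed
    obtain Y where Y: "Y \<in> L.N" "\<phi> Y = ?X" using phi_surj[OF X] by blast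
    have "((\<lambda>F. T o\<^sub>L (sum q F o\<^sub>L (?T' o\<^sub>L ?X))) \<longlongrightarrow> ?X) L.fin"
      using tendsto_compose_right[OF tendsto_compose_left[OF R.p_approx_left[OF b], of ?T'], of T]
      by (simp add: T'T compose_assoc)
    then have Y_left: "((\<lambda>F. op_tensor t (sum p F) ?th o\<^sub>L Y) \<longlongrightarrow> Y) L.fin"
      using at_left[OF Y(1)] Y(2) by simp
    have "((\<lambda>F. ?X o\<^sub>L (T o\<^sub>L (sum q F o\<^sub>L ?T'))) \<longlongrightarrow> ?X) L.fin"
      using tendsto_compose_right[OF tendsto_compose_left[OF R.p_approx_right[OF b], of ?T'], of T]
      by (simp add: T'T compose_assoc)
    then have Y_right: "((\<lambda>F. Y o\<^sub>L op_tensor t (sum p F) ?th) \<longlongrightarrow> Y) L.fin"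
      using at_right[OF Y(1)] Y(2) by simp
    \<comment> \<open>\<open>?r\<close> may lie outside \<open>N\<close>, yet it fixes the
      approximating products and hence \<open>Y\<close>. Rank-one compression then exhibits
      \<open>Y\<close> as an elementary tensor with second factor \<open>?th\<close>.\<close>
    let ?r = "op_tensor t id_blinfun ?th"
    have rY: "?r o\<^sub>L Y = Y"
    proof (rule tendsto_unique[OF finite_subsets_at_top_neq_bot[of \<Gamma>] _ Y_left])
      have "((\<lambda>F. ?r o\<^sub>L (op_tensor t (sum p F) ?th o\<^sub>L Y)) \<longlongrightarrow> ?r o\<^sub>L Y) L.fin"
        by (rule tendsto_compose_right[OF Y_left])
      moreover have "\<forall>\<^sub>F F in L.fin. ?r o\<^sub>L (op_tensor t (sum p F) ?th o\<^sub>L Y) = op_tensor t (sum p F) ?th o\<^sub>L Y"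
        using L.eventually_fin
        by eventually_elim (simp add: L.op_tensor_compose L.clin_sum_p th thth clin_id flip: compose_assoc)
      ultimately show "((\<lambda>F. op_tensor t (sum p F) ?th o\<^sub>L Y) \<longlongrightarrow> ?r o\<^sub>L Y) L.fin"
        by (rule Lim_transform_eventually)
    qed
    have Yr: "Y o\<^sub>L ?r = Y"
    proof (rule tendsto_unique[OF finite_subsets_at_top_neq_bot[of \<Gamma>] _ Y_right])
      have "((\<lambda>F. (Y o\<^sub>L op_tensor t (sum p F) ?th) o\<^sub>L ?r) \<longlongrightarrow> Y o\<^sub>L ?r) L.fin"
        by (rule tendsto_compose_left[OF Y_right])
      moreover have "\<forall>\<^sub>F F in L.fin. (Y o\<^sub>L op_tensor t (sum p F) ?th) o\<^sub>L ?r = Y o\<^sub>L op_tensor t (sum p F) ?th"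
        using L.eventually_fin
        by eventually_elim (simp add: L.op_tensor_compose L.clin_sum_p th thth clin_id compose_assoc)
      ultimately show "((\<lambda>F. Y o\<^sub>L op_tensor t (sum p F) ?th) \<longlongrightarrow> Y o\<^sub>L ?r) L.fin"
        by (rule Lim_transform_eventually)
    qed
    let ?a = "L.sliceL \<xi>0 \<xi>0 Y"
    have "op_tensor t ?a ?th = ?r o\<^sub>L (Y o\<^sub>L ?r)" by (rule L.rank1_compress[OF L.clin_N[OF Y(1)], symmetric])
    also have "\<dots> = Y" by (simp add: Yr rY)
    finally have "\<psi> ?a = ?T' o\<^sub>L (?X o\<^sub>L T)" by (simp add: \<psi>_def Y(2))
    also have "\<dots> = b" by (simp add: compose_assoc T'T T(2))
    finally show ?thesis using L.sliceL_N[OF Y(1)] by blast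
  qed
  have inj: "inj_on \<psi> A"
  proof (rule inj_onI)
    fix a b assume ab: "a \<in> A" "b \<in> A" "\<psi> a = \<psi> b"
    have "\<psi> (a - b) + \<psi> b = \<psi> a" using psi_add[of "a - b" b] ab by (simp add: subalgebra_diff L.A)
    then have "norm (a - b) = 0" using psi_norm[of "a - b"] ab by (simp add: subalgebra_diff L.A)
    then show "a = b" by simp
  qed
  have bij: "bij_betw \<psi> A B"
    unfolding bij_betw_def using inj psi_in psi_surj by (auto simp: image_iff)
  have "norm (inv_into A \<psi> b) = norm b" if "b \<in> B" for b
    using psi_norm[of "inv_into A \<psi> b"] bij_betw_inv_into_right[OF bij that]
      bij_betwE[OF bij_betw_inv_into[OF bij]] that by auto
  then show ?thesis
    unfolding bicontinuously_isomorphic_def algebra_isomorphism_def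
    using bij psi_add psi_scaleC psi_mult psi_norm by (intro exI[of _ \<psi>]) (auto intro!: exI[of _ 1])
qed

section \<open>Diagonals isomorphic to \<open>c\<^sub>0(\<Gamma>)\<close>\<close>

text \<open>\<open>\<Phi>\<close> is only algebraic and carries no information on norms;
  \<open>norm_diag_le\<close> recovers it from positivity.\<close>

locale c0_diagonal =
  fixes A :: "('a::chilbert_space \<Rightarrow>\<^sub>L 'a) set" and \<Gamma> :: "'i set" and \<Phi> :: "('a \<Rightarrow>\<^sub>L 'a) \<Rightarrow> 'i \<Rightarrow> complex"
  assumes operator_algebra: "operator_algebra A"
    and bij: "bij_betw \<Phi> (diag A) (c0 \<Gamma>)"
    and \<Phi>_add: "a \<in> diag A \<Longrightarrow> b \<in> diag A \<Longrightarrow> \<Phi> (a + b) = (\<lambda>i. \<Phi> a i + \<Phi> b i)"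
    and \<Phi>_scaleC: "a \<in> diag A \<Longrightarrow> \<Phi> (c *\<^sub>C a) = (\<lambda>i. c * \<Phi> a i)"
    and \<Phi>_mult: "a \<in> diag A \<Longrightarrow> b \<in> diag A \<Longrightarrow> \<Phi> (a o\<^sub>L b) = (\<lambda>i. \<Phi> a i * \<Phi> b i)"
    and \<Phi>_adj: "a \<in> diag A \<Longrightarrow> \<Phi> (adj a) = (\<lambda>i. cnj (\<Phi> a i))"
begin

lemma A: "subalgebra A" "closed A" "A \<subseteq> \<B>"
  using operator_algebra by (auto simp: operator_algebra_def subalgebra_def)

lemma diagI: "d \<in> A \<Longrightarrow> hadj d \<in> A \<Longrightarrow> d \<in> diag A" and diagD: "d \<in> diag A \<Longrightarrow> d \<in> A"
  and hadj_diag: "d \<in> diag A \<Longrightarrow> hadj d \<in> diag A"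
  using A by (auto simp: mem_diag_iff hadj_hadj subalgebra_clin)

lemma clin_diag: "d \<in> diag A \<Longrightarrow> clin d"
  using diagD subalgebra_clin A by blast

lemma diag_zero: "0 \<in> diag A"
  by (intro diagI) (simp_all add: subalgebra_zero A)

lemma diag_add: "d \<in> diag A \<Longrightarrow> e \<in> diag A \<Longrightarrow> d + e \<in> diag A"
  by (rule diagI) (simp_all add: hadj_add clin_diag subalgebra_add A diagD hadj_diag)

lemma diag_scaleC: "d \<in> diag A \<Longrightarrow> c *\<^sub>C d \<in> diag A"
  by (rule diagI) (simp_all add: hadj_scaleC clin_diag subalgebra_scaleC A diagD hadj_diag)

lemma diag_mult: "d \<in> diag A \<Longrightarrow> e \<in> diag A \<Longrightarrow> d o\<^sub>L e \<in> diag A"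
  by (rule diagI) (simp_all add: hadj_compose clin_diag subalgebra_mult A diagD hadj_diag)

lemma diag_diff: "d \<in> diag A \<Longrightarrow> e \<in> diag A \<Longrightarrow> d - e \<in> diag A"
  using diag_add[of d "(-1) *\<^sub>C e"] diag_scaleC[of e "-1"] by (simp add: scaleC_minus_one)

lemma diag_sum: "(\<And>i. i \<in> I \<Longrightarrow> f i \<in> diag A) \<Longrightarrow> sum f I \<in> diag A"
  by (induction I rule: infinite_finite_induct) (simp_all add: diag_zero diag_add)

lemma \<Phi>_hadj: "d \<in> diag A \<Longrightarrow> \<Phi> (hadj d) = (\<lambda>i. cnj (\<Phi> d i))"
  using \<Phi>_adj[of d] adj_eq_hadj[of d] A(3) diagD by fastforce

lemma \<Phi>_zero: "\<Phi> 0 = (\<lambda>i. 0)"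
  using \<Phi>_scaleC[OF diag_zero, of 0] by simp

lemma \<Phi>_diff: "d \<in> diag A \<Longrightarrow> e \<in> diag A \<Longrightarrow> \<Phi> (d - e) = (\<lambda>i. \<Phi> d i - \<Phi> e i)"
  using \<Phi>_add[of "d - e" e] by (auto simp: diag_diff fun_eq_iff)

lemma \<Phi>_sum: "(\<And>i. i \<in> I \<Longrightarrow> f i \<in> diag A) \<Longrightarrow> \<Phi> (sum f I) = (\<lambda>j. \<Sum>i\<in>I. \<Phi> (f i) j)"
  by (induction I rule: infinite_finite_induct) (simp_all add: \<Phi>_zero \<Phi>_add diag_sum)

lemma \<Phi>_in: "d \<in> diag A \<Longrightarrow> \<Phi> d \<in> c0 \<Gamma>"
  using bij by (meson bij_betwE)

lemma \<Phi>_eqD: "d \<in> diag A \<Longrightarrow> e \<in> diag A \<Longrightarrow> \<Phi> d = \<Phi> e \<Longrightarrow> d = e"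
  using bij by (meson bij_betw_imp_inj_on inj_onD)

lemma \<Phi>_surj: "g \<in> c0 \<Gamma> \<Longrightarrow> \<exists>d\<in>diag A. \<Phi> d = g"
  using bij_betw_imp_surj_on[OF bij, symmetric] by auto

text \<open>With \<open>k = d\<^sup>*d\<close> and \<open>\<bar>\<Phi> d\<bar> \<le> \<epsilon>\<close>, the function
  \<open>g = \<epsilon> - sqrt (\<epsilon>\<^sup>2 - \<bar>\<Phi> d\<bar>\<^sup>2)\<close> lies in \<open>c\<^sub>0(\<Gamma>)\<close>, unlike the square
  root itself, and \<open>2\<epsilon>g - g\<^sup>2 = \<bar>\<Phi> d\<bar>\<^sup>2\<close>. Hence \<open>\<epsilon>\<^sup>2 - k = (\<epsilon> - G)\<^sup>2 \<ge> 0\<close>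
  for the element \<open>G\<close> corresponding to \<open>g\<close>.\<close>

lemma norm_diag_le:
  assumes d: "d \<in> diag A" and \<epsilon>: "0 < \<epsilon>" and le: "\<And>i. cmod (\<Phi> d i) \<le> \<epsilon>"
  shows "norm d \<le> \<epsilon>"
proof -
  define s where "s i = sqrt (\<epsilon>\<^sup>2 - (cmod (\<Phi> d i))\<^sup>2)" for i
  define g where "g i = complex_of_real (\<epsilon> - s i)" for i
  have le2: "(cmod (\<Phi> d i))\<^sup>2 \<le> \<epsilon>\<^sup>2" for i using le by (simp add: power_mono)
  have s2: "(s i)\<^sup>2 = \<epsilon>\<^sup>2 - (cmod (\<Phi> d i))\<^sup>2" for i using le2[of i] by (simp add: s_def)
  have s0: "0 \<le> s i" for i using le2[of i] by (simp add: s_def)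
  have s\<epsilon>: "s i \<le> \<epsilon>" for i
    by (rule power2_le_imp_le) (use s2[of i] \<epsilon> in auto)
  have "g \<in> c0 \<Gamma>"
    unfolding c0_def
  proof (intro CollectI conjI allI impI)
    show "g i = 0" if "i \<notin> \<Gamma>" for i
    proof -
      have "\<Phi> d i = 0" using \<Phi>_in[OF d] that by (simp add: c0_def)
      then show ?thesis using \<epsilon> by (simp add: g_def s_def)
    qed
    fix r :: real assume r: "0 < r"
    \<comment> \<open>The threshold comes from \<open>(\<epsilon> - s i) * \<epsilon> \<le>
      \<epsilon>\<^sup>2 - (s i)\<^sup>2\<close>, which holds since
      \<open>0 \<le> s i \<le> \<epsilon>\<close>; so \<open>r \<le> cmod (g i)\<close> forces
      \<open>r * \<epsilon> \<le> (cmod (\<Phi> d i))\<^sup>2\<close>.\<close>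
    have "finite {i \<in> \<Gamma>. sqrt (r * \<epsilon>) \<le> cmod (\<Phi> d i)}"
      using \<Phi>_in[OF d] r \<epsilon> by (simp add: c0_def)
    moreover have "sqrt (r * \<epsilon>) \<le> cmod (\<Phi> d i)" if "r \<le> cmod (g i)" for i
    proof -
      have "r \<le> \<epsilon> - s i" using that s\<epsilon>[of i] by (simp only: g_def norm_of_real)
      then have "r * \<epsilon> \<le> (\<epsilon> - s i) * \<epsilon>" using \<epsilon> by (simp add: mult_right_mono)
      also have "\<dots> \<le> (cmod (\<Phi> d i))\<^sup>2"
        using s2[of i] mult_left_mono[OF s\<epsilon>[of i] s0[of i]] by (simp add: power2_eq_square algebra_simps)
      finally show ?thesis by (simp add: real_le_lsqrt real_sqrt_le_iff' sqrt_le_D)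
    qed
    ultimately show "finite {i \<in> \<Gamma>. r \<le> cmod (g i)}"
      by (elim finite_subset[rotated]) auto
  qed
  then obtain G where G: "G \<in> diag A" "\<Phi> G = g" using \<Phi>_surj by blast
  have GG: "hadj G = G"
    using G(1) by (intro \<Phi>_eqD hadj_diag) (simp_all add: \<Phi>_hadj, simp add: G(2) g_def fun_eq_iff)
  have k: "(hadj d o\<^sub>L d) + (G o\<^sub>L G) = complex_of_real (2 * \<epsilon>) *\<^sub>C G"
  proof (rule \<Phi>_eqD)
    have "cnj (\<Phi> d i) * \<Phi> d i + g i * g i = complex_of_real (2 * \<epsilon>) * g i" for i
    proof -
      have "cnj (\<Phi> d i) * \<Phi> d i = complex_of_real (\<epsilon>\<^sup>2 - (s i)\<^sup>2)"
        using complex_norm_square[of "\<Phi> d i"] by (simp add: s2 mult.commute)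
      then show ?thesis
        by (simp add: g_def power2_eq_square algebra_simps flip: of_real_mult of_real_add of_real_diff)
    qed
    then show "\<Phi> ((hadj d o\<^sub>L d) + (G o\<^sub>L G)) = \<Phi> (complex_of_real (2 * \<epsilon>) *\<^sub>C G)"
      using d G by (simp add: \<Phi>_add \<Phi>_mult \<Phi>_hadj \<Phi>_scaleC diag_mult hadj_diag)
  qed (use d G in \<open>auto intro: diag_add diag_mult hadj_diag diag_scaleC\<close>)
  show ?thesis
  proof (rule norm_blinfun_bound)
    fix x
    have "inner x (((hadj d o\<^sub>L d) + (G o\<^sub>L G)) x) = inner x ((complex_of_real (2 * \<epsilon>) *\<^sub>C G) x)"
      by (simp only: k)
    then have "(norm (d x))\<^sup>2 + (norm (G x))\<^sup>2 = 2 * \<epsilon> * inner x (G x)"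
      using inner_hadj[of G x "G x"] GG
      by (simp add: blinfun.add_left blinfun.scaleR_left scaleC_of_real inner_add_right inner_hadj[symmetric]
        power2_norm_eq_inner flip: of_real_mult)
    moreover have "(norm (\<epsilon> *\<^sub>R x - G x))\<^sup>2 = \<epsilon>\<^sup>2 * (norm x)\<^sup>2 - 2 * \<epsilon> * inner x (G x) + (norm (G x))\<^sup>2"
      unfolding power2_norm_eq_inner by (simp add: inner_simps inner_commute power2_eq_square algebra_simps)
    ultimately have "(norm (d x))\<^sup>2 \<le> (\<epsilon> * norm x)\<^sup>2"
      using zero_le_power2[of "norm (\<epsilon> *\<^sub>R x - G x)"] by (simp add: power_mult_distrib)
    then show "norm (d x) \<le> \<epsilon> * norm x" by (rule power2_le_imp_le) (use \<epsilon> in simp)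
  qed (use \<epsilon> in simp)
qed

definition p :: "'i \<Rightarrow> ('a \<Rightarrow>\<^sub>L 'a)"
  where "p i = inv_into (diag A) \<Phi> (\<lambda>j. if j = i then 1 else 0)"

lemma p_diag: "i \<in> \<Gamma> \<Longrightarrow> p i \<in> diag A" and \<Phi>_p: "i \<in> \<Gamma> \<Longrightarrow> \<Phi> (p i) = (\<lambda>j. if j = i then 1 else 0)"
proof -
  assume i: "i \<in> \<Gamma>"
  let ?\<delta> = "\<lambda>j. if j = i then 1 else 0 :: complex"
  have "{j \<in> \<Gamma>. \<epsilon> \<le> cmod (?\<delta> j)} \<subseteq> {i}" if "0 < \<epsilon>" for \<epsilon> using that by auto
  then have "?\<delta> \<in> c0 \<Gamma>" unfolding c0_def using i by (auto intro: finite_subset)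
  then show "p i \<in> diag A" "\<Phi> (p i) = ?\<delta>"
    unfolding p_def using bij_betwE[OF bij_betw_inv_into[OF bij]] bij_betw_inv_into_right[OF bij] by simp_all
qed

lemma sum_p_diag: "F \<subseteq> \<Gamma> \<Longrightarrow> sum p F \<in> diag A"
  by (rule diag_sum) (use p_diag in auto)

lemma \<Phi>_sum_p:
  assumes "finite F" "F \<subseteq> \<Gamma>" shows "\<Phi> (sum p F) = (\<lambda>j. if j \<in> F then 1 else 0)"
proof -
  have "\<Phi> (sum p F) = (\<lambda>j. \<Sum>i\<in>F. \<Phi> (p i) j)" by (rule \<Phi>_sum) (use p_diag assms in auto)
  also have "\<dots> = (\<lambda>j. \<Sum>i\<in>F. if j = i then 1 else 0)"
    by (intro ext sum.cong) (use \<Phi>_p assms in auto)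
  finally show ?thesis using assms by (simp add: sum.delta)
qed

lemma norm_sum_p_le: "finite F \<Longrightarrow> F \<subseteq> \<Gamma> \<Longrightarrow> norm (sum p F) \<le> 1"
  by (rule norm_diag_le) (auto simp: sum_p_diag \<Phi>_sum_p)

text \<open>The function of the remainder vanishes on \<open>F\<close> and is small elsewhere once
  \<open>F\<close> contains the finitely many large values; \<open>norm_diag_le\<close> turns this
  into an operator norm estimate.\<close>

lemma diag_approx:
  assumes d: "d \<in> diag A"
  shows "((\<lambda>F. sum p F o\<^sub>L d) \<longlongrightarrow> d) (finite_subsets_at_top \<Gamma>)"
    and "((\<lambda>F. d o\<^sub>L sum p F) \<longlongrightarrow> d) (finite_subsets_at_top \<Gamma>)"
proof -
  have comm: "d o\<^sub>L sum p F = sum p F o\<^sub>L d" if "F \<subseteq> \<Gamma>" for F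
    using d sum_p_diag[OF that] by (intro \<Phi>_eqD) (simp_all add: \<Phi>_mult diag_mult mult.commute)
  have ev: "\<forall>\<^sub>F F in finite_subsets_at_top \<Gamma>. norm ((sum p F o\<^sub>L d) - d) < e" if e: "0 < e" for e
  proof -
    \<comment> \<open>Half of \<open>e\<close>, because \<open>norm_diag_le\<close> gives only a
      weak inequality.\<close>
    have fin: "finite {i \<in> \<Gamma>. e / 2 \<le> cmod (\<Phi> d i)}" using \<Phi>_in[OF d] half_gt_zero[OF e] unfolding c0_def by blast
    have "norm ((sum p F o\<^sub>L d) - d) \<le> e / 2"
      if F: "finite F" "F \<subseteq> \<Gamma>" "{i \<in> \<Gamma>. e / 2 \<le> cmod (\<Phi> d i)} \<subseteq> F" for F
    proof (rule norm_diag_le)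
      show "(sum p F o\<^sub>L d) - d \<in> diag A" by (intro diag_diff diag_mult sum_p_diag F d)
      have out: "\<Phi> d i = 0" if "i \<notin> \<Gamma>" for i using \<Phi>_in[OF d] that by (simp add: c0_def)
      show "cmod (\<Phi> ((sum p F o\<^sub>L d) - d) i) \<le> e / 2" for i
        using F e out[of i] d by (cases "i \<in> \<Gamma>") (auto simp: \<Phi>_diff \<Phi>_mult \<Phi>_sum_p diag_mult sum_p_diag not_le)
    qed (use e in simp)
    then show ?thesis
      unfolding eventually_finite_subsets_at_top using fin e
      by (intro exI[of _ "{i \<in> \<Gamma>. e / 2 \<le> cmod (\<Phi> d i)}"]) (smt (verit, best) field_sum_of_halves mem_Collect_eq subsetI)
  qed
  show lim: "((\<lambda>F. sum p F o\<^sub>L d) \<longlongrightarrow> d) (finite_subsets_at_top \<Gamma>)"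
    by (rule tendstoI) (simp add: dist_norm ev)
  show "((\<lambda>F. d o\<^sub>L sum p F) \<longlongrightarrow> d) (finite_subsets_at_top \<Gamma>)"
    by (rule Lim_transform_eventually[OF lim], rule eventually_finite_subsets_at_top_weakI) (simp add: comm)
qed

text \<open>The contractive approximate unit from the diagonal writes \<open>a\<close> as a limit of
  \<open>e o\<^sub>L a\<close> with \<open>e\<close> in the diagonal, where convergence is known.
  Contractivity of the sums makes the set of good operators closed.\<close>

lemma approx:
  assumes a: "a \<in> A"
  shows "((\<lambda>F. sum p F o\<^sub>L a) \<longlongrightarrow> a) (finite_subsets_at_top \<Gamma>)"
    and "((\<lambda>F. a o\<^sub>L sum p F) \<longlongrightarrow> a) (finite_subsets_at_top \<Gamma>)"
proof -
  obtain U where U: "U \<noteq> bot" "\<forall>\<^sub>F e in U. e \<in> diag A \<and> norm e \<le> 1"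
    "\<And>a. a \<in> A \<Longrightarrow> ((\<lambda>e. e o\<^sub>L a) \<longlongrightarrow> a) U \<and> ((\<lambda>e. a o\<^sub>L e) \<longlongrightarrow> a) U"
    using operator_algebra unfolding operator_algebra_def has_contractive_approx_unit_in_def by blast
  have contr_left: "\<forall>\<^sub>F F in finite_subsets_at_top \<Gamma>. \<forall>X::'a \<Rightarrow>\<^sub>L 'a. norm (sum p F o\<^sub>L X) \<le> norm X"
  proof (rule eventually_finite_subsets_at_top_weakI, intro allI)
    fix F and X :: "'a \<Rightarrow>\<^sub>L 'a" assume "finite F" "F \<subseteq> \<Gamma>"
    then have "norm (sum p F) * norm X \<le> 1 * norm X" by (intro mult_right_mono norm_sum_p_le) auto
    then show "norm (sum p F o\<^sub>L X) \<le> norm X" using norm_blinfun_compose[of "sum p F" X] by simp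
  qed
  have contr_right: "\<forall>\<^sub>F F in finite_subsets_at_top \<Gamma>. \<forall>X::'a \<Rightarrow>\<^sub>L 'a. norm (X o\<^sub>L sum p F) \<le> norm X"
  proof (rule eventually_finite_subsets_at_top_weakI, intro allI)
    fix F and X :: "'a \<Rightarrow>\<^sub>L 'a" assume "finite F" "F \<subseteq> \<Gamma>"
    then have "norm X * norm (sum p F) \<le> norm X * 1" by (intro mult_left_mono norm_sum_p_le) auto
    then show "norm (X o\<^sub>L sum p F) \<le> norm X" using norm_blinfun_compose[of X "sum p F"] by simp
  qed
  have "closed {X::'a \<Rightarrow>\<^sub>L 'a. ((\<lambda>F. sum p F o\<^sub>L X) \<longlongrightarrow> X) (finite_subsets_at_top \<Gamma>)}"
    by (rule closed_subspace_tendsto_contractions[OF finite_subsets_at_top_neq_bot bounded_linear_compose_right contr_left])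
  moreover have "\<forall>\<^sub>F e in U. e o\<^sub>L a \<in> {X. ((\<lambda>F. sum p F o\<^sub>L X) \<longlongrightarrow> X) (finite_subsets_at_top \<Gamma>)}"
    using U(2)
  proof eventually_elim
    case (elim e)
    then show ?case using tendsto_compose_left[OF diag_approx(1), of e a] by (simp add: compose_assoc)
  qed
  ultimately have "a \<in> {X. ((\<lambda>F. sum p F o\<^sub>L X) \<longlongrightarrow> X) (finite_subsets_at_top \<Gamma>)}"
    using U(1) U(3)[OF a] by (intro Lim_in_closed_set) auto
  then show "((\<lambda>F. sum p F o\<^sub>L a) \<longlongrightarrow> a) (finite_subsets_at_top \<Gamma>)" by simp
  have "closed {X::'a \<Rightarrow>\<^sub>L 'a. ((\<lambda>F. X o\<^sub>L sum p F) \<longlongrightarrow> X) (finite_subsets_at_top \<Gamma>)}"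
    by (rule closed_subspace_tendsto_contractions[OF finite_subsets_at_top_neq_bot bounded_linear_compose_left contr_right])
  moreover have "\<forall>\<^sub>F e in U. a o\<^sub>L e \<in> {X. ((\<lambda>F. X o\<^sub>L sum p F) \<longlongrightarrow> X) (finite_subsets_at_top \<Gamma>)}"
    using U(2)
  proof eventually_elim
    case (elim e)
    then show ?case using tendsto_compose_right[OF diag_approx(2), of e a] by (simp add: compose_assoc)
  qed
  ultimately have "a \<in> {X. ((\<lambda>F. X o\<^sub>L sum p F) \<longlongrightarrow> X) (finite_subsets_at_top \<Gamma>)}"
    using U(1) U(3)[OF a] by (intro Lim_in_closed_set) auto
  then show "((\<lambda>F. a o\<^sub>L sum p F) \<longlongrightarrow> a) (finite_subsets_at_top \<Gamma>)" by simp
qed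

text \<open>Norm convergence on \<open>A\<close> gives convergence at all vectors
  \<open>a x\<close>, and these are total by nondegeneracy.\<close>

lemma strong: "((\<lambda>F. sum p F x) \<longlongrightarrow> x) (finite_subsets_at_top \<Gamma>)"
proof -
  let ?S = "{x. ((\<lambda>F. sum p F x) \<longlongrightarrow> x) (finite_subsets_at_top \<Gamma>)}"
  let ?E = "{blinfun_apply a x |a x. a \<in> A}"
  have "\<forall>\<^sub>F F in finite_subsets_at_top \<Gamma>. \<forall>x::'a. norm (sum p F x) \<le> norm x"
  proof (rule eventually_finite_subsets_at_top_weakI, intro allI)
    fix F and x :: 'a assume "finite F" "F \<subseteq> \<Gamma>"
    then have "norm (sum p F) * norm x \<le> 1 * norm x" by (intro mult_right_mono norm_sum_p_le) auto
    then show "norm (sum p F x) \<le> norm x" using norm_blinfun[of "sum p F" x] by simp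
  qed
  note S = closed_subspace_tendsto_contractions[OF finite_subsets_at_top_neq_bot blinfun.bounded_linear_right this]
  have "?E \<subseteq> ?S"
  proof
    fix y assume "y \<in> ?E"
    then obtain a x where y: "y = blinfun_apply a x" "a \<in> A" by blast
    show "y \<in> ?S" using blinfun.tendsto[OF approx(1)[OF y(2)] tendsto_const[of x]] by (simp add: y)
  qed
  moreover have "cspan ?E = span ?E"
  proof (rule cspan_eq_span)
    fix c y assume "y \<in> ?E"
    then obtain a x where y: "y = blinfun_apply a x" "a \<in> A" by blast
    then have "c *\<^sub>C y = blinfun_apply (c *\<^sub>C a) x" "c *\<^sub>C a \<in> A"
      by (simp_all add: scaleC_blinfun.rep_eq subalgebra_scaleC A)
    then show "c *\<^sub>C y \<in> ?E" by blast
  qed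
  ultimately have "closure (cspan ?E) \<subseteq> ?S" using S by (simp add: closure_minimal span_minimal)
  then show ?thesis using operator_algebra unfolding operator_algebra_def nondegenerate_def by blast
qed

lemma tensor_frame:
  assumes t: "hilbert_tensor t" and K: "operator_algebra K" "contains_compacts K"
  shows "tensor_frame t A K \<Gamma> p"
proof unfold_locales
  show "hilbert_tensor t" by (rule t)
  show "subalgebra A" "closed A" by (rule A)+
  show "subalgebra K" "closed K" using K(1) by (simp_all add: operator_algebra_def)
  show "rank1 \<xi> \<eta> \<in> K" for \<xi> \<eta> using K(2) rank1_compact by (auto simp: contains_compacts_def)
  show "p i \<in> A" if "i \<in> \<Gamma>" for i using p_diag[OF that] by (rule diagD)
  show "hadj (p i) = p i" if "i \<in> \<Gamma>" for i
    using p_diag[OF that] by (intro \<Phi>_eqD hadj_diag) (auto simp: \<Phi>_hadj \<Phi>_p that)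
  show "p i o\<^sub>L p j = (if i = j then p i else 0)" if "i \<in> \<Gamma>" "j \<in> \<Gamma>" for i j
    using p_diag that by (intro \<Phi>_eqD) (auto simp: \<Phi>_mult \<Phi>_p \<Phi>_zero diag_mult diag_zero)
  show "p i \<noteq> 0" if "i \<in> \<Gamma>" for i using \<Phi>_p[OF that] \<Phi>_zero by (metis zero_neq_one)
  \<comment> \<open>The scalar is the value at \<open>i\<close> of the function that represents
    \<open>d\<close>.\<close>
  show "\<exists>c. p i o\<^sub>L d = c *\<^sub>C p i \<and> d o\<^sub>L p i = c *\<^sub>C p i" if d: "d \<in> diag A" and i: "i \<in> \<Gamma>" for d i
    using p_diag[OF i] d
    by (intro exI[of _ "\<Phi> d i"] conjI \<Phi>_eqD) (auto simp: \<Phi>_mult \<Phi>_p i \<Phi>_scaleC diag_mult diag_scaleC)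
qed (simp_all add: approx strong)

text \<open>Without indices every finite sum is 0, and these sums form an approximate unit.\<close>

lemma index_set_nonempty: assumes "A \<noteq> {0}" shows "\<Gamma> \<noteq> {}"
proof
  assume "\<Gamma> = {}"
  have "a = 0" if "a \<in> A" for a
  proof (rule tendsto_unique[OF finite_subsets_at_top_neq_bot approx(1)[OF that]])
    show "((\<lambda>F. sum p F o\<^sub>L a) \<longlongrightarrow> 0) (finite_subsets_at_top \<Gamma>)"
      by (rule tendsto_eventually, rule eventually_finite_subsets_at_top_weakI) (simp add: \<open>\<Gamma> = {}\<close>)
  qed
  then have "A = {0}" using subalgebra_zero[OF A(1)] by blast
  with assms show False by blast
qed

end

section \<open>Assembling the result\<close>

lemma c0_diagonal_exists:
  assumes "operator_algebra A" "c0_isomorphic_diagonal TYPE('i) A"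
  obtains \<Gamma> :: "'i set" and \<Phi> where "c0_diagonal A \<Gamma> \<Phi>"
  using assms unfolding c0_isomorphic_diagonal_def c0_diagonal_def by blast

lemma infinite_dimensional_unit_vector:
  assumes "infinite_dimensional TYPE('h::chilbert_space)" obtains \<xi> :: "'h::chilbert_space" where "norm \<xi> = 1"
proof -
  have "cspan {} \<noteq> (UNIV :: 'h set)" using assms unfolding infinite_dimensional_def by blast
  moreover have "(0::'h) \<in> cspan {}" using csubspace_cspan by (auto simp: csubspace_def)
  ultimately have "\<not> (\<forall>x::'h. x = 0)" by (metis UNIV_eq_I)
  then obtain x :: 'h where x: "x \<noteq> 0" by blast
  show ?thesis by (rule norm_unit_scale_exists[OF x]) (rule that)
qed

theorem theorem2p12:
  fixes A :: "('a::chilbert_space \<Rightarrow>\<^sub>L 'a) set"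
    and B :: "('b::chilbert_space \<Rightarrow>\<^sub>L 'b) set"
    and KA KB :: "('h::chilbert_space \<Rightarrow>\<^sub>L 'h) set"
    and tA :: "'a \<Rightarrow> 'h \<Rightarrow> 'p::chilbert_space"
    and tB :: "'b \<Rightarrow> 'h \<Rightarrow> 'q::chilbert_space"
  assumes "infinite_dimensional TYPE('h)" "separable_space (euclidean :: 'h topology)"
    and "hilbert_tensor tA" "hilbert_tensor tB"
    and "operator_algebra A" "A \<noteq> {0}" "analytic TYPE('gA::ab_group_add) A"
    and "c0_isomorphic_diagonal TYPE('iA) A" "separable_space (top_of_set (diag A))"
    and "operator_algebra B" "B \<noteq> {0}" "analytic TYPE('gB::ab_group_add) B"
    and "c0_isomorphic_diagonal TYPE('iB) B" "separable_space (top_of_set (diag B))"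
    and "operator_algebra KA" "contains_compacts KA"
    and "operator_algebra KB" "contains_compacts KB"
    and "isometrically_isomorphic (spatial_tensor tA A KA) (spatial_tensor tB B KB)"
  shows "star_isomorphic (diag KA) (diag KB) \<and> bicontinuously_isomorphic A B"
proof
  obtain \<xi> :: 'h where \<xi>: "norm \<xi> = 1" using infinite_dimensional_unit_vector assms(1) by blast
  obtain \<Gamma> :: "'iA set" and \<Phi> where "c0_diagonal A \<Gamma> \<Phi>"
    using c0_diagonal_exists assms(5,8) by blast
  then interpret CA: c0_diagonal A \<Gamma> \<Phi> .
  obtain \<Delta> :: "'iB set" and \<Psi> where "c0_diagonal B \<Delta> \<Psi>"
    using c0_diagonal_exists assms(10,13) by blast
  then interpret CB: c0_diagonal B \<Delta> \<Psi> .
  obtain \<phi> where \<phi>: "isometric_iso \<phi> (spatial_tensor tA A KA) (spatial_tensor tB B KB)"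
    using assms(19) unfolding isometrically_isomorphic_def isometric_iso_def by blast
  interpret frame_iso tA A KA \<Gamma> CA.p tB B KB \<Delta> CB.p \<phi>
    by (intro frame_iso.intro frame_iso_axioms.intro CA.tensor_frame CB.tensor_frame assms \<phi>)
  obtain \<sigma> where "matched_iso tA A KA \<Gamma> CA.p tB B KB (CB.p \<circ> \<sigma>) \<phi>"
    using matched_iso_exists[OF \<xi>] by blast
  then interpret M: matched_iso tA A KA \<Gamma> CA.p tB B KB "CB.p \<circ> \<sigma>" \<phi> .
  \<comment> \<open>A nonzero \<open>A\<close> has a minimal projection, and any one of them
    suffices to compare \<open>KA\<close> with \<open>KB\<close>.\<close>
  obtain i where "i \<in> \<Gamma>" using CA.index_set_nonempty assms(6) by blast
  then show "star_isomorphic (diag KA) (diag KB)" by (rule M.star_isomorphic_diag)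
  show "bicontinuously_isomorphic A B" by (rule M.bicontinuously_isomorphic[OF \<xi>])
qed

end
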